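(* Let $\Omega\subset\mathbb{R}^n$ be a bounded domain, and let $u,v\in C^{1,1}(\Omega)\cap C^0(\bar\Omega)$ be respectively a supersolution and a subsolution of the equation $$F(D^2u-A(\cdot,u,Du))=B(\cdot,u,Du)\quad\text{in }\Omega .$$ Assume that $F\in C^0(\Gamma)$ satisfies F1$^-$, F2 and F3, $A\in C^2(\bar\Omega\times\mathbb{R}\times\mathbb{R}^n)$ is regular and nondecreasing in $z$, and $B\in C^2(\bar\Omega\times\mathbb{R}\times\mathbb{R}^n)$, $B\ge a_0$, is convex in $p$ and nondecreasing in $z$. Assume also that there exists a strict subsolution $\underline u\in C^{1,1}(\bar\Omega)$ of the equation satisfying $\underline u\ge u$ in $\Omega$. Then $$\sup_\Omega(v-u)\le\sup_{\partial\Omega}(v-u)^+,$$ where $(v-u)^+=\max\{v-u,0\}$.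
   Context: **Setting.** $\mathbb{S}^n$ is the space of real symmetric $n\times n$ matrices, $\Gamma\subset\mathbb{S}^n$, $\Gamma\neq\mathbb{S}^n$, is an open convex cone with vertex $0$ containing the cone of positive definite matrices; $A=A(x,z,p)$ takes values in $\mathbb{S}^n$, $B=B(x,z,p)$ is scalar; $M[u]=D^2u-A(\cdot,u,Du)$. $C^{1,1}(\Omega)$ is a local space ($Du$ is locally Lipschitz in $\Omega$). **Conditions on $F$.** - F1$^-$: $F(r+\eta)\ge F(r)$ for $r\in\Gamma$ and $\eta\ge0$ in $\mathbb{S}^n$, and $\liminf_{\sigma\to0}\frac{F(r+\sigma I)-F(r)}{\sigma}>0$ for all $r\in\Gamma$. - F2: $F$ is concave in $\Gamma$. - F3: $F(\Gamma)=(a_0,\infty)$ for a constant $a_0\ge-\infty$, and $\sup_{r_0\in\partial\Gamma}\limsup_{r\to r_0}F(r)\le a_0$. When $a_0$ is finite, $F$ is understood to be extended to $\bar\Gamma$ by $F=a_0$ on $\partial\Gamma$. **Regularity of $A$.** $A$ is regular if $\sum D^2_{p_kp_l}A_{ij}(x,z,p)\xi_i\xi_j\eta_k\eta_l\ge0$ for all $\xi\perp\eta$ in $\mathbb{R}^n$ and all $(x,z,p)\in\Omega\times\mathbb{R}\times\mathbb{R}^n$. $A$ nondecreasing in $z$ is in the sense of symmetric matrices. **Sub/supersolutions.** $v$ is a subsolution if $M[v]\in\bar\Gamma$ and $F(M[v])\ge B(\cdot,v,Dv)$ a.e. in $\Omega$ (with $M[v]\in\Gamma$ if $a_0=-\infty$).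 $u$ is a supersolution if $F(M[u])\le B(\cdot,u,Du)$ at almost every point where $M[u]\in\Gamma$. $\underline u\in C^{1,1}(\bar\Omega)$ is a strict subsolution if, for some constants $\bar\delta,\bar\delta'>0$, $M[\underline u]-\bar\delta I\in\Gamma$ and $F(M[\underline u]-\bar\delta I)\ge B(\cdot,\underline u,D\underline u)+\bar\delta'$ a.e. in $\Omega$. *)

theory Defs
  imports "HOL-Analysis.Analysis"
begin

section \<open>Symmetric matrices and the cone\<close>

definition sym_mats :: "(real^'n^'n) set" where
  "sym_mats = {r. transpose r = r}"

definition pos_semidef :: "real^'n^'n \<Rightarrow> bool" where
  "pos_semidef r \<longleftrightarrow> r \<in> sym_mats \<and> (\<forall>\<xi>. 0 \<le> \<xi> \<bullet> (r *v \<xi>))"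

definition pos_def :: "real^'n^'n \<Rightarrow> bool" where
  "pos_def r \<longleftrightarrow> r \<in> sym_mats \<and> (\<forall>\<xi>. \<xi> \<noteq> 0 \<longrightarrow> 0 < \<xi> \<bullet> (r *v \<xi>))"

text \<open>
  The library predicates \<^const>\<open>cone\<close> and \<^const>\<open>convex_cone\<close> force \<open>0 \<in> \<Gamma>\<close>, which an open cone
  different from the whole space cannot satisfy; hence only positive multiples are used.
  Openness and (below) the boundary are relative to the space of symmetric matrices, which has
  empty interior in the type of all matrices.
\<close>

definition admissible_cone :: "(real^'n^'n) set \<Rightarrow> bool" where
  "admissible_cone \<Gamma> \<longleftrightarrow>
     openin (top_of_set sym_mats) \<Gamma> \<and> \<Gamma> \<noteq> sym_mats \<and>
     convex \<Gamma> \<and> (\<forall>r\<in>\<Gamma>. \<forall>t>0. t *\<^sub>R r \<in> \<Gamma>) \<and>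
     {r. pos_def r} \<subseteq> \<Gamma>"

section \<open>Conditions on \<open>F\<close>\<close>

definition F1_minus :: "(real^'n^'n) set \<Rightarrow> (real^'n^'n \<Rightarrow> real) \<Rightarrow> bool" where
  "F1_minus \<Gamma> F \<longleftrightarrow>
     (\<forall>r\<in>\<Gamma>. \<forall>\<eta>. pos_semidef \<eta> \<longrightarrow> F r \<le> F (r + \<eta>)) \<and>
     (\<forall>r\<in>\<Gamma>. 0 < Liminf (at (0::real)) (\<lambda>\<sigma>. ereal ((F (r + \<sigma> *\<^sub>R mat 1) - F r) / \<sigma>)))"

definition F2 :: "(real^'n^'n) set \<Rightarrow> (real^'n^'n \<Rightarrow> real) \<Rightarrow> bool" where
  "F2 \<Gamma> F \<longleftrightarrow> concave_on \<Gamma> F"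

definition F3 :: "(real^'n^'n) set \<Rightarrow> ereal \<Rightarrow> (real^'n^'n \<Rightarrow> real) \<Rightarrow> bool" where
  "F3 \<Gamma> a\<^sub>0 F \<longleftrightarrow>
     a\<^sub>0 < \<infinity> \<and> F ` \<Gamma> = {t. a\<^sub>0 < ereal t} \<and>
     (SUP r\<^sub>0 \<in> top_of_set sym_mats frontier_of \<Gamma>. Limsup (at r\<^sub>0 within \<Gamma>) (\<lambda>r. ereal (F r))) \<le> a\<^sub>0"

text \<open>
  The extension of \<open>F\<close> by \<open>a\<^sub>0\<close> to the closure of \<open>\<Gamma>\<close>. It is only ever evaluated on the closure,
  and only on \<open>\<Gamma>\<close> itself when \<open>a\<^sub>0 = -\<infinity>\<close>.
\<close>

definition F_ext :: "(real^'n^'n) set \<Rightarrow> ereal \<Rightarrow> (real^'n^'n \<Rightarrow> real) \<Rightarrow> real^'n^'n \<Rightarrow> ereal" where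
  "F_ext \<Gamma> a\<^sub>0 F r = (if r \<in> \<Gamma> then ereal (F r) else a\<^sub>0)"

section \<open>Derivatives and function spaces\<close>

definition pd :: "'n \<Rightarrow> (real^'n \<Rightarrow> real) \<Rightarrow> real^'n \<Rightarrow> real" where
  "pd k f x = deriv (\<lambda>t. f (x + t *\<^sub>R axis k 1)) 0"

definition grad :: "(real^'n \<Rightarrow> real) \<Rightarrow> real^'n \<Rightarrow> real^'n" where
  "grad u x = (\<chi> i. pd i u x)"

text \<open>
  If \<open>grad u\<close> is locally Lipschitz, then by Rademacher's theorem the second derivatives exist
  almost everywhere; the values of \<open>hess u\<close> on the exceptional null set play no role below,
  since \<open>hess\<close> only occurs in statements that hold almost everywhere.
\<close>

definition hess :: "(real^'n \<Rightarrow> real) \<Rightarrow> real^'n \<Rightarrow> real^'n^'n" where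
  "hess u x = (\<chi> i j. pd i (pd j u) x)"

definition C11_loc :: "(real^'n) set \<Rightarrow> (real^'n \<Rightarrow> real) \<Rightarrow> bool" where
  "C11_loc \<Omega> u \<longleftrightarrow>
     (\<forall>x\<in>\<Omega>. u differentiable (at x)) \<and>
     (\<forall>x\<in>\<Omega>. \<exists>\<epsilon>>0. \<exists>L. L-lipschitz_on (ball x \<epsilon> \<inter> \<Omega>) (grad u))"

text \<open>
  \<open>C\<^sup>1\<^sup>,\<^sup>1\<close> and \<open>C\<^sup>2\<close> on a closed set \<open>closure U\<close> are understood as is usual for elliptic equations:
  the function has the required derivatives in the open set \<open>U\<close>, and these extend
  continuously to the closure. A Lipschitz gradient extends automatically.
\<close>

definition C11_closure :: "(real^'n) set \<Rightarrow> (real^'n \<Rightarrow> real) \<Rightarrow> bool" where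
  "C11_closure \<Omega> u \<longleftrightarrow>
     continuous_on (closure \<Omega>) u \<and>
     (\<forall>x\<in>\<Omega>. u differentiable (at x)) \<and>
     (\<exists>L. L-lipschitz_on \<Omega> (grad u))"

definition C2_closure :: "'a::real_normed_vector set \<Rightarrow> ('a \<Rightarrow> 'b::real_normed_vector) \<Rightarrow> bool" where
  "C2_closure U f \<longleftrightarrow>
     continuous_on (closure U) f \<and>
     (\<exists>(f' :: 'a \<Rightarrow> 'a \<Rightarrow>\<^sub>L 'b) (f'' :: 'a \<Rightarrow> 'a \<Rightarrow>\<^sub>L 'a \<Rightarrow>\<^sub>L 'b).
        continuous_on (closure U) f' \<and> continuous_on (closure U) f'' \<and>
        (\<forall>x\<in>U. (f has_derivative blinfun_apply (f' x)) (at x) \<and>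
               (f' has_derivative blinfun_apply (f'' x)) (at x)))"

section \<open>Conditions on \<open>A\<close> and \<open>B\<close>\<close>

type_synonym 'n coeffA = "real^'n \<Rightarrow> real \<Rightarrow> real^'n \<Rightarrow> real^'n^'n"
type_synonym 'n coeffB = "real^'n \<Rightarrow> real \<Rightarrow> real^'n \<Rightarrow> real"

definition regular_A :: "(real^'n) set \<Rightarrow> 'n coeffA \<Rightarrow> bool" where
  "regular_A \<Omega> A \<longleftrightarrow>
     (\<forall>x\<in>\<Omega>. \<forall>z p \<xi> \<eta>. \<xi> \<bullet> \<eta> = 0 \<longrightarrow>
        0 \<le> (\<Sum>i\<in>UNIV. \<Sum>j\<in>UNIV. \<Sum>k\<in>UNIV. \<Sum>l\<in>UNIV.
               pd k (pd l (\<lambda>q. A x z q $ i $ j)) p * \<xi> $ i * \<xi> $ j * \<eta> $ k * \<eta> $ l))"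

definition nondecreasing_A :: "(real^'n) set \<Rightarrow> 'n coeffA \<Rightarrow> bool" where
  "nondecreasing_A D A \<longleftrightarrow>
     (\<forall>x\<in>D. \<forall>p z z'. z \<le> z' \<longrightarrow> pos_semidef (A x z' p - A x z p))"

definition nondecreasing_B :: "(real^'n) set \<Rightarrow> 'n coeffB \<Rightarrow> bool" where
  "nondecreasing_B D B \<longleftrightarrow> (\<forall>x\<in>D. \<forall>p. mono (\<lambda>z. B x z p))"

definition convex_in_p :: "(real^'n) set \<Rightarrow> 'n coeffB \<Rightarrow> bool" where
  "convex_in_p D B \<longleftrightarrow> (\<forall>x\<in>D. \<forall>z. convex_on UNIV (B x z))"

section \<open>Subsolutions and supersolutions\<close>

definition Mop :: "'n coeffA \<Rightarrow> (real^'n \<Rightarrow> real) \<Rightarrow> real^'n \<Rightarrow> real^'n^'n" where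
  "Mop A u x = hess u x - A x (u x) (grad u x)"

definition subsolution ::
  "(real^'n) set \<Rightarrow> (real^'n^'n) set \<Rightarrow> ereal \<Rightarrow> (real^'n^'n \<Rightarrow> real) \<Rightarrow> 'n coeffA \<Rightarrow> 'n coeffB
     \<Rightarrow> (real^'n \<Rightarrow> real) \<Rightarrow> bool" where
  "subsolution \<Omega> \<Gamma> a\<^sub>0 F A B v \<longleftrightarrow>
     (AE x in lebesgue_on \<Omega>.
        Mop A v x \<in> closure \<Gamma> \<and> (a\<^sub>0 = -\<infinity> \<longrightarrow> Mop A v x \<in> \<Gamma>) \<and>
        F_ext \<Gamma> a\<^sub>0 F (Mop A v x) \<ge> ereal (B x (v x) (grad v x)))"

definition supersolution ::
  "(real^'n) set \<Rightarrow> (real^'n^'n) set \<Rightarrow> (real^'n^'n \<Rightarrow> real) \<Rightarrow> 'n coeffA \<Rightarrow> 'n coeffB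
     \<Rightarrow> (real^'n \<Rightarrow> real) \<Rightarrow> bool" where
  "supersolution \<Omega> \<Gamma> F A B u \<longleftrightarrow>
     (AE x in lebesgue_on \<Omega>.
        Mop A u x \<in> \<Gamma> \<longrightarrow> F (Mop A u x) \<le> B x (u x) (grad u x))"

definition strict_subsolution ::
  "(real^'n) set \<Rightarrow> (real^'n^'n) set \<Rightarrow> (real^'n^'n \<Rightarrow> real) \<Rightarrow> 'n coeffA \<Rightarrow> 'n coeffB
     \<Rightarrow> (real^'n \<Rightarrow> real) \<Rightarrow> bool" where
  "strict_subsolution \<Omega> \<Gamma> F A B w \<longleftrightarrow>
     (\<exists>\<delta>>0. \<exists>\<delta>'>0. AE x in lebesgue_on \<Omega>.
        Mop A w x - \<delta> *\<^sub>R mat 1 \<in> \<Gamma> \<and>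
        F (Mop A w x - \<delta> *\<^sub>R mat 1) \<ge> B x (w x) (grad w x) + \<delta>')"

end

theory Submission
  imports Defs
begin

text \<open>
  Suppose \<open>v - u\<close> exceeds its boundary bound somewhere. Write \<open>w\<close> for the difference of the strict
  subsolution and \<open>v\<close>, and perturb \<open>v\<close> to \<open>v + \<tau> exp (k w)\<close> with \<open>\<tau>\<close> small. At an interior
  maximum of \<open>v + \<tau> exp (k w) - u\<close> put \<open>s = \<tau> k exp (k w)\<close>, a number in \<open>(0, 1)\<close>, and let \<open>q = Dw\<close>.
  The gradient of \<open>u\<close> there is the convex combination, with weights \<open>1 - s\<close> and \<open>s\<close>, of the gradients
  of \<open>v\<close> and of the strict subsolution, and the Hessian of \<open>u\<close> dominates the same combination of
  Hessians plus \<open>s k (q \<otimes> q)\<close>. As \<open>u\<close> lies below \<open>v\<close> there and below the strict subsolution, monotonicity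
  in \<open>z\<close> allows \<open>A\<close> and \<open>B\<close> to be compared at the value of \<open>u\<close>. If \<open>A\<close> were convex in \<open>p\<close>, then \<open>M[u]\<close> would dominate the
  combination of \<open>M[v]\<close> and \<open>M\<close> of the strict subsolution, and the concavity of \<open>F\<close> and the convexity
  of \<open>B\<close> would give \<open>F(M[u]) \<ge> B + s \<delta>'\<close>, against the supersolution inequality. Regularity only gives
  convexity of \<open>\<xi> \<bullet> A \<xi>\<close> along directions orthogonal to \<open>\<xi>\<close>; the defect for general \<open>\<xi>\<close> is at most
  \<open>s (\<kappa> |q|\<^sup>2 |\<xi>|\<^sup>2 + C' (\<xi> \<bullet> q)\<^sup>2)\<close> with \<open>\<kappa>\<close> as small as desired (lemma \<open>regular_A_segment\<close>). Its second
  part is absorbed by the exponential, for \<open>k \<ge> C'\<close>, and its first part by the room \<open>\<delta>\<close> in the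
  strict subsolution. What then remains is a property of \<open>F\<close> on the cone (lemma \<open>touching_inequality\<close>).

  The inequalities hold only almost everywhere, so the maximum itself is of no use. Subtracting a
  small linear function \<open>\<zeta> \<bullet> x\<close> moves the maximum point, and the gradient at the new point is \<open>\<zeta>\<close>. Hence
  the gradient maps the set of such contact points onto a small ball. A Lipschitz map takes null
  sets to null sets, so some contact point avoids any prescribed null set (lemma
  \<open>contact_point_off_negligible\<close>), and the slack \<open>\<delta>, \<delta>'\<close> absorbs the small change of the gradient.

  At that contact point the iterated partial derivatives must form a symmetric matrix that is the
  derivative of the gradient. For almost every point this is Rademacher's theorem applied to the
  components of the gradient, together with the symmetry of second derivatives; it is derived here from
  the Vitali covering theorem (differentiability in one variable), Tonelli's theorem (directional
  derivatives) and integration over boxes (additivity in the direction).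
\<close>

section \<open>Lipschitz functions of one variable are differentiable almost everywhere\<close>

lemma bounded_no_limit_imp_oscillation:
  fixes Q :: "'a \<Rightarrow> real"
  assumes F: "F \<noteq> bot" and bd: "\<forall>\<^sub>F x in F. \<bar>Q x\<bar> \<le> M" and no: "\<nexists>D. (Q \<longlongrightarrow> D) F"
  obtains p q :: rat where "p < q"
    "\<exists>\<^sub>F x in F. Q x < of_rat p" "\<exists>\<^sub>F x in F. of_rat q < Q x"
proof -
  let ?l = "Liminf F (\<lambda>x. ereal (Q x))" and ?u = "Limsup F (\<lambda>x. ereal (Q x))"
  have le: "?l \<le> ?u" by (rule Liminf_le_Limsup[OF F])
  have u: "?u \<le> ereal M"
    by (rule Limsup_bounded) (use bd in \<open>auto elim!: eventually_mono\<close>)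
  have l: "ereal (-M) \<le> ?l"
    by (rule Liminf_bounded) (use bd in \<open>auto elim!: eventually_mono\<close>)
  have "?l \<noteq> ?u"
  proof
    assume eq: "?l = ?u"
    have "\<bar>?l\<bar> \<noteq> \<infinity>" using l u eq by auto
    then obtain D where D: "?l = ereal D" by auto
    have "((\<lambda>x. ereal (Q x)) \<longlongrightarrow> ereal D) F"
      using tendsto_iff_Liminf_eq_Limsup[OF F] D eq by metis
    then show False using no by auto
  qed
  with le have lu: "?l < ?u" by auto
  obtain a where a: "?l < ereal a" "ereal a < ?u" using lu ereal_dense2 by blast
  obtain b where b: "ereal a < ereal b" "ereal b < ?u" using a(2) ereal_dense2 by blast
  obtain c where c: "a < of_rat c" "of_rat c < (b::real)" using of_rat_dense b(1) by auto
  obtain d where d: "of_rat c < (of_rat d::real)" "of_rat d < (b::real)" using of_rat_dense c(2) by blast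
  have "\<exists>\<^sub>F x in F. Q x < of_rat c"
  proof (rule ccontr)
    assume "\<not> ?thesis"
    then have "\<forall>\<^sub>F x in F. ereal (of_rat c) \<le> ereal (Q x)"
      by (simp add: not_frequently not_less)
    then have "ereal (of_rat c) \<le> ?l" by (rule Liminf_bounded)
    then show False using a(1) c(1) by (meson ereal_less_eq(3) less_le_not_le order_trans not_le)
  qed
  moreover have "\<exists>\<^sub>F x in F. of_rat d < Q x"
  proof (rule ccontr)
    assume "\<not> ?thesis"
    then have "\<forall>\<^sub>F x in F. ereal (Q x) \<le> ereal (of_rat d)"
      by (simp add: not_frequently not_less)
    then have "?u \<le> ereal (of_rat d)" by (rule Limsup_bounded)
    then show False using b(2) d(2) by (meson ereal_less_eq(3) less_le_not_le order_trans not_le)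
  qed
  ultimately show thesis using that[of c d] d(1) by (simp add: of_rat_less)
qed

text \<open>
  A pair \<open>(c, r)\<close> stands for the interval of centre \<open>c\<close> and radius \<open>r\<close>. The finely covered points are
  those to which the Vitali covering theorem applies; they form a \<open>G\<^sub>\<delta>\<close> set for every \<open>K\<close>, however
  large, because arbitrary unions of open intervals are open.
\<close>

definition finely_covered :: "(real \<times> real) set \<Rightarrow> real set" where
  "finely_covered K = {x. \<forall>d>0. \<exists>(c, r)\<in>K. x \<in> ball c r \<and> r < d}"

lemma finely_covered_borel [measurable]: "finely_covered K \<in> sets borel"
proof -
  have "finely_covered K = (\<Inter>n. \<Union>(c, r)\<in>{(c, r)\<in>K. r < inverse (real (Suc n))}. ball c r)"
  proof (intro equalityI subsetI)
    fix x assume x: "x \<in> (\<Inter>n. \<Union>(c, r)\<in>{(c, r)\<in>K. r < inverse (real (Suc n))}. ball c r)"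
    show "x \<in> finely_covered K" unfolding finely_covered_def
    proof (intro CollectI allI impI)
      fix d :: real assume "0 < d"
      then obtain n where "inverse (real (Suc n)) < d" using reals_Archimedean by blast
      with x show "\<exists>(c, r)\<in>K. x \<in> ball c r \<and> r < d"
        by (fastforce dest: spec[of _ n])
    qed
  next
    fix x assume "x \<in> finely_covered K"
    then have "\<exists>(c, r)\<in>K. x \<in> ball c r \<and> r < inverse (real (Suc n))" for n
      unfolding finely_covered_def by (auto simp del: of_nat_Suc)
    then show "x \<in> (\<Inter>n. \<Union>(c, r)\<in>{(c, r)\<in>K. r < inverse (real (Suc n))}. ball c r)"
      by (fastforce simp del: of_nat_Suc)
  qed
  also have "\<dots> \<in> sets borel"
    by (intro sets.countable_INT borel_open open_UN image_subsetI) (auto intro!: borel_open)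
  finally show ?thesis .
qed

lemma finely_covered_disjoint_cover:
  assumes "open U" "E \<subseteq> U" "E \<subseteq> finely_covered K"
  obtains C where "countable C" "C \<subseteq> K" "\<And>c r. (c, r) \<in> C \<Longrightarrow> ball c r \<subseteq> U"
    "disjoint_family_on (\<lambda>(c, r). ball c r) C" "negligible (E - (\<Union>(c, r)\<in>C. ball c r))"
proof -
  let ?K = "{(c, r)\<in>K. ball c r \<subseteq> U}"
  have *: "\<exists>i. i \<in> ?K \<and> x \<in> ball (fst i) (snd i) \<and> snd i < d" if x: "x \<in> E" and d: "0 < d" for x d
  proof -
    obtain e where e: "e > 0" "ball x e \<subseteq> U" using assms x by (meson openE subsetD)
    have "0 < min d (e/2)" using d e by auto
    then obtain c r where cr: "(c, r) \<in> K" "x \<in> ball c r" "r < min d (e/2)"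
      using assms(3) x unfolding finely_covered_def by fast
    have "ball c r \<subseteq> ball x e"
    proof
      fix y assume "y \<in> ball c r"
      then show "y \<in> ball x e" using cr(2,3) by (auto simp: dist_real_def)
    qed
    then show ?thesis using cr e by (intro exI[of _ "(c, r)"]) auto
  qed
  obtain C where C: "countable C" "C \<subseteq> ?K"
    "pairwise (\<lambda>i j. disjnt (ball (fst i) (snd i)) (ball (fst j) (snd j))) C"
    "negligible (E - (\<Union>i \<in> C. ball (fst i) (snd i)))"
    using Vitali_covering_theorem_balls[of E ?K fst snd, OF *] by blast
  show thesis
  proof
    show "countable C" by fact
    show "C \<subseteq> K" using C(2) by auto
    show "\<And>c r. (c, r) \<in> C \<Longrightarrow> ball c r \<subseteq> U" using C(2) by auto
    show "disjoint_family_on (\<lambda>(c, r). ball c r) C"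
      using C(3) by (auto simp: disjoint_family_on_def pairwise_def disjnt_def split_beta)
    show "negligible (E - (\<Union>(c, r)\<in>C. ball c r))" using C(4) by (simp add: split_beta)
  qed
qed

lemma emeasure_interval_measure_ball:
  assumes "mono f" "continuous_on UNIV f" "0 \<le> r"
  shows "emeasure (interval_measure f) (ball c r) = ennreal (f (c + r) - f (c - r))"
proof (cases "r = 0")
  case False
  then have r: "c - r \<le> c + r" using assms by auto
  let ?M = "interval_measure f"
  have cont: "continuous_on {a..b} f" for a b
    using assms(2) by (auto intro: continuous_on_subset)
  have rc: "continuous (at_right a) f" for a
    using assms(2) by (auto simp: continuous_on_eq_continuous_at intro: continuous_at_imp_continuous_within)
  have Icc: "emeasure ?M {a..b} = ennreal (f b - f a)" if "a \<le> b" for a b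
    using emeasure_interval_measure_Icc[of a b f] that assms(1) cont by (simp add: monoD rc assms)
  have "emeasure ?M {c - r<..c + r} = emeasure ?M (ball c r \<union> {c + r..c + r})"
    using False assms(3) by (intro arg_cong[of _ _ "emeasure ?M"]) (auto simp: dist_real_def)
  also have "\<dots> = emeasure ?M (ball c r)"
    by (rule emeasure_Un_null_set) (auto simp: null_sets_def Icc simp del: atLeastAtMost_singleton)
  finally show ?thesis
    using emeasure_interval_measure_Ioc[of "c - r" "c + r" f] r assms(1) rc by (simp add: monoD)
qed auto

lemma emeasure_lborel_ball_real: "0 \<le> r \<Longrightarrow> emeasure lborel (ball c r :: real set) = ennreal (2 * r)"
  by (simp add: ball_eq_greaterThanLessThan)

text \<open>
  The Stieltjes measure of \<open>f\<close> turns sums of increments over disjoint intervals into a measure of a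
  union. A disjoint Vitali subfamily of steep intervals exhausts \<open>E\<close> up to a null set, and on each of
  its members the Stieltjes measure is at least \<open>q\<close> times the length.
\<close>

lemma steep_fine_cover_measure:
  assumes f: "mono f" "continuous_on UNIV f" and q: "0 < q"
    and E: "E \<in> sets borel" "E \<subseteq> finely_covered K" "E \<subseteq> U" and U: "open U"
    and K: "\<And>c r. (c, r) \<in> K \<Longrightarrow> 0 < r \<and> 2 * r * q < f (c + r) - f (c - r)"
  shows "ennreal q * emeasure lborel E \<le> emeasure (interval_measure f) U"
proof -
  obtain C where C: "countable C" "C \<subseteq> K" "\<And>c r. (c, r) \<in> C \<Longrightarrow> ball c r \<subseteq> U"
    "disjoint_family_on (\<lambda>(c, r). ball c r) C" "negligible (E - (\<Union>(c, r)\<in>C. ball c r))"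
    using finely_covered_disjoint_cover[OF U E(3,2)] by blast
  let ?W = "\<Union>(c, r)\<in>C. ball c r"
  have W: "?W \<in> sets borel" by (intro borel_open open_UN) auto
  have em: "emeasure M ?W = (\<integral>\<^sup>+i. emeasure M (ball (fst i) (snd i)) \<partial>count_space C)"
    if "sets M = sets borel" for M :: "real measure"
    using emeasure_UN_countable[of C "\<lambda>(c, r). ball c r" M] C(1,4) that by (auto simp: split_beta)
  have "emeasure lborel E \<le> emeasure lborel (?W \<union> (E - ?W))"
    using E(1) W by (intro emeasure_mono) auto
  also have "\<dots> = emeasure lborel ?W"
    using C(5) E(1) W by (intro emeasure_Un_null_set) (auto simp: negligible_iff_null_sets null_sets_def)
  finally have "ennreal q * emeasure lborel E \<le> ennreal q * emeasure lborel ?W"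
    by (rule mult_left_mono) auto
  also have "\<dots> = (\<integral>\<^sup>+i. ennreal q * emeasure lborel (ball (fst i) (snd i)) \<partial>count_space C)"
    by (subst em) (auto simp: nn_integral_cmult)
  also have "\<dots> \<le> (\<integral>\<^sup>+i. emeasure (interval_measure f) (ball (fst i) (snd i)) \<partial>count_space C)"
  proof (rule nn_integral_mono)
    fix i assume "i \<in> space (count_space C)"
    then have "(fst i, snd i) \<in> K" using C(2) by auto
    note k = K[OF this]
    then show "ennreal q * emeasure lborel (ball (fst i) (snd i)) \<le> emeasure (interval_measure f) (ball (fst i) (snd i))"
      using q by (auto simp add: emeasure_interval_measure_ball[OF f] emeasure_lborel_ball_real
          ennreal_mult[symmetric] algebra_simps simp del: ennreal_numeral intro!: ennreal_leI) 
  qed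
  also have "\<dots> = emeasure (interval_measure f) ?W" by (subst em) auto
  also have "\<dots> \<le> emeasure (interval_measure f) U"
    using C(3) U by (intro emeasure_mono) auto
  finally show ?thesis .
qed

text \<open>
  The counterpart for flat intervals. The open set \<open>W\<close> is the union of a disjoint Vitali subfamily;
  it must be returned explicitly, since the steep intervals are afterwards chosen inside it.
\<close>

lemma flat_fine_cover_measure:
  assumes f: "mono f" "continuous_on UNIV f" and p: "0 < p"
    and E: "E \<subseteq> finely_covered K" "E \<subseteq> V" and V: "open V"
    and K: "\<And>c r. (c, r) \<in> K \<Longrightarrow> 0 < r \<and> f (c + r) - f (c - r) < 2 * r * p"
  obtains W where "open W" "W \<subseteq> V" "negligible (E - W)"
    "emeasure (interval_measure f) W \<le> ennreal p * emeasure lborel V"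
proof -
  obtain C where C: "countable C" "C \<subseteq> K" "\<And>c r. (c, r) \<in> C \<Longrightarrow> ball c r \<subseteq> V"
    "disjoint_family_on (\<lambda>(c, r). ball c r) C" "negligible (E - (\<Union>(c, r)\<in>C. ball c r))"
    using finely_covered_disjoint_cover[OF V E(2,1)] by blast
  let ?W = "\<Union>(c, r)\<in>C. ball c r"
  have em: "emeasure M ?W = (\<integral>\<^sup>+i. emeasure M (ball (fst i) (snd i)) \<partial>count_space C)"
    if "sets M = sets borel" for M :: "real measure"
    using emeasure_UN_countable[of C "\<lambda>(c, r). ball c r" M] C(1,4) that by (auto simp: split_beta)
  have "emeasure (interval_measure f) ?W
      = (\<integral>\<^sup>+i. emeasure (interval_measure f) (ball (fst i) (snd i)) \<partial>count_space C)"
    by (subst em) auto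
  also have "\<dots> \<le> (\<integral>\<^sup>+i. ennreal p * emeasure lborel (ball (fst i) (snd i)) \<partial>count_space C)"
  proof (rule nn_integral_mono)
    fix i assume "i \<in> space (count_space C)"
    then have "(fst i, snd i) \<in> K" using C(2) by auto
    note k = K[OF this]
    then show "emeasure (interval_measure f) (ball (fst i) (snd i)) \<le> ennreal p * emeasure lborel (ball (fst i) (snd i))"
      using p by (auto simp add: emeasure_interval_measure_ball[OF f] emeasure_lborel_ball_real
          ennreal_mult[symmetric] algebra_simps simp del: ennreal_numeral intro!: ennreal_leI)
  qed
  also have "\<dots> = ennreal p * emeasure lborel ?W"
    by (subst em) (auto simp: nn_integral_cmult)
  also have "\<dots> \<le> ennreal p * emeasure lborel V"
    using C(3) V by (intro mult_left_mono emeasure_mono) auto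
  finally show thesis using C(3,5) by (intro that[of ?W]) auto
qed

text \<open>
  If \<open>E\<close> is a bounded part of the set and \<open>V\<close> an open set around \<open>E\<close> of almost the same measure,
  the two previous lemmas give \<open>q |E| \<le> \<mu>(W) \<le> p |V|\<close> for some \<open>W\<close> containing almost all of \<open>E\<close>,
  where \<open>\<mu>\<close> is the Stieltjes measure. Letting \<open>|V|\<close> decrease to \<open>|E|\<close> contradicts \<open>p < q\<close> unless
  \<open>|E| = 0\<close>.
\<close>

lemma flat_steep_fine_covers_null:
  assumes f: "mono f" "continuous_on UNIV f" and pq: "0 < p" "p < q"
    and K: "\<And>c r. (c, r) \<in> K \<Longrightarrow> 0 < r \<and> f (c + r) - f (c - r) < 2 * r * p"
    and L: "\<And>c r. (c, r) \<in> L \<Longrightarrow> 0 < r \<and> 2 * r * q < f (c + r) - f (c - r)"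
  shows "finely_covered K \<inter> finely_covered L \<in> null_sets lborel"
proof -
  let ?G = "finely_covered K \<inter> finely_covered L"
  have "?G \<inter> ball 0 (real n) \<in> null_sets lborel" for n
  proof -
    let ?E = "?G \<inter> ball 0 (real n)"
    have E: "?E \<in> sets borel" by simp
    have fin: "emeasure lborel ?E < \<infinity>"
    proof -
      have "emeasure lborel ?E \<le> emeasure lborel (ball (0::real) (real n))" by (rule emeasure_mono) auto
      also have "\<dots> < \<infinity>" by (simp add: emeasure_lborel_ball_real)
      finally show ?thesis .
    qed
    define m where "m = measure lborel ?E"
    have m: "emeasure lborel ?E = ennreal m" "0 \<le> m"
      unfolding m_def using fin by (auto simp: emeasure_eq_ennreal_measure)
    have "q * m \<le> p * m + e" if e: "0 < e" for e
    proof -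
      obtain V where V: "open V" "?E \<subseteq> V" "emeasure lborel (V - ?E) \<le> e / p"
        using outer_regular_lborel_le[OF E, of "e / p"] e pq by auto
      obtain W where W: "open W" "W \<subseteq> V" "negligible (?E - W)"
        "emeasure (interval_measure f) W \<le> ennreal p * emeasure lborel V"
        by (rule flat_fine_cover_measure[OF f pq(1) _ V(2,1) K]) auto
      have "?E - W \<in> null_sets lborel" using W(1,3) E by (auto simp: negligible_iff_null_sets null_sets_def)
      then have "emeasure lborel (?E \<inter> W \<union> (?E - W)) = emeasure lborel (?E \<inter> W)"
        using W(1) E by (intro emeasure_Un_null_set) auto
      moreover have "?E \<inter> W \<union> (?E - W) = ?E" by auto
      ultimately have "ennreal (q * m) = ennreal q * emeasure lborel (?E \<inter> W)"
        using m pq by (simp add: ennreal_mult)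
      also have "\<dots> \<le> emeasure (interval_measure f) W"
        using W(1) E pq by (intro steep_fine_cover_measure[OF f _ _ _ _ _ L]) auto
      also have "\<dots> \<le> ennreal p * emeasure lborel V" by fact
      also have "emeasure lborel V = emeasure lborel ?E + emeasure lborel (V - ?E)"
        using V E by (subst plus_emeasure) (auto intro!: arg_cong[of _ _ "emeasure lborel"])
      also have "ennreal p * \<dots> \<le> ennreal p * (ennreal m + ennreal (e / p))"
        using V(3) m by (intro mult_left_mono add_mono) auto
      also have "\<dots> = ennreal (p * m + e)"
        using m pq e by (simp add: ennreal_plus[symmetric] ennreal_mult[symmetric] field_simps del: ennreal_plus)
      finally show ?thesis using m pq e by (subst (asm) ennreal_le_iff) auto
    qed
    then have "q * m \<le> p * m" by (rule field_le_epsilon)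
    with pq m(2) have "m = 0" by (metis less_le mult_le_cancel_right not_le)
    then show ?thesis using m E by (auto simp: null_sets_def)
  qed
  then have "(\<Union>n. ?G \<inter> ball 0 (real n)) \<in> null_sets lborel" by (rule null_sets_UN)
  moreover have "(\<Union>n. ?G \<inter> ball 0 (real n)) = ?G"
    by (auto simp: reals_Archimedean2)
  ultimately show ?thesis by simp
qed

lemma small_slope_finely_covers:
  assumes f: "continuous_on UNIV (f :: real \<Rightarrow> real)"
    and fr: "\<exists>\<^sub>F y in at t. (f y - f t) / (y - t) < p"
  shows "t \<in> finely_covered {(c, r). 0 < r \<and> f (c + r) - f (c - r) < 2 * r * p}"
  unfolding finely_covered_def
proof (intro CollectI allI impI)
  fix d :: real assume d: "0 < d"
  have "\<exists>y. y \<noteq> t \<and> dist y t < d \<and> (f y - f t) / (y - t) < p"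
    using fr d unfolding frequently_at by auto
  then obtain y where y: "y \<noteq> t" "\<bar>y - t\<bar> < d" "(f y - f t) / (y - t) < p"
    by (auto simp: dist_real_def)
  define c where "c = (y + t) / 2"
  define r where "r = \<bar>y - t\<bar> / 2"
  have r: "0 < r" "r < d" using y d by (auto simp: r_def)
  have less: "f (c + r) - f (c - r) < 2 * r * p"
  proof (cases "y > t")
    case True
    then have *: "c + r = y" "c - r = t" "2 * r = y - t" by (auto simp: c_def r_def field_simps)
    show ?thesis unfolding * using y True by (simp add: field_simps)
  next
    case False
    then have *: "c + r = t" "c - r = y" "2 * r = t - y" by (auto simp: c_def r_def field_simps)
    have "(f y - f t) / (y - t) = (f t - f y) / (t - y)"
      by (metis minus_diff_eq minus_divide_divide)
    then show ?thesis unfolding * using y False by (simp add: field_simps)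
  qed
  \<comment> \<open>The interval between the two points has \<open>t\<close> as an endpoint; enlarge it a little.\<close>
  have "((\<lambda>e. 2 * (r + e) * p - (f (c + (r + e)) - f (c - (r + e)))) \<longlongrightarrow>
      2 * (r + 0) * p - (f (c + (r + 0)) - f (c - (r + 0)))) (at_right 0)"
    using f by (intro tendsto_intros continuous_on_tendsto_compose[OF f]) auto
  then have "\<forall>\<^sub>F e in at_right 0. 0 < 2 * (r + e) * p - (f (c + (r + e)) - f (c - (r + e)))"
    by (rule order_tendstoD) (use less in simp)
  moreover have "\<forall>\<^sub>F e in at_right 0. e \<in> {0<..<d - r}"
    by (rule eventually_at_rightI[of 0 "d - r"]) (use r in auto)
  ultimately have "\<forall>\<^sub>F e in at_right 0. 0 < 2 * (r + e) * p - (f (c + (r + e)) - f (c - (r + e))) \<and> e \<in> {0<..<d - r}"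
    by (rule eventually_conj)
  then obtain e where e: "0 < 2 * (r + e) * p - (f (c + (r + e)) - f (c - (r + e)))" "0 < e" "e < d - r"
    using eventually_happens[of _ "at_right (0::real)"] by auto
  have "t \<in> ball c (r + e)" using e(2) by (auto simp: dist_real_def c_def r_def field_simps)
  then show "\<exists>(c, r)\<in>{(c, r). 0 < r \<and> f (c + r) - f (c - r) < 2 * r * p}. t \<in> ball c r \<and> r < d"
    using e r by (intro bexI[of _ "(c, r + e)"]) auto
qed

lemma large_slope_finely_covers:
  assumes f: "continuous_on UNIV (f :: real \<Rightarrow> real)"
    and fr: "\<exists>\<^sub>F y in at t. q < (f y - f t) / (y - t)"
  shows "t \<in> finely_covered {(c, r). 0 < r \<and> 2 * r * q < f (c + r) - f (c - r)}"
proof -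
  have "\<exists>\<^sub>F y in at t. (- f y - - f t) / (y - t) < - q"
    using fr by (rule frequently_elim1) (simp add: minus_divide_left[symmetric] diff_divide_distrib)
  moreover have "continuous_on UNIV (\<lambda>x. - f x)" using f by (intro continuous_intros)
  ultimately have "t \<in> finely_covered {(c, r). 0 < r \<and> - f (c + r) - - f (c - r) < 2 * r * (- q)}"
    by (rule small_slope_finely_covers[rotated])
  moreover have "{(c, r). 0 < r \<and> - f (c + r) - - f (c - r) < 2 * r * (- q)}
      = {(c, r). 0 < r \<and> 2 * r * q < f (c + r) - f (c - r)}" by auto
  ultimately show ?thesis by simp
qed

lemma slope_Lipschitz_bound:
  fixes f :: "real \<Rightarrow> real"
  assumes "L-lipschitz_on UNIV f"
  shows "\<bar>(f y - f t) / (y - t)\<bar> \<le> L"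
proof (cases "y = t")
  case False
  then show ?thesis
    using lipschitz_onD[OF assms, of y t] by (simp add: dist_real_def field_simps)
qed (use lipschitz_on_nonneg[OF assms] in simp)

text \<open>
  Adding a multiple of the identity makes \<open>f\<close> monotone. Where the difference quotient of the monotone
  function has no limit it oscillates across two rationals \<open>p < q\<close>, so that the point is finely
  covered both by intervals of slope below \<open>p\<close> and by intervals of slope above \<open>q\<close>; there are only
  countably many such pairs.
\<close>

theorem Lipschitz_real_differentiable_AE:
  fixes f :: "real \<Rightarrow> real"
  assumes L: "L-lipschitz_on UNIV f"
  shows "AE t in lborel. \<exists>D. ((\<lambda>y. (f y - f t) / (y - t)) \<longlongrightarrow> D) (at t)"
proof -
  define g where "g x = f x + L * x" for x
  have slope: "(g y - g t) / (y - t) = (f y - f t) / (y - t) + L" if "y \<noteq> t" for y t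
    using that by (simp add: g_def field_simps)
  have cf: "continuous_on UNIV f" by (rule lipschitz_on_continuous_on[OF L])
  then have cg: "continuous_on UNIV g" unfolding g_def by (intro continuous_intros)
  have mg: "mono g"
  proof (rule monoI)
    fix x y :: real assume "x \<le> y"
    then show "g x \<le> g y" using lipschitz_onD[OF L, of x y] by (auto simp: dist_real_def g_def algebra_simps)
  qed
  define K where "K p = {(c, r). 0 < r \<and> g (c + r) - g (c - r) < 2 * r * p}" for p
  define H where "H q = {(c, r). 0 < r \<and> 2 * r * q < g (c + r) - g (c - r)}" for q
  define I where "I = {(p, q :: rat). 0 < p \<and> p < q}"
  have "(\<Union>(p, q)\<in>I. finely_covered (K (of_rat p)) \<inter> finely_covered (H (of_rat q))) \<in> null_sets lborel"
  proof (rule null_sets_UN')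
    show "countable I" by simp
    fix i assume "i \<in> I"
    then show "(case i of (p, q) \<Rightarrow> finely_covered (K (of_rat p)) \<inter> finely_covered (H (of_rat q))) \<in> null_sets lborel"
      by (auto simp: I_def K_def H_def of_rat_less intro!: flat_steep_fine_covers_null[OF mg cg, of "of_rat (fst i)" "of_rat (snd i)"])
  qed
  then show ?thesis
  proof (rule AE_I', intro subsetI)
    fix t assume "t \<in> {t \<in> space lborel. \<not> (\<exists>D. ((\<lambda>y. (f y - f t) / (y - t)) \<longlongrightarrow> D) (at t))}"
    then have no: "\<nexists>D. ((\<lambda>y. (f y - f t) / (y - t)) \<longlongrightarrow> D) (at t)" by simp
    let ?Q = "\<lambda>y. (f y - f t) / (y - t) + L"
    have "\<nexists>D. (?Q \<longlongrightarrow> D) (at t)"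
    proof
      assume "\<exists>D. (?Q \<longlongrightarrow> D) (at t)"
      then obtain D where "(?Q \<longlongrightarrow> D) (at t)" by blast
      then have "((\<lambda>y. ?Q y - L) \<longlongrightarrow> D - L) (at t)" by (intro tendsto_intros)
      then show False using no by auto
    qed
    moreover have "\<forall>\<^sub>F y in at t. \<bar>?Q y\<bar> \<le> L + L"
    proof (rule always_eventually, rule allI)
      fix y show "\<bar>?Q y\<bar> \<le> L + L"
        using slope_Lipschitz_bound[OF L, of y t] by linarith
    qed
    ultimately obtain p q :: rat where pq: "p < q" "\<exists>\<^sub>F y in at t. ?Q y < of_rat p" "\<exists>\<^sub>F y in at t. of_rat q < ?Q y"
      using bounded_no_limit_imp_oscillation[of "at t" ?Q "L + L"] by auto
    have "\<exists>y. ?Q y < of_rat p" using frequently_ex[OF pq(2)] .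
    then obtain y where "?Q y < of_rat p" by blast
    with slope_Lipschitz_bound[OF L, of y t] have "0 < (of_rat p :: real)" by linarith
    then have p: "0 < p" by simp
    have ne: "\<forall>\<^sub>F y in at t. y \<noteq> t" by (simp add: eventually_at_filter)
    have "\<exists>\<^sub>F y in at t. (g y - g t) / (y - t) < of_rat p"
      using frequently_eventually_conj[OF pq(2) ne] by (rule frequently_elim1) (simp add: slope)
    moreover have "\<exists>\<^sub>F y in at t. of_rat q < (g y - g t) / (y - t)"
      using frequently_eventually_conj[OF pq(3) ne] by (rule frequently_elim1) (simp add: slope)
    ultimately have "t \<in> finely_covered (K (of_rat p)) \<inter> finely_covered (H (of_rat q))"
      unfolding K_def H_def using small_slope_finely_covers[OF cg] large_slope_finely_covers[OF cg] by blast
    with p pq(1) show "t \<in> (\<Union>(p, q)\<in>I. finely_covered (K (of_rat p)) \<inter> finely_covered (H (of_rat q)))"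
      by (auto simp: I_def)
  qed
qed

section \<open>Directional derivatives of Lipschitz functions\<close>

definition diff_quotient :: "('a::euclidean_space \<Rightarrow> real) \<Rightarrow> 'a \<Rightarrow> real \<Rightarrow> 'a \<Rightarrow> real" where
  "diff_quotient f \<xi> t x = (f (x + t *\<^sub>R \<xi>) - f x) / t"

lemma diff_quotient_bound:
  assumes "L-lipschitz_on UNIV f"
  shows "\<bar>diff_quotient f \<xi> t x\<bar> \<le> L * norm \<xi>"
proof (cases "t = 0")
  case False
  then show ?thesis
    using lipschitz_onD[OF assms, of "x + t *\<^sub>R \<xi>" x] by (simp add: diff_quotient_def dist_norm field_simps)
qed (use lipschitz_on_nonneg[OF assms] in \<open>simp add: diff_quotient_def\<close>)

text \<open>
  A form of Tonelli's theorem for an arbitrary direction \<open>\<xi>\<close>, with no change of coordinates: by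
  translation invariance the measure of \<open>N\<close> is the average over \<open>t \<in> {0..1}\<close> of the integrals of
  \<open>indicator N (x + t *\<^sub>R \<xi>)\<close> over \<open>x\<close>, and exchanging the integrals gives \<open>0\<close>.
\<close>

lemma null_along_lines_imp_null:
  fixes N :: "'a::euclidean_space set"
  assumes N [measurable]: "N \<in> sets borel"
    and ae: "\<And>x. AE t in lborel. x + t *\<^sub>R \<xi> \<notin> N"
  shows "N \<in> null_sets lborel"
proof -
  have m: "(\<lambda>(t, x). indicator {0..1::real} t * indicator N (x + t *\<^sub>R \<xi>) :: ennreal)
      \<in> borel_measurable (lborel \<Otimes>\<^sub>M lborel)"
    by measurable
  have "emeasure lborel N = (\<integral>\<^sup>+t. indicator {0..1::real} t * emeasure lborel N \<partial>lborel)"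
    by (simp add: nn_integral_multc)
  also have "\<dots> = (\<integral>\<^sup>+t. (\<integral>\<^sup>+x. indicator {0..1::real} t * indicator N (x + t *\<^sub>R \<xi>) \<partial>lborel) \<partial>lborel)"
  proof (rule nn_integral_cong)
    fix t :: real
    have "emeasure lborel N = (\<integral>\<^sup>+x. indicator N x \<partial>distr lborel borel ((+) (t *\<^sub>R \<xi>)))"
      by (simp add: lborel_distr_plus)
    also have "\<dots> = (\<integral>\<^sup>+x. indicator N (x + t *\<^sub>R \<xi>) \<partial>lborel)"
      by (subst nn_integral_distr) (auto simp: add.commute)
    finally show "indicator {0..1::real} t * emeasure lborel N
        = (\<integral>\<^sup>+x. indicator {0..1::real} t * indicator N (x + t *\<^sub>R \<xi>) \<partial>lborel)"
      by (subst nn_integral_cmult) auto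
  qed
  also have "\<dots> = (\<integral>\<^sup>+x. (\<integral>\<^sup>+t. indicator {0..1::real} t * indicator N (x + t *\<^sub>R \<xi>) \<partial>lborel) \<partial>lborel)"
    using lborel_pair.Fubini'[OF m] by simp
  also have "\<dots> = (\<integral>\<^sup>+x. 0 \<partial>(lborel :: 'a measure))"
  proof (rule nn_integral_cong)
    fix x :: 'a
    have "(\<integral>\<^sup>+t. indicator {0..1::real} t * indicator N (x + t *\<^sub>R \<xi>) \<partial>lborel) = (\<integral>\<^sup>+t. 0 \<partial>(lborel :: real measure))"
      by (rule nn_integral_cong_AE) (use ae[of x] in \<open>auto elim!: eventually_mono\<close>)
    then show "(\<integral>\<^sup>+t. indicator {0..1::real} t * indicator N (x + t *\<^sub>R \<xi>) \<partial>lborel) = 0" by simp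
  qed
  finally show ?thesis using N by (auto simp: null_sets_def)
qed

lemma open_exists_less:
  fixes g :: "'i \<Rightarrow> 'a::topological_space \<Rightarrow> real"
  assumes "\<And>i. continuous_on UNIV (g i)"
  shows "open {x. \<exists>i. P i \<and> g i x < p}" "open {x. \<exists>i. P i \<and> p < g i x}"
proof -
  have "{x. \<exists>i. P i \<and> g i x < p} = (\<Union>i\<in>{i. P i}. {x. g i x < p})"
    "{x. \<exists>i. P i \<and> p < g i x} = (\<Union>i\<in>{i. P i}. {x. p < g i x})" by auto
  then show "open {x. \<exists>i. P i \<and> g i x < p}" "open {x. \<exists>i. P i \<and> p < g i x}"
    using assms by (auto intro!: open_UN open_Collect_less continuous_on_const)
qed

lemma frequently_at_0_iff:
  "(\<exists>\<^sub>F t in at (0::real). P t) \<longleftrightarrow> (\<forall>n. \<exists>t. (t \<noteq> 0 \<and> \<bar>t\<bar> < inverse (real (Suc n))) \<and> P t)"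
proof
  assume "\<exists>\<^sub>F t in at (0::real). P t"
  then show "\<forall>n. \<exists>t. (t \<noteq> 0 \<and> \<bar>t\<bar> < inverse (real (Suc n))) \<and> P t"
    unfolding frequently_at by (auto simp: dist_real_def simp del: of_nat_Suc)
next
  assume *: "\<forall>n. \<exists>t. (t \<noteq> 0 \<and> \<bar>t\<bar> < inverse (real (Suc n))) \<and> P t"
  show "\<exists>\<^sub>F t in at (0::real). P t" unfolding frequently_at
  proof (intro allI impI)
    fix d :: real assume "0 < d"
    then obtain n where "inverse (real (Suc n)) < d" using reals_Archimedean by blast
    with *[rule_format, of n] show "\<exists>x\<in>UNIV. x \<noteq> 0 \<and> dist x 0 < d \<and> P x"
      by (auto simp: dist_real_def simp del: of_nat_Suc)
  qed
qed

text \<open>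
  Divergence means oscillation across a pair of rationals. For a fixed level, the set of points where
  some small \<open>t\<close> gives a difference quotient below (or above) the level is open, even though \<open>t\<close>
  ranges over an uncountable set.
\<close>

lemma diff_quotient_diverges_borel:
  assumes L: "L-lipschitz_on UNIV f"
  shows "{x :: 'a::euclidean_space. \<nexists>D. ((\<lambda>t. diff_quotient f \<xi> t x) \<longlongrightarrow> D) (at 0)} \<in> sets borel"
proof -
  define lo where "lo p = {x. \<exists>\<^sub>F t in at 0. diff_quotient f \<xi> t x < p}" for p
  define hi where "hi q = {x. \<exists>\<^sub>F t in at 0. q < diff_quotient f \<xi> t x}" for q
  define I where "I = {(p, q :: rat). p < q}"
  have cf: "continuous_on UNIV f" by (rule lipschitz_on_continuous_on[OF L])
  have cont: "continuous_on UNIV (diff_quotient f \<xi> t)" for t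
  proof -
    have "continuous_on UNIV (\<lambda>x. (f (x + t *\<^sub>R \<xi>) - f x) * inverse t)"
      by (intro continuous_intros cf continuous_on_compose2[OF cf]) auto
    then show ?thesis by (simp add: diff_quotient_def[abs_def] divide_inverse)
  qed
  have Gd: "{x. \<forall>n. S n x} \<in> sets borel" if "\<And>n. open {x. S n x}" for S :: "nat \<Rightarrow> 'a \<Rightarrow> bool"
  proof -
    have "(\<Inter>n. {x. S n x}) \<in> sets borel" using that by (intro sets.countable_INT) auto
    moreover have "(\<Inter>n. {x. S n x}) = {x. \<forall>n. S n x}" by blast
    ultimately show ?thesis by simp
  qed
  have borel: "lo p \<in> sets borel" "hi p \<in> sets borel" for p
    unfolding lo_def hi_def frequently_at_0_iff
    by (rule Gd; rule open_exists_less[OF cont])+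
  have "{x. \<nexists>D. ((\<lambda>t. diff_quotient f \<xi> t x) \<longlongrightarrow> D) (at 0)} = (\<Union>i\<in>I. lo (of_rat (fst i)) \<inter> hi (of_rat (snd i)))" (is "?A = ?B")
  proof (intro equalityI subsetI)
    fix x assume "x \<in> ?A"
    then have no: "\<nexists>D. ((\<lambda>t. diff_quotient f \<xi> t x) \<longlongrightarrow> D) (at 0)" by simp
    have bd: "\<forall>\<^sub>F t in at 0. \<bar>diff_quotient f \<xi> t x\<bar> \<le> L * norm \<xi>" using diff_quotient_bound[OF L] by simp
    obtain p q :: rat where pq: "p < q" "\<exists>\<^sub>F t in at 0. diff_quotient f \<xi> t x < of_rat p" "\<exists>\<^sub>F t in at 0. of_rat q < diff_quotient f \<xi> t x"
      by (rule bounded_no_limit_imp_oscillation[OF at_neq_bot bd no])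
    then have "x \<in> lo (of_rat p) \<inter> hi (of_rat q)" "(p, q) \<in> I" by (simp_all add: lo_def hi_def I_def)
    then show "x \<in> ?B" by force
  next
    fix x assume "x \<in> ?B"
    then obtain p q :: rat where "(p, q) \<in> I" "x \<in> lo (of_rat p) \<inter> hi (of_rat q)" by force
    then have pq: "p < q" "\<exists>\<^sub>F t in at 0. diff_quotient f \<xi> t x < of_rat p" "\<exists>\<^sub>F t in at 0. of_rat q < diff_quotient f \<xi> t x"
      by (simp_all add: lo_def hi_def I_def)
    have False if lim: "((\<lambda>t. diff_quotient f \<xi> t x) \<longlongrightarrow> D) (at 0)" for D
    proof -
      have "\<not> D > of_rat p"
      proof
        assume "D > of_rat p"
        then have "\<forall>\<^sub>F t in at 0. diff_quotient f \<xi> t x > of_rat p" using lim by (rule order_tendstoD(1)[rotated])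
        then have "\<forall>\<^sub>F t in at 0. \<not> diff_quotient f \<xi> t x < of_rat p" by (rule eventually_mono) simp
        then show False using pq(2) by (simp add: frequently_def)
      qed
      moreover have "\<not> D < of_rat q"
      proof
        assume "D < of_rat q"
        then have "\<forall>\<^sub>F t in at 0. diff_quotient f \<xi> t x < of_rat q" using lim by (rule order_tendstoD(2)[rotated])
        then have "\<forall>\<^sub>F t in at 0. \<not> diff_quotient f \<xi> t x > of_rat q" by (rule eventually_mono) simp
        then show False using pq(3) by (simp add: frequently_def)
      qed
      moreover have "(of_rat p :: real) < of_rat q" using pq(1) by (simp add: of_rat_less)
      ultimately show False by linarith
    qed
    then show "x \<in> ?A" by auto
  qed
  moreover have "?B \<in> sets borel"
    by (rule sets.countable_UN'') (use borel in auto)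
  ultimately show ?thesis by simp
qed

lemma Lipschitz_directional_derivative_AE:
  fixes f :: "'a::euclidean_space \<Rightarrow> real"
  assumes L: "L-lipschitz_on UNIV f"
  shows "AE x in lborel. \<exists>D. ((\<lambda>t. diff_quotient f \<xi> t x) \<longlongrightarrow> D) (at 0)"
proof -
  let ?N = "{x. \<nexists>D. ((\<lambda>t. diff_quotient f \<xi> t x) \<longlongrightarrow> D) (at 0)}"
  have "?N \<in> null_sets lborel"
  proof (rule null_along_lines_imp_null[where \<xi> = \<xi>])
    show "?N \<in> sets borel" by (rule diff_quotient_diverges_borel[OF L])
  next
    fix x
    define g where "g s = f (x + s *\<^sub>R \<xi>)" for s
    have "(L * norm \<xi>)-lipschitz_on UNIV g"
    proof (rule lipschitz_onI)
      fix s t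
      have "dist (g s) (g t) \<le> L * dist (x + s *\<^sub>R \<xi>) (x + t *\<^sub>R \<xi>)"
        unfolding g_def by (rule lipschitz_onD[OF L]) auto
      also have "dist (x + s *\<^sub>R \<xi>) (x + t *\<^sub>R \<xi>) = norm \<xi> * dist s t"
        by (simp add: dist_norm algebra_simps flip: scaleR_diff_left)
      finally show "dist (g s) (g t) \<le> L * norm \<xi> * dist s t" by (simp add: mult.assoc)
    qed (use lipschitz_on_nonneg[OF L] in simp)
    from Lipschitz_real_differentiable_AE[OF this]
    show "AE s in lborel. x + s *\<^sub>R \<xi> \<notin> ?N"
    proof (rule eventually_mono)
      fix s assume "\<exists>D. ((\<lambda>y. (g y - g s) / (y - s)) \<longlongrightarrow> D) (at s)"
      then obtain D where "((\<lambda>y. (g y - g s) / (y - s)) \<longlongrightarrow> D) (at s)" by blast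
      then have "((\<lambda>t. (g (s + t) - g s) / t) \<longlongrightarrow> D) (at 0)"
        using LIM_offset_zero[of "\<lambda>y. (g y - g s) / (y - s)" D s] by simp
      then have "((\<lambda>t. diff_quotient f \<xi> t (x + s *\<^sub>R \<xi>)) \<longlongrightarrow> D) (at 0)"
        by (simp add: diff_quotient_def g_def algebra_simps)
      then show "x + s *\<^sub>R \<xi> \<notin> ?N" by auto
    qed
  qed
  then show ?thesis by (rule AE_I') auto
qed

section \<open>Additivity in the direction and Rademacher's theorem\<close>

lemma integrable_indicator_box_bounded:
  fixes h :: "'a::euclidean_space \<Rightarrow> real"
  assumes h [measurable]: "h \<in> borel_measurable borel" and bd: "AE x in lborel. \<bar>h x\<bar> \<le> c"
  shows "integrable lborel (\<lambda>x. indicator (box l u) x * h x)"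
proof (rule Bochner_Integration.integrable_bound)
  show "integrable lborel (\<lambda>x. indicator (box l u) x * c :: real)"
    using emeasure_lborel_box_finite[of l u] by (intro integrable_mult_left integrable_real_indicator) auto
  show "AE x in lborel. norm (indicator (box l u) x * h x) \<le> norm (indicator (box l u) x * c)"
    using bd by eventually_elim (auto simp: indicator_def)
qed measurable

text \<open>
  For \<open>d > |c|\<close>, the measure with density \<open>1 + h / d\<close> has the same values on boxes as Lebesgue measure.
  The two measures therefore coincide, and so do their densities.
\<close>

lemma zero_box_integrals_imp_AE_zero:
  fixes h :: "'a::euclidean_space \<Rightarrow> real"
  assumes h [measurable]: "h \<in> borel_measurable borel" and bd: "AE x in lborel. \<bar>h x\<bar> \<le> c"
    and zero: "\<And>l u. (\<integral>x. indicator (box l u) x * h x \<partial>lborel) = 0"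
  shows "AE x in lborel. h x = 0"
proof -
  define d where "d = \<bar>c\<bar> + 1"
  have d: "0 < d" by (simp add: d_def)
  define M where "M = density lborel (\<lambda>x. ennreal (1 + h x / d))"
  have "lborel = M"
  proof (rule lborel_eqI)
    fix l u :: 'a assume lu: "\<And>b. b \<in> Basis \<Longrightarrow> l \<bullet> b \<le> u \<bullet> b"
    note int = integrable_indicator_box_bounded[OF h bd, of l u]
    have int': "integrable lborel (indicator (box l u) :: 'a \<Rightarrow> real)"
      using emeasure_lborel_box_finite[of l u] by (intro integrable_real_indicator) auto
    have "emeasure M (box l u) = (\<integral>\<^sup>+x. ennreal (1 + h x / d) * indicator (box l u) x \<partial>lborel)"
      unfolding M_def by (rule emeasure_density) auto
    also have "\<dots> = (\<integral>\<^sup>+x. ennreal (indicator (box l u) x + (indicator (box l u) x * h x) / d) \<partial>lborel)"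
      by (intro nn_integral_cong) (auto simp: indicator_def)
    also have "\<dots> = ennreal (\<integral>x. indicator (box l u) x + (indicator (box l u) x * h x) / d \<partial>lborel)"
    proof (rule nn_integral_eq_integral)
      show "integrable lborel (\<lambda>x. indicator (box l u) x + indicator (box l u) x * h x / d)"
        using int int' by auto
      show "AE x in lborel. 0 \<le> indicator (box l u) x + indicator (box l u) x * h x / d"
        using bd by eventually_elim (auto simp: indicator_def d_def field_simps)
    qed
    also have "(\<integral>x. indicator (box l u) x + (indicator (box l u) x * h x) / d \<partial>lborel) = measure lborel (box l u)"
      using int int' by (subst Bochner_Integration.integral_add) (auto simp: zero)
    also have "ennreal \<dots> = emeasure lborel (box l u)"
      using emeasure_lborel_box_finite[of l u] by (simp add: emeasure_eq_ennreal_measure top.not_eq_extremum)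
    finally show "emeasure M (box l u) = (\<Prod>b\<in>Basis. (u - l) \<bullet> b)"
      using lu by simp
  qed (simp add: M_def)
  then have "density lborel (\<lambda>x. ennreal (1 + h x / d)) = density lborel (\<lambda>_. 1)"
    by (simp add: M_def density_1)
  then have "AE x in lborel. ennreal (1 + h x / d) = 1"
    by (intro sigma_finite_measure.density_unique[OF sigma_finite_lborel]) auto
  with bd show ?thesis
  proof eventually_elim
    case (elim x)
    have "0 \<le> 1 + h x / d" using elim(1) d by (auto simp: d_def field_simps)
    then have "1 + h x / d = 1" using elim(2) by (metis ennreal_1 ennreal_inj zero_le_one)
    with d show ?case by simp
  qed
qed

text \<open>
  Dominated convergence that allows the argument of \<open>Q n\<close> to be shifted by a vanishing vector: after a
  change of variables the shift acts on the box, whose indicator converges off its boundary.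
\<close>

lemma box_integral_shift_limit:
  fixes Q :: "nat \<Rightarrow> 'a::euclidean_space \<Rightarrow> real"
  assumes Q [measurable]: "\<And>n. Q n \<in> borel_measurable borel" and bd: "\<And>n x. \<bar>Q n x\<bar> \<le> c"
    and G [measurable]: "G \<in> borel_measurable borel"
    and lim: "AE x in lborel. (\<lambda>n. Q n x) \<longlonglongrightarrow> G x" and a: "a \<longlonglongrightarrow> 0"
  shows "(\<lambda>n. \<integral>x. indicator (box l u) x * Q n (x + a n) \<partial>lborel) \<longlonglongrightarrow> (\<integral>x. indicator (box l u) x * G x \<partial>lborel)"
proof -
  have "Bseq a" by (rule convergent_imp_Bseq) (rule convergentI[OF a])
  then obtain A where A: "\<And>n. norm (a n) \<le> A" by (metis BseqE)
  obtain R where R: "\<And>x. x \<in> box l u \<Longrightarrow> norm x \<le> R" using bounded_box[of l u] by (auto simp: bounded_iff)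
  have shift: "(\<integral>x. indicator (box l u) x * Q n (x + a n) \<partial>lborel) = (\<integral>y. indicator (box l u) (y - a n) * Q n y \<partial>lborel)" for n
  proof -
    have "(\<integral>y. indicator (box l u) (y - a n) * Q n y \<partial>lborel)
        = (\<integral>y. indicator (box l u) (y - a n) * Q n y \<partial>distr lborel borel ((+) (a n)))"
      by (simp add: lborel_distr_plus)
    also have "\<dots> = (\<integral>x. indicator (box l u) x * Q n (x + a n) \<partial>lborel)"
      by (subst integral_distr) (auto simp: add.commute)
    finally show ?thesis by simp
  qed
  have c: "0 \<le> c" using bd[of 0 0] by linarith
  have "(\<lambda>n. \<integral>y. indicator (box l u) (y - a n) * Q n y \<partial>lborel) \<longlonglongrightarrow> (\<integral>x. indicator (box l u) x * G x \<partial>lborel)"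
  proof (rule integral_dominated_convergence[where w = "\<lambda>y. indicator (cball 0 (R + A)) y * c"])
    show "integrable lborel (\<lambda>y :: 'a. indicator (cball 0 (R + A)) y * c)"
      using emeasure_lborel_cball_finite[of "0 :: 'a" "R + A"]
      by (intro integrable_mult_left integrable_real_indicator) auto
    show "AE y in lborel. norm (indicator (box l u) (y - a n) * Q n y) \<le> indicator (cball 0 (R + A)) y * c" for n
    proof (rule AE_I2)
      fix y :: 'a
      show "norm (indicator (box l u) (y - a n) * Q n y) \<le> indicator (cball 0 (R + A)) y * c"
      proof (cases "y - a n \<in> box l u")
        case True
        have "norm y \<le> norm (y - a n) + norm (a n)" by (metis diff_add_cancel norm_triangle_ineq)
        then have "y \<in> cball 0 (R + A)" using R[OF True] A[of n] by auto
        then show ?thesis using True bd[of n y] by simp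
      qed (use c in \<open>auto simp: indicator_def\<close>)
    qed
    have "frontier (box l u) \<in> null_sets lborel"
      using negligible_convex_frontier[of "box l u"]
      by (auto simp: negligible_iff_null_sets null_sets_def)
    then have "AE y in lborel. y \<notin> frontier (box l u)" by (rule AE_not_in)
    with lim show "AE y in lborel. (\<lambda>n. indicator (box l u) (y - a n) * Q n y) \<longlonglongrightarrow> indicator (box l u) y * G y"
    proof eventually_elim
      case (elim y)
      have y: "(\<lambda>n. y - a n) \<longlonglongrightarrow> y" using tendsto_diff[OF tendsto_const a, of y] by simp
      have "\<forall>\<^sub>F n in sequentially. (indicator (box l u) (y - a n) :: real) = indicator (box l u) y"
      proof (cases "y \<in> box l u")
        case True
        then have "\<forall>\<^sub>F n in sequentially. y - a n \<in> box l u" by (intro topological_tendstoD[OF y]) auto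
        then show ?thesis by eventually_elim (use True in simp)
      next
        case False
        then have "y \<in> - closure (box l u)" using elim(2) by (auto simp: frontier_def interior_open[OF open_box])
        then have "\<forall>\<^sub>F n in sequentially. y - a n \<in> - closure (box l u)" using y
          by (intro topological_tendstoD[OF y]) auto
        then show ?thesis by eventually_elim (use False closure_subset[of "box l u"] in \<open>auto simp: indicator_def\<close>)
      qed
      then have "(\<lambda>n. indicator (box l u) (y - a n) :: real) \<longlonglongrightarrow> indicator (box l u) y"
        by (rule tendsto_eventually)
      then show ?case using elim(1) by (rule tendsto_mult)
    qed
  qed measurable
  then show ?thesis by (simp add: shift)
qed

text \<open>
  The directional derivative, as a limit along the sequence \<open>1 / (n + 1)\<close>. This makes it Borel measurable
  everywhere, also at points where the limit for real \<open>t\<close> does not exist and the value is meaningless.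
\<close>
definition dir_deriv :: "('a::euclidean_space \<Rightarrow> real) \<Rightarrow> 'a \<Rightarrow> 'a \<Rightarrow> real" where
  "dir_deriv f \<xi> x = lim (\<lambda>n. diff_quotient f \<xi> (inverse (real (Suc n))) x)"

lemma filterlim_inverse_Suc: "filterlim (\<lambda>n. inverse (real (Suc n))) (at 0) sequentially"
  unfolding filterlim_at using LIMSEQ_inverse_real_of_nat by (auto simp del: of_nat_Suc)

lemma diff_quotient_limit_dd:
  assumes "((\<lambda>t. diff_quotient f \<xi> t x) \<longlongrightarrow> D) (at 0)"
  shows "dir_deriv f \<xi> x = D" "(\<lambda>n. diff_quotient f \<xi> (inverse (real (Suc n))) x) \<longlonglongrightarrow> D"
proof -
  show "(\<lambda>n. diff_quotient f \<xi> (inverse (real (Suc n))) x) \<longlonglongrightarrow> D"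
    by (rule filterlim_compose[OF assms filterlim_inverse_Suc])
  then show "dir_deriv f \<xi> x = D" unfolding dir_deriv_def by (rule limI)
qed

lemma diff_quotient_measurable:
  assumes L: "L-lipschitz_on UNIV f"
  shows "diff_quotient f \<xi> t \<in> borel_measurable borel"
proof -
  have cf: "continuous_on UNIV f" by (rule lipschitz_on_continuous_on[OF L])
  have "continuous_on UNIV (\<lambda>x. (f (x + t *\<^sub>R \<xi>) - f x) * inverse t)"
    by (intro continuous_intros cf continuous_on_compose2[OF cf]) auto
  then show ?thesis
    using borel_measurable_continuous_onI by (simp add: diff_quotient_def[abs_def] divide_inverse)
qed

lemma dir_deriv_measurable:
  assumes L: "L-lipschitz_on UNIV f"
  shows "dir_deriv f \<xi> \<in> borel_measurable borel"
  unfolding dir_deriv_def[abs_def] by (intro borel_measurable_lim_metric diff_quotient_measurable[OF L])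

lemma dd_AE_limit:
  assumes L: "L-lipschitz_on UNIV f"
  shows "AE x in lborel. ((\<lambda>t. diff_quotient f \<xi> t x) \<longlongrightarrow> dir_deriv f \<xi> x) (at 0)"
  using Lipschitz_directional_derivative_AE[OF L, of \<xi>]
  by eventually_elim (use diff_quotient_limit_dd in blast)

lemma dd_AE_bound:
  assumes L: "L-lipschitz_on UNIV f"
  shows "AE x in lborel. \<bar>dir_deriv f \<xi> x\<bar> \<le> L * norm \<xi>"
  using dd_AE_limit[OF L, of \<xi>]
proof eventually_elim
  case (elim x)
  have "((\<lambda>t. \<bar>diff_quotient f \<xi> t x\<bar>) \<longlongrightarrow> \<bar>dir_deriv f \<xi> x\<bar>) (at 0)" using elim by (rule tendsto_rabs)
  then show ?case by (rule tendsto_upperbound) (auto simp: diff_quotient_bound[OF L])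
qed

text \<open>
  The difference quotient in direction \<open>\<xi> + \<eta>\<close> at \<open>x\<close> is the one in direction \<open>\<eta>\<close> at \<open>x\<close> plus the
  one in direction \<open>\<xi>\<close> at the moved point \<open>x + t *\<^sub>R \<eta>\<close>. Nothing is known pointwise about the latter,
  but in an integral over a box the move disappears in the limit \<open>t \<longlonglongrightarrow> 0\<close>.
\<close>

lemma dir_deriv_add_AE:
  assumes L: "L-lipschitz_on UNIV f"
  shows "AE x in lborel. dir_deriv f (\<xi> + \<eta>) x = dir_deriv f \<xi> x + dir_deriv f \<eta> x"
proof -
  note [measurable] = dir_deriv_measurable[OF L] diff_quotient_measurable[OF L]
  define t where "t n = inverse (real (Suc n))" for n
  have t0: "t \<longlonglongrightarrow> 0" unfolding t_def by (rule LIMSEQ_inverse_real_of_nat)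
  have lim: "AE x in lborel. (\<lambda>n. diff_quotient f \<zeta> (t n) x) \<longlonglongrightarrow> dir_deriv f \<zeta> x" for \<zeta>
    using dd_AE_limit[OF L, of \<zeta>] unfolding t_def by eventually_elim (rule diff_quotient_limit_dd)
  have split: "diff_quotient f (\<xi> + \<eta>) s x = diff_quotient f \<xi> s (x + s *\<^sub>R \<eta>) + diff_quotient f \<eta> s x" for s x
    by (simp add: diff_quotient_def algebra_simps add_divide_distrib diff_divide_distrib)
  have int: "integrable lborel (\<lambda>x. indicator (box l u) x * dir_deriv f \<zeta> x)" for l u \<zeta>
    by (rule integrable_indicator_box_bounded[OF _ dd_AE_bound[OF L]]) measurable
  have int': "integrable lborel (\<lambda>x. indicator (box l u) x * diff_quotient f \<zeta> s (x + b))" for l u \<zeta> s b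
    by (rule integrable_indicator_box_bounded[where c = "L * norm \<zeta>"]) (auto simp: diff_quotient_bound[OF L])
  have eq: "(\<integral>x. indicator (box l u) x * dir_deriv f (\<xi> + \<eta>) x \<partial>lborel)
      = (\<integral>x. indicator (box l u) x * dir_deriv f \<xi> x \<partial>lborel) + (\<integral>x. indicator (box l u) x * dir_deriv f \<eta> x \<partial>lborel)" for l u
  proof (rule LIMSEQ_unique)
    show "(\<lambda>n. \<integral>x. indicator (box l u) x * diff_quotient f (\<xi> + \<eta>) (t n) (x + 0) \<partial>lborel)
        \<longlonglongrightarrow> (\<integral>x. indicator (box l u) x * dir_deriv f (\<xi> + \<eta>) x \<partial>lborel)"
      by (rule box_integral_shift_limit[OF _ diff_quotient_bound[OF L] _ lim]) auto
    have "(\<lambda>n. t n *\<^sub>R \<eta>) \<longlonglongrightarrow> 0" using tendsto_scaleR[OF t0 tendsto_const, of \<eta>] by simp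
    then have "(\<lambda>n. (\<integral>x. indicator (box l u) x * diff_quotient f \<xi> (t n) (x + t n *\<^sub>R \<eta>) \<partial>lborel)
          + (\<integral>x. indicator (box l u) x * diff_quotient f \<eta> (t n) (x + 0) \<partial>lborel))
        \<longlonglongrightarrow> (\<integral>x. indicator (box l u) x * dir_deriv f \<xi> x \<partial>lborel) + (\<integral>x. indicator (box l u) x * dir_deriv f \<eta> x \<partial>lborel)"
      by (intro tendsto_add box_integral_shift_limit[OF _ diff_quotient_bound[OF L] _ lim]) auto
    also have "(\<lambda>n. (\<integral>x. indicator (box l u) x * diff_quotient f \<xi> (t n) (x + t n *\<^sub>R \<eta>) \<partial>lborel)
          + (\<integral>x. indicator (box l u) x * diff_quotient f \<eta> (t n) (x + 0) \<partial>lborel))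
        = (\<lambda>n. \<integral>x. indicator (box l u) x * diff_quotient f (\<xi> + \<eta>) (t n) (x + 0) \<partial>lborel)"
      by (subst Bochner_Integration.integral_add[OF int' int', symmetric]) (simp only: split distrib_left add_0_right)
    finally show "(\<lambda>n. \<integral>x. indicator (box l u) x * diff_quotient f (\<xi> + \<eta>) (t n) (x + 0) \<partial>lborel)
        \<longlonglongrightarrow> (\<integral>x. indicator (box l u) x * dir_deriv f \<xi> x \<partial>lborel) + (\<integral>x. indicator (box l u) x * dir_deriv f \<eta> x \<partial>lborel)" .
  qed
  have "AE x in lborel. dir_deriv f (\<xi> + \<eta>) x - dir_deriv f \<xi> x - dir_deriv f \<eta> x = 0"
  proof (rule zero_box_integrals_imp_AE_zero)
    show "AE x in lborel. \<bar>dir_deriv f (\<xi> + \<eta>) x - dir_deriv f \<xi> x - dir_deriv f \<eta> x\<bar>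
        \<le> L * norm (\<xi> + \<eta>) + L * norm \<xi> + L * norm \<eta>"
      using dd_AE_bound[OF L, of "\<xi> + \<eta>"] dd_AE_bound[OF L, of \<xi>] dd_AE_bound[OF L, of \<eta>]
      by eventually_elim linarith
    fix l u
    have "(\<integral>x. indicator (box l u) x * (dir_deriv f (\<xi> + \<eta>) x - dir_deriv f \<xi> x - dir_deriv f \<eta> x) \<partial>lborel)
       = (\<integral>x. indicator (box l u) x * dir_deriv f (\<xi> + \<eta>) x - indicator (box l u) x * dir_deriv f \<xi> x
            - indicator (box l u) x * dir_deriv f \<eta> x \<partial>lborel)"
      by (simp only: right_diff_distrib)
    also have "\<dots> = (\<integral>x. indicator (box l u) x * dir_deriv f (\<xi> + \<eta>) x \<partial>lborel)
        - (\<integral>x. indicator (box l u) x * dir_deriv f \<xi> x \<partial>lborel) - (\<integral>x. indicator (box l u) x * dir_deriv f \<eta> x \<partial>lborel)"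
      by (simp only: Bochner_Integration.integral_diff Bochner_Integration.integrable_diff int)
    also have "\<dots> = 0" by (simp only: eq)
    finally show "(\<integral>x. indicator (box l u) x * (dir_deriv f (\<xi> + \<eta>) x - dir_deriv f \<xi> x - dir_deriv f \<eta> x) \<partial>lborel) = 0" .
  qed measurable
  then show ?thesis by eventually_elim simp
qed

lemma dir_deriv_scaleR_AE:
  assumes L: "L-lipschitz_on UNIV f"
  shows "AE x in lborel. dir_deriv f (c *\<^sub>R \<xi>) x = c * dir_deriv f \<xi> x"
proof (cases "c = 0")
  case True
  then show ?thesis by (simp add: dir_deriv_def diff_quotient_def)
next
  case False
  show ?thesis using dd_AE_limit[OF L, of \<xi>]
  proof eventually_elim
    case (elim x)
    have "((\<lambda>t. c * diff_quotient f \<xi> (c * t) x) \<longlongrightarrow> c * dir_deriv f \<xi> x) (at 0)"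
    proof (intro tendsto_intros filterlim_compose[OF elim])
      show "filterlim (\<lambda>t. c * t) (at 0) (at 0)"
        using False by (auto simp: filterlim_at eventually_at_filter intro!: tendsto_eq_intros)
    qed
    moreover have "(\<lambda>t. c * diff_quotient f \<xi> (c * t) x) = (\<lambda>t. diff_quotient f (c *\<^sub>R \<xi>) t x)"
      using False by (simp add: diff_quotient_def mult.commute)
    ultimately show ?case using diff_quotient_limit_dd(1) by metis
  qed
qed

lemma dir_deriv_linear_AE:
  assumes L: "L-lipschitz_on UNIV f" and S: "finite S"
  shows "AE x in lborel. dir_deriv f (\<Sum>b\<in>S. c b *\<^sub>R b) x = (\<Sum>b\<in>S. c b * dir_deriv f b x)"
  using S
proof induction
  case empty
  show ?case by (simp add: dir_deriv_def diff_quotient_def)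
next
  case (insert b S)
  show ?case
    using insert.IH dir_deriv_add_AE[OF L, of "c b *\<^sub>R b" "\<Sum>b\<in>S. c b *\<^sub>R b"] dir_deriv_scaleR_AE[OF L, of "c b" b]
    by eventually_elim (use insert.hyps in simp)
qed

text \<open>
  The Lipschitz bound makes the difference quotients equicontinuous in the direction, and the unit sphere
  is compact, so finitely many directions control all of them uniformly.
\<close>

lemma dense_directions_imp_has_derivative:
  fixes f :: "'a::euclidean_space \<Rightarrow> real"
  assumes L: "L-lipschitz_on UNIV f"
    and dense: "\<And>X. open X \<Longrightarrow> X \<noteq> {} \<Longrightarrow> \<exists>d\<in>D. d \<in> X"
    and lim: "\<And>\<xi>. \<xi> \<in> D \<Longrightarrow> ((\<lambda>t. diff_quotient f \<xi> t x) \<longlongrightarrow> G \<bullet> \<xi>) (at 0)"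
  shows "(f has_derivative (\<lambda>h. G \<bullet> h)) (at x)"
  unfolding has_derivative_at_alt
proof (intro conjI allI impI)
  show "bounded_linear (\<lambda>h. G \<bullet> h)" by (rule bounded_linear_inner_right)
  fix e :: real assume e: "0 < e"
  have L0: "0 \<le> L" by (rule lipschitz_on_nonneg[OF L])
  define k where "k = e / (2 * (L + norm G + 1))"
  have k: "0 < k" using e L0 by (auto simp: k_def intro!: divide_pos_pos add_nonneg_pos)
  have k': "(L + norm G) * k \<le> e / 2"
  proof -
    have "(L + norm G) * k \<le> (L + norm G + 1) * k" using k by (intro mult_right_mono) auto
    also have "\<dots> = e / 2" using L0 norm_ge_zero[of G] by (simp add: k_def field_simps add_nonneg_eq_0_iff)
    finally show ?thesis .
  qed
  have "sphere 0 1 \<subseteq> (\<Union>\<xi>\<in>D. ball \<xi> k)"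
  proof
    fix w :: 'a
    have "ball w k \<noteq> {}" using k by simp
    then obtain d where "d \<in> D" "d \<in> ball w k" using dense[of "ball w k"] by auto
    then show "w \<in> (\<Union>\<xi>\<in>D. ball \<xi> k)" by (auto simp: dist_commute)
  qed
  then obtain D' where D': "D' \<subseteq> D" "finite D'" "sphere 0 1 \<subseteq> (\<Union>\<xi>\<in>D'. ball \<xi> k)"
    using compactE_image[OF compact_sphere, of D "\<lambda>\<xi>. ball \<xi> k"] by blast
  have "\<forall>\<^sub>F t in at 0. \<forall>\<xi>\<in>D'. dist (diff_quotient f \<xi> t x) (G \<bullet> \<xi>) < e / 2"
    using D' e by (intro eventually_ball_finite ballI tendstoD lim) auto
  then obtain d where d: "0 < d" "\<And>t \<xi>. t \<noteq> 0 \<Longrightarrow> \<bar>t\<bar> < d \<Longrightarrow> \<xi> \<in> D' \<Longrightarrow> \<bar>diff_quotient f \<xi> t x - G \<bullet> \<xi>\<bar> < e / 2"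
    unfolding eventually_at by (auto simp: dist_real_def)
  show "\<exists>d>0. \<forall>y. norm (y - x) < d \<longrightarrow> norm (f y - f x - G \<bullet> (y - x)) \<le> e * norm (y - x)"
  proof (intro exI[of _ d] conjI allI impI)
    fix y assume y: "norm (y - x) < d"
    show "norm (f y - f x - G \<bullet> (y - x)) \<le> e * norm (y - x)"
    proof (cases "y = x")
      case False
      define t where "t = norm (y - x)"
      define w where "w = (y - x) /\<^sub>R t"
      have t: "0 < t" "\<bar>t\<bar> < d" using False y by (auto simp: t_def)
      have w: "y = x + t *\<^sub>R w" "norm w = 1" using t by (auto simp: w_def t_def)
      then obtain \<xi> where xi: "\<xi> \<in> D'" "norm (w - \<xi>) < k"
        using D'(3) by (force simp: dist_norm norm_minus_commute)
      have "\<bar>f (x + t *\<^sub>R w) - f (x + t *\<^sub>R \<xi>)\<bar> \<le> L * (t * norm (w - \<xi>))"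
        using lipschitz_onD[OF L, of "x + t *\<^sub>R w" "x + t *\<^sub>R \<xi>"] t
        by (simp add: dist_norm flip: scaleR_diff_right)
      also have "\<dots> \<le> L * (t * k)" using L0 t xi by (intro mult_left_mono) auto
      finally have 1: "\<bar>f (x + t *\<^sub>R w) - f (x + t *\<^sub>R \<xi>)\<bar> \<le> L * (t * k)" .
      have "\<bar>f (x + t *\<^sub>R \<xi>) - f x - t * (G \<bullet> \<xi>)\<bar> = t * \<bar>diff_quotient f \<xi> t x - G \<bullet> \<xi>\<bar>"
      proof -
        have "f (x + t *\<^sub>R \<xi>) - f x - t * (G \<bullet> \<xi>) = t * (diff_quotient f \<xi> t x - G \<bullet> \<xi>)"
          using t by (simp add: diff_quotient_def field_simps)
        then show ?thesis using t by (simp add: abs_mult)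
      qed
      also have "\<dots> \<le> t * (e / 2)" using d(2)[OF _ t(2) xi(1)] t by (intro mult_left_mono) auto
      finally have 2: "\<bar>f (x + t *\<^sub>R \<xi>) - f x - t * (G \<bullet> \<xi>)\<bar> \<le> t * (e / 2)" .
      have "\<bar>t * (G \<bullet> (w - \<xi>))\<bar> \<le> t * (norm G * norm (w - \<xi>))"
        using t Cauchy_Schwarz_ineq2[of G "w - \<xi>"] by (simp add: abs_mult)
      also have "\<dots> \<le> t * (norm G * k)" using t xi by (intro mult_left_mono) auto
      finally have 3: "\<bar>t * (G \<bullet> (w - \<xi>))\<bar> \<le> t * (norm G * k)" .
      have "f y - f x - G \<bullet> (y - x) = (f (x + t *\<^sub>R w) - f (x + t *\<^sub>R \<xi>)) + (f (x + t *\<^sub>R \<xi>) - f x - t * (G \<bullet> \<xi>)) - t * (G \<bullet> (w - \<xi>))"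
        using w(1) by (simp add: algebra_simps)
      then have "norm (f y - f x - G \<bullet> (y - x)) \<le> L * (t * k) + t * (e / 2) + t * (norm G * k)"
        using 1 2 3 by (simp only: real_norm_def)
      also have "\<dots> = t * ((L + norm G) * k + e / 2)" by (simp add: algebra_simps)
      also have "\<dots> \<le> t * (e / 2 + e / 2)" using k' t by (intro mult_left_mono) auto
      finally show ?thesis by (simp add: t_def mult.commute)
    qed simp
  qed (rule d)
qed

text \<open>
  Off one null set, all directions of a countable dense set have difference quotients that converge to
  values depending linearly on the direction.
\<close>

theorem Rademacher:
  fixes f :: "'a::euclidean_space \<Rightarrow> real"
  assumes L: "L-lipschitz_on UNIV f"
  shows "AE x in lborel. f differentiable (at x)"
proof -
  obtain D :: "'a set" where D: "countable D" "\<And>X. open X \<Longrightarrow> X \<noteq> {} \<Longrightarrow> \<exists>d\<in>D. d \<in> X"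
    using countable_dense_exists[where 'a = 'a] by blast
  have "AE x in lborel. \<forall>\<xi>\<in>D. ((\<lambda>t. diff_quotient f \<xi> t x) \<longlongrightarrow> (\<Sum>b\<in>Basis. dir_deriv f b x *\<^sub>R b) \<bullet> \<xi>) (at 0)"
  unfolding AE_ball_countable[OF D(1)]
  proof (rule ballI)
    fix \<xi> :: 'a
    show "AE x in lborel. ((\<lambda>t. diff_quotient f \<xi> t x) \<longlongrightarrow> (\<Sum>b\<in>Basis. dir_deriv f b x *\<^sub>R b) \<bullet> \<xi>) (at 0)"
      using dd_AE_limit[OF L, of \<xi>] dir_deriv_linear_AE[OF L finite_Basis, of "\<lambda>b. \<xi> \<bullet> b"]
    proof eventually_elim
      case (elim x)
      have "(\<Sum>b\<in>Basis. dir_deriv f b x *\<^sub>R b) \<bullet> \<xi> = (\<Sum>b\<in>Basis. (\<xi> \<bullet> b) * dir_deriv f b x)"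
        by (simp only: inner_sum_left inner_scaleR_left) (simp add: inner_commute mult.commute)
      then show ?case using elim by (simp add: euclidean_representation)
    qed
  qed
  then show ?thesis
  proof eventually_elim
    case (elim x)
    have "(f has_derivative (\<lambda>h. (\<Sum>b\<in>Basis. dir_deriv f b x *\<^sub>R b) \<bullet> h)) (at x)"
      using D(2) elim by (intro dense_directions_imp_has_derivative[OF L, where D = D]) blast+
    then show ?case unfolding differentiable_def by (rule exI[of _ "\<lambda>h. (\<Sum>b\<in>Basis. dir_deriv f b x *\<^sub>R b) \<bullet> h"])
  qed
qed

section \<open>Second derivatives of functions with locally Lipschitz gradient\<close>

text \<open>
  Near a given point, composing \<open>f\<close> with the nearest-point projection onto a small closed ball gives a
  globally Lipschitz function that agrees with \<open>f\<close> on the ball.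
\<close>

lemma locally_Lipschitz_differentiable_AE:
  fixes f :: "'a::euclidean_space \<Rightarrow> real"
  assumes \<Omega>: "open \<Omega>" and lip: "\<And>x. x \<in> \<Omega> \<Longrightarrow> \<exists>\<epsilon>>0. \<exists>L. L-lipschitz_on (ball x \<epsilon> \<inter> \<Omega>) f"
  shows "negligible {x \<in> \<Omega>. \<not> f differentiable (at x)}" (is "negligible ?N")
  unfolding locally_negligible_alt[of ?N]
proof
  fix x assume "x \<in> ?N"
  then have x: "x \<in> \<Omega>" by simp
  obtain \<epsilon> L where \<epsilon>: "0 < \<epsilon>" and L: "L-lipschitz_on (ball x \<epsilon> \<inter> \<Omega>) f" using lip[OF x] by blast
  obtain e where e: "0 < e" "cball x e \<subseteq> ball x \<epsilon> \<inter> \<Omega>"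
  proof -
    have "open (ball x \<epsilon> \<inter> \<Omega>)" "x \<in> ball x \<epsilon> \<inter> \<Omega>" using \<Omega> x \<epsilon> by auto
    then show thesis using that by (meson open_contains_cball)
  qed
  let ?c = "closest_point (cball x e)"
  let ?g = "\<lambda>y. f (?c y)"
  have cb: "convex (cball x e)" "closed (cball x e)" "cball x e \<noteq> {}" using e by auto
  have "L-lipschitz_on UNIV ?g"
  proof (rule lipschitz_onI)
    fix y z
    have "?c w \<in> ball x \<epsilon> \<inter> \<Omega>" for w by (rule subsetD[OF e(2) closest_point_in_set[OF cb(2,3)]])
    then have "dist (?g y) (?g z) \<le> L * dist (?c y) (?c z)" by (intro lipschitz_onD[OF L])
    also have "\<dots> \<le> L * dist y z"
      using closest_point_lipschitz[OF cb] lipschitz_on_nonneg[OF L] by (intro mult_left_mono) auto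
    finally show "dist (?g y) (?g z) \<le> L * dist y z" .
  qed (rule lipschitz_on_nonneg[OF L])
  then have "AE y in lborel. ?g differentiable (at y)" by (rule Rademacher)
  then obtain N where N: "\<And>y. y \<in> space lborel - N \<Longrightarrow> ?g differentiable (at y)" "N \<in> null_sets lborel"
    by (rule AE_E3) blast
  have "?N \<inter> ball x e \<subseteq> N"
  proof
    fix y assume y: "y \<in> ?N \<inter> ball x e"
    show "y \<in> N"
    proof (rule ccontr)
      assume "y \<notin> N"
      then have "?g differentiable (at y)" using N(1) by simp
      then obtain g' where "(?g has_derivative g') (at y)" unfolding differentiable_def by blast
      then have "(f has_derivative g') (at y)"
        by (rule has_derivative_transform_within_open[where s = "ball x e"]) (use y in \<open>auto simp: closest_point_self\<close>)
      then show False using y unfolding differentiable_def by auto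
    qed
  qed
  moreover have "negligible N" using N(2) by (auto simp: negligible_iff_null_sets null_sets_completionI)
  ultimately have "negligible (?N \<inter> ball x e)" by (rule negligible_subset[rotated])
  moreover have "openin (top_of_set ?N) (?N \<inter> ball x e)" by (rule openin_open_Int) simp
  ultimately show "\<exists>U. openin (top_of_set ?N) U \<and> x \<in> U \<and> negligible U"
    using \<open>x \<in> ?N\<close> e by (intro exI[of _ "?N \<inter> ball x e"]) auto
qed

text \<open>
  The mean value theorem in direction \<open>b\<close> expresses the second difference by a difference of \<open>g\<close> between
  two points within distance \<open>O(t)\<close> of \<open>x\<close>, where \<open>g\<close> may be replaced by its linearisation. The
  symmetry of second derivatives follows because the second difference is symmetric in \<open>a\<close> and \<open>b\<close>.
\<close>

lemma second_difference_expansion: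
  fixes u :: "'a::euclidean_space \<Rightarrow> real"
  assumes S: "open S" "x \<in> S" and u: "\<forall>y\<in>S. (u has_derivative (\<lambda>h. g y \<bullet> h)) (at y)"
    and g: "(g has_derivative g') (at x)" and e: "0 < e"
  shows "\<forall>\<^sub>F t in at_right 0. \<bar>(u (x + t *\<^sub>R a + t *\<^sub>R b) - u (x + t *\<^sub>R a) - u (x + t *\<^sub>R b) + u x) - t\<^sup>2 * (g' a \<bullet> b)\<bar> \<le> e * t\<^sup>2"
proof -
  interpret g': bounded_linear g' using g by (rule has_derivative_bounded_linear)
  define R where "R = norm a + norm b"
  have R: "0 \<le> R" by (simp add: R_def)
  define k where "k = e / (2 * (R + 1) * (norm b + 1))"
  have k: "0 < k" using e R by (auto simp: k_def intro!: divide_pos_pos mult_pos_pos add_nonneg_pos)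
  have k': "2 * (k * R) * norm b \<le> e"
  proof -
    have "2 * (k * R) * norm b \<le> 2 * (k * (R + 1)) * (norm b + 1)"
      using k R by (intro mult_mono) auto
    also have "\<dots> = e" using R norm_ge_zero[of b] by (simp add: k_def field_simps add_nonneg_eq_0_iff)
    finally show ?thesis .
  qed
  obtain d1 where d1: "0 < d1" "ball x d1 \<subseteq> S" using S by (meson openE)
  obtain d2 where d2: "0 < d2" "\<And>y. norm (y - x) < d2 \<Longrightarrow> norm (g y - g x - g' (y - x)) \<le> k * norm (y - x)"
    using g k unfolding has_derivative_at_alt by blast
  define T where "T = min d1 d2 / (R + 1)"
  have T: "0 < T" using d1 d2 R by (auto simp: T_def)
  show ?thesis
  proof (rule eventually_at_rightI[OF _ T])
    fix t assume "t \<in> {0<..<T}"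
    then have t: "0 < t" "t < T" by auto
    have tR: "t * R < min d1 d2"
    proof -
      have "t * R \<le> t * (R + 1)" using t by (intro mult_left_mono) auto
      also have "\<dots> < min d1 d2" using t(2) R by (simp add: T_def field_simps)
      finally show ?thesis .
    qed
    have near: "norm (s *\<^sub>R a + r *\<^sub>R b) \<le> t * R" if "0 \<le> s" "s \<le> t" "0 \<le> r" "r \<le> t" for s r
    proof -
      have "norm (s *\<^sub>R a + r *\<^sub>R b) \<le> s * norm a + r * norm b"
        using norm_triangle_ineq[of "s *\<^sub>R a" "r *\<^sub>R b"] that by simp
      also have "\<dots> \<le> t * norm a + t * norm b" using that by (intro add_mono mult_right_mono) auto
      finally show ?thesis by (simp add: R_def algebra_simps)
    qed
    have inS: "x + (s *\<^sub>R a + r *\<^sub>R b) \<in> S" if "0 \<le> s" "s \<le> t" "0 \<le> r" "r \<le> t" for s r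
    proof -
      have "dist x (x + w) = norm w" for w by (simp add: dist_norm)
      then show ?thesis using near[OF that] tR by (intro subsetD[OF d1(2)]) simp
    qed
    have gexp: "norm (g (x + (s *\<^sub>R a + r *\<^sub>R b)) - g x - (s *\<^sub>R g' a + r *\<^sub>R g' b)) \<le> k * (t * R)"
      if "0 \<le> s" "s \<le> t" "0 \<le> r" "r \<le> t" for s r
    proof -
      have "norm (g (x + (s *\<^sub>R a + r *\<^sub>R b)) - g x - g' (s *\<^sub>R a + r *\<^sub>R b)) \<le> k * norm (s *\<^sub>R a + r *\<^sub>R b)"
        using d2(2)[of "x + (s *\<^sub>R a + r *\<^sub>R b)"] near[OF that] tR by auto
      also have "\<dots> \<le> k * (t * R)" using near[OF that] k by (intro mult_left_mono) auto
      finally show ?thesis by (simp add: g'.add g'.scaleR)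
    qed
    define \<phi> where "\<phi> r = u (x + (t *\<^sub>R a + r *\<^sub>R b)) - u (x + (0 *\<^sub>R a + r *\<^sub>R b))" for r
    have der: "(\<phi> has_derivative (\<lambda>h. h * ((g (x + (t *\<^sub>R a + r *\<^sub>R b)) - g (x + (0 *\<^sub>R a + r *\<^sub>R b))) \<bullet> b))) (at r within {0..t})"
      if r: "0 \<le> r" "r \<le> t" for r
    proof -
      have 1: "((\<lambda>r. u (x + (s *\<^sub>R a + r *\<^sub>R b))) has_derivative (\<lambda>h. g (x + (s *\<^sub>R a + r *\<^sub>R b)) \<bullet> (h *\<^sub>R b))) (at r within {0..t})"
        if "0 \<le> s" "s \<le> t" for s
      proof (rule has_derivative_compose[where f = "\<lambda>r. x + (s *\<^sub>R a + r *\<^sub>R b)" and g = u])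
        show "((\<lambda>r. x + (s *\<^sub>R a + r *\<^sub>R b)) has_derivative (\<lambda>h. h *\<^sub>R b)) (at r within {0..t})"
          by (auto intro!: derivative_eq_intros)
        show "(u has_derivative (\<lambda>h. g (x + (s *\<^sub>R a + r *\<^sub>R b)) \<bullet> h)) (at (x + (s *\<^sub>R a + r *\<^sub>R b)))"
          using u inS[OF that r] by blast
      qed
      have "(\<phi> has_derivative (\<lambda>h. g (x + (t *\<^sub>R a + r *\<^sub>R b)) \<bullet> (h *\<^sub>R b) - g (x + (0 *\<^sub>R a + r *\<^sub>R b)) \<bullet> (h *\<^sub>R b))) (at r within {0..t})"
        unfolding \<phi>_def using t by (intro has_derivative_diff 1) auto
      then show ?thesis by (simp add: inner_diff_left algebra_simps)
    qed
    obtain r where r: "r \<in> {0<..<t}" and eq: "\<phi> t - \<phi> 0 = (t - 0) * ((g (x + (t *\<^sub>R a + r *\<^sub>R b)) - g (x + (0 *\<^sub>R a + r *\<^sub>R b))) \<bullet> b)"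
      using mvt_simple[OF t(1), of \<phi> "\<lambda>r h. h * ((g (x + (t *\<^sub>R a + r *\<^sub>R b)) - g (x + (0 *\<^sub>R a + r *\<^sub>R b))) \<bullet> b)"] der
      by (auto simp: greaterThanLessThan_iff)
    let ?E1 = "g (x + (t *\<^sub>R a + r *\<^sub>R b)) - g x - (t *\<^sub>R g' a + r *\<^sub>R g' b)"
    let ?E2 = "g (x + (0 *\<^sub>R a + r *\<^sub>R b)) - g x - (0 *\<^sub>R g' a + r *\<^sub>R g' b)"
    have E: "norm ?E1 \<le> k * (t * R)" "norm ?E2 \<le> k * (t * R)"
      using r t by (intro gexp; simp)+
    have "u (x + t *\<^sub>R a + t *\<^sub>R b) - u (x + t *\<^sub>R a) - u (x + t *\<^sub>R b) + u x = \<phi> t - \<phi> 0"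
      by (simp add: \<phi>_def add.assoc)
    also have "\<dots> = t * ((t *\<^sub>R g' a + (?E1 - ?E2)) \<bullet> b)"
      unfolding eq by (simp add: algebra_simps)
    also have "\<dots> = t\<^sup>2 * (g' a \<bullet> b) + t * ((?E1 - ?E2) \<bullet> b)"
      by (simp only: inner_add_left inner_scaleR_left) (simp add: power2_eq_square algebra_simps)
    finally have "\<bar>(u (x + t *\<^sub>R a + t *\<^sub>R b) - u (x + t *\<^sub>R a) - u (x + t *\<^sub>R b) + u x) - t\<^sup>2 * (g' a \<bullet> b)\<bar>
        = t * \<bar>(?E1 - ?E2) \<bullet> b\<bar>" using t by (simp add: abs_mult)
    also have "\<bar>(?E1 - ?E2) \<bullet> b\<bar> \<le> norm (?E1 - ?E2) * norm b" by (rule Cauchy_Schwarz_ineq2)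
    also have "norm (?E1 - ?E2) \<le> k * (t * R) + k * (t * R)"
      using norm_triangle_ineq4[of ?E1 ?E2] E by linarith
    also have "t * ((k * (t * R) + k * (t * R)) * norm b) = t\<^sup>2 * (2 * (k * R) * norm b)"
      by (simp add: power2_eq_square algebra_simps)
    also have "\<dots> \<le> t\<^sup>2 * e" using k' by (intro mult_left_mono) auto
    finally show "\<bar>(u (x + t *\<^sub>R a + t *\<^sub>R b) - u (x + t *\<^sub>R a) - u (x + t *\<^sub>R b) + u x) - t\<^sup>2 * (g' a \<bullet> b)\<bar> \<le> e * t\<^sup>2"
      using t by (simp add: mult.commute mult_left_mono mult_right_mono)
  qed
qed

lemma derivative_of_gradient_symmetric:
  fixes u :: "'a::euclidean_space \<Rightarrow> real"
  assumes S: "open S" "x \<in> S" and u: "\<forall>y\<in>S. (u has_derivative (\<lambda>h. g y \<bullet> h)) (at y)"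
    and g: "(g has_derivative g') (at x)"
  shows "g' a \<bullet> b = g' b \<bullet> a"
proof -
  have "\<bar>g' a \<bullet> b - g' b \<bullet> a\<bar> \<le> 0 + e" if e: "0 < e" for e
  proof -
    have "0 < e / 2" using e by simp
    note * = second_difference_expansion[OF S u g this]
    have "\<forall>\<^sub>F t in at_right (0::real). 0 < t" by (simp add: eventually_at_right_less)
    with *[of a b] *[of b a] have "\<forall>\<^sub>F t in at_right (0::real). \<bar>g' a \<bullet> b - g' b \<bullet> a\<bar> \<le> e"
    proof eventually_elim
      case (elim t)
      have sw: "u (x + t *\<^sub>R b + t *\<^sub>R a) = u (x + t *\<^sub>R a + t *\<^sub>R b)" by (simp add: add_ac)
      have "t\<^sup>2 * \<bar>g' a \<bullet> b - g' b \<bullet> a\<bar> = \<bar>t\<^sup>2 * (g' a \<bullet> b) - t\<^sup>2 * (g' b \<bullet> a)\<bar>"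
        by (simp add: abs_mult flip: right_diff_distrib)
      also have "\<dots> \<le> e / 2 * t\<^sup>2 + e / 2 * t\<^sup>2"
        using elim(1,2) unfolding sw by linarith
      also have "\<dots> = t\<^sup>2 * e" by simp
      finally show ?case using elim(3) by simp
    qed
    then show ?thesis using eventually_happens[of _ "at_right (0::real)"] by auto
  qed
  then have "\<bar>g' a \<bullet> b - g' b \<bullet> a\<bar> \<le> 0" by (rule field_le_epsilon)
  then show ?thesis by simp
qed

lemma pd_eq_derivative:
  assumes "(f has_derivative f') (at x)"
  shows "pd k f x = f' (axis k 1)"
proof -
  have "((\<lambda>t. f (x + t *\<^sub>R axis k 1)) has_derivative (\<lambda>t. f' (t *\<^sub>R axis k 1))) (at 0)"
    by (rule has_derivative_compose[where g = f]) (use assms in \<open>auto intro!: derivative_eq_intros\<close>)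
  moreover have "(\<lambda>t. f' (t *\<^sub>R axis k 1)) = (*) (f' (axis k 1))"
    using has_derivative_linear[OF assms] by (auto simp: linear_cmul)
  ultimately have "((\<lambda>t. f (x + t *\<^sub>R axis k 1)) has_field_derivative f' (axis k 1)) (at 0)"
    by (simp add: has_field_derivative_def)
  then show ?thesis unfolding pd_def by (rule DERIV_imp_deriv)
qed

lemma has_derivative_grad:
  fixes f :: "real^'n \<Rightarrow> real"
  assumes "f differentiable (at x)"
  shows "(f has_derivative (\<lambda>h. grad f x \<bullet> h)) (at x)"
proof -
  obtain f' where f': "(f has_derivative f') (at x)" using assms unfolding differentiable_def by blast
  have "f' h = grad f x \<bullet> h" for h
  proof -
    have "f' h = f' (\<Sum>i\<in>UNIV. h $ i *\<^sub>R axis i 1)" by (simp add: basis_expansion flip: scalar_mult_eq_scaleR)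
    also have "\<dots> = (\<Sum>i\<in>UNIV. h $ i * f' (axis i 1))"
      using has_derivative_linear[OF f'] by (simp add: linear_sum linear_cmul)
    also have "\<dots> = grad f x \<bullet> h" by (simp add: inner_vec_def grad_def pd_eq_derivative[OF f'] mult.commute)
    finally show ?thesis .
  qed
  then have "f' = (\<lambda>h. grad f x \<bullet> h)" by blast
  with f' show ?thesis by simp
qed

text \<open>
  By the index convention of \<open>hess\<close>, the derivative of the gradient is first obtained as the transpose
  of \<open>hess u x\<close>; symmetry then removes the transposition.
\<close>

lemma grad_has_derivative_hess:
  fixes u :: "real^'n \<Rightarrow> real"
  assumes S: "open S" "x \<in> S" and u: "\<And>y. y \<in> S \<Longrightarrow> u differentiable (at y)"
    and pd: "\<And>j. pd j u differentiable (at x)"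
  shows "(grad u has_derivative (\<lambda>h. hess u x *v h)) (at x)" "hess u x \<in> sym_mats"
proof -
  let ?H = "transpose (hess u x)"
  have g: "(grad u has_derivative (\<lambda>h. ?H *v h)) (at x)"
    unfolding has_derivative_componentwise_within[of "grad u"]
  proof
    fix b :: "real^'n" assume "b \<in> Basis"
    then obtain j where b: "b = axis j 1" unfolding Basis_vec_def by auto
    have 1: "(\<lambda>y. grad u y \<bullet> b) = pd j u" by (auto simp: b grad_def inner_axis)
    have "(?H *v h) \<bullet> b = (?H *v h) $ j" for h by (simp add: b inner_axis)
    then have 2: "(\<lambda>h. (?H *v h) \<bullet> b) = (\<lambda>h. grad (pd j u) x \<bullet> h)"
      by (simp add: matrix_vector_mult_def transpose_def hess_def grad_def inner_vec_def)
    show "((\<lambda>y. grad u y \<bullet> b) has_derivative (\<lambda>h. (?H *v h) \<bullet> b)) (at x)"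
      unfolding 1 2 by (rule has_derivative_grad[OF pd])
  qed
  have "(?H *v a) \<bullet> b = (?H *v b) \<bullet> a" for a b
    by (rule derivative_of_gradient_symmetric[OF S _ g]) (use has_derivative_grad[OF u] in blast)
  then have "?H $ i $ j = ?H $ j $ i" for i j
  proof -
    have "(?H *v axis j 1) \<bullet> axis i 1 = (?H *v axis i 1) \<bullet> axis j 1"
      using \<open>\<And>a b. (?H *v a) \<bullet> b = (?H *v b) \<bullet> a\<close> .
    moreover have "(T *v axis j 1) \<bullet> axis i 1 = T $ i $ j" for T :: "real^'n^'n" and i j
      by (simp add: inner_axis matrix_vector_mult_basis column_def)
    ultimately show ?thesis by (simp only:)
  qed
  then have sym: "?H = hess u x" by (simp add: vec_eq_iff transpose_def)
  then show "hess u x \<in> sym_mats" by (simp add: sym_mats_def)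
  show "(grad u has_derivative (\<lambda>h. hess u x *v h)) (at x)" using g sym by simp
qed

lemma C11_loc_hess_AE:
  fixes u :: "real^'n \<Rightarrow> real"
  assumes \<Omega>: "open \<Omega>" and u: "C11_loc \<Omega> u"
  obtains N where "negligible N"
    "\<And>x. x \<in> \<Omega> - N \<Longrightarrow> (grad u has_derivative (\<lambda>h. hess u x *v h)) (at x) \<and> hess u x \<in> sym_mats"
proof
  let ?N = "\<Union>j. {x \<in> \<Omega>. \<not> pd j u differentiable (at x)}"
  show "negligible ?N"
  proof (rule negligible_Union, safe)
    fix j
    show "negligible {x \<in> \<Omega>. \<not> pd j u differentiable (at x)}"
    proof (rule locally_Lipschitz_differentiable_AE[OF \<Omega>])
      fix x assume "x \<in> \<Omega>"
      then obtain \<epsilon> L where e: "0 < \<epsilon>" "L-lipschitz_on (ball x \<epsilon> \<inter> \<Omega>) (grad u)"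
        using u unfolding C11_loc_def by blast
      have "L-lipschitz_on (ball x \<epsilon> \<inter> \<Omega>) (pd j u)"
      proof (rule lipschitz_onI)
        fix y z assume yz: "y \<in> ball x \<epsilon> \<inter> \<Omega>" "z \<in> ball x \<epsilon> \<inter> \<Omega>"
        have "dist (pd j u y) (pd j u z) = dist (grad u y $ j) (grad u z $ j)" by (simp add: grad_def)
        also have "\<dots> \<le> dist (grad u y) (grad u z)" by (rule dist_vec_nth_le)
        also have "\<dots> \<le> L * dist y z" by (rule lipschitz_onD[OF e(2) yz])
        finally show "dist (pd j u y) (pd j u z) \<le> L * dist y z" .
      qed (rule lipschitz_on_nonneg[OF e(2)])
      with e show "\<exists>\<epsilon>>0. \<exists>L. L-lipschitz_on (ball x \<epsilon> \<inter> \<Omega>) (pd j u)" by blast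
    qed
  qed simp
  fix x assume x: "x \<in> \<Omega> - ?N"
  then show "(grad u has_derivative (\<lambda>h. hess u x *v h)) (at x) \<and> hess u x \<in> sym_mats"
    using grad_has_derivative_hess[OF \<Omega>, of x u] u unfolding C11_loc_def by blast
qed

section \<open>The cone and concavity up to its boundary\<close>

lemma subspace_sym_mats: "subspace (sym_mats :: (real^'n^'n) set)"
  unfolding subspace_def sym_mats_def by (auto simp: transpose_def vec_eq_iff)

lemma admissible_coneD:
  assumes "admissible_cone \<Gamma>"
  shows "\<Gamma> \<subseteq> sym_mats" "closure \<Gamma> \<subseteq> sym_mats" "convex \<Gamma>" "\<And>r t. r \<in> \<Gamma> \<Longrightarrow> 0 < t \<Longrightarrow> t *\<^sub>R r \<in> \<Gamma>"
    "\<And>r. pos_def r \<Longrightarrow> r \<in> \<Gamma>"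
proof -
  show "\<Gamma> \<subseteq> sym_mats" using assms openin_imp_subset unfolding admissible_cone_def by blast
  then show "closure \<Gamma> \<subseteq> sym_mats"
    by (rule closure_minimal) (rule closed_subspace[OF subspace_sym_mats])
qed (use assms in \<open>auto simp: admissible_cone_def\<close>)

lemma admissible_cone_closure_scaleR:
  assumes \<Gamma>: "admissible_cone \<Gamma>" and "r \<in> closure \<Gamma>" "0 < t"
  shows "t *\<^sub>R r \<in> closure \<Gamma>"
proof -
  have "(*\<^sub>R) t ` \<Gamma> \<subseteq> \<Gamma>" using admissible_coneD(4)[OF \<Gamma>] assms(3) by blast
  then have "(*\<^sub>R) t ` closure \<Gamma> \<subseteq> closure \<Gamma>" by (subst closure_scaleR) (rule closure_mono)
  with assms(2) show ?thesis by blast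
qed

text \<open>
  Approximate \<open>r\<close> by a point of the cone and let the open cone absorb the small error into \<open>r1\<close>.
\<close>

lemma admissible_cone_closure_add:
  assumes \<Gamma>: "admissible_cone \<Gamma>" and r: "r \<in> closure \<Gamma>" and r1: "r1 \<in> \<Gamma>"
  shows "r + r1 \<in> \<Gamma>"
proof -
  obtain e where e: "0 < e" "ball r1 e \<inter> sym_mats \<subseteq> \<Gamma>"
    using \<Gamma> r1 unfolding admissible_cone_def openin_contains_ball by blast
  obtain r' where r': "r' \<in> \<Gamma>" "dist r' r < e" using r e(1) unfolding closure_approachable by blast
  have sym: "r \<in> sym_mats" "r' \<in> sym_mats" "r1 \<in> sym_mats"
    using admissible_coneD(1,2)[OF \<Gamma>] r r' r1 by auto
  have "r1 + (r - r') \<in> sym_mats"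
    using subspace_sym_mats sym by (intro subspace_add subspace_diff) auto
  moreover have "r1 + (r - r') \<in> ball r1 e"
  proof -
    have "dist r1 (r1 + w) = norm w" for w by (simp add: dist_norm)
    then show ?thesis using r'(2) by (simp add: dist_norm norm_minus_commute)
  qed
  ultimately have y: "r1 + (r - r') \<in> \<Gamma>" using e by blast
  have "(1/2) *\<^sub>R r' + (1/2) *\<^sub>R (r1 + (r - r')) \<in> \<Gamma>"
    by (rule convexD[OF admissible_coneD(3)[OF \<Gamma>] r'(1) y]) auto
  then have "2 *\<^sub>R ((1/2) *\<^sub>R r' + (1/2) *\<^sub>R (r1 + (r - r'))) \<in> \<Gamma>"
    using admissible_coneD(4)[OF \<Gamma>] by simp
  moreover have "2 *\<^sub>R ((1/2) *\<^sub>R r' + (1/2) *\<^sub>R (r1 + (r - r'))) = r + r1"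
    by (simp add: scaleR_add_right)
  ultimately show ?thesis by simp
qed

lemma admissible_cone_combination:
  assumes \<Gamma>: "admissible_cone \<Gamma>" and r: "r \<in> closure \<Gamma>" "r1 \<in> \<Gamma>" and s: "0 < s" "s < 1"
  shows "(1 - s) *\<^sub>R r + s *\<^sub>R r1 \<in> \<Gamma>"
  using admissible_cone_closure_add[OF \<Gamma> admissible_cone_closure_scaleR[OF \<Gamma> r(1), of "1 - s"]]
    admissible_coneD(4)[OF \<Gamma> r(2) s(1)] s by simp

lemma pos_semidef_in_closure:
  assumes \<Gamma>: "admissible_cone \<Gamma>" and \<eta>: "pos_semidef \<eta>"
  shows "\<eta> \<in> closure \<Gamma>"
  unfolding closure_approachable
proof (intro allI impI)
  fix e :: real assume e: "0 < e"
  define c where "c = e / (norm (mat 1 :: real^'a^'a) + 1)"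
  have c: "0 < c" using e by (auto simp: c_def intro!: divide_pos_pos add_nonneg_pos)
  have "pos_def (\<eta> + c *\<^sub>R mat 1)"
    unfolding pos_def_def
  proof (intro conjI allI impI)
    have "mat 1 \<in> (sym_mats :: (real^'a^'a) set)" by (simp add: sym_mats_def transpose_mat)
    then show "\<eta> + c *\<^sub>R mat 1 \<in> sym_mats"
      using \<eta> subspace_sym_mats unfolding pos_semidef_def by (intro subspace_add subspace_scale) auto
    fix \<xi> :: "real^'a" assume "\<xi> \<noteq> 0"
    then have "0 < c * (\<xi> \<bullet> \<xi>)" using c by simp
    moreover have "\<xi> \<bullet> ((\<eta> + c *\<^sub>R mat 1) *v \<xi>) = \<xi> \<bullet> (\<eta> *v \<xi>) + c * (\<xi> \<bullet> \<xi>)"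
      by (simp add: matrix_vector_mult_add_rdistrib scaleR_matrix_vector_assoc[symmetric] inner_add_right)
    ultimately show "0 < \<xi> \<bullet> ((\<eta> + c *\<^sub>R mat 1) *v \<xi>)"
      using \<eta> unfolding pos_semidef_def by (simp add: add_nonneg_pos)
  qed
  then have "\<eta> + c *\<^sub>R mat 1 \<in> \<Gamma>" by (rule admissible_coneD(5)[OF \<Gamma>])
  moreover have "dist (\<eta> + c *\<^sub>R mat 1) \<eta> < e"
  proof -
    have "c * norm (mat 1 :: real^'a^'a) < c * (norm (mat 1 :: real^'a^'a) + 1)" using c by simp
    also have "\<dots> = e" using norm_ge_zero[of "mat 1 :: real^'a^'a"] by (simp add: c_def add_nonneg_eq_0_iff)
    finally show ?thesis using c by (simp add: dist_norm)
  qed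
  ultimately show "\<exists>y\<in>\<Gamma>. dist y \<eta> < e" by blast
qed

text \<open>
  The concavity of \<open>F\<close> persists when one of the two points lies on the boundary of the cone, where \<open>F\<close> is
  extended by \<open>a\<^sub>0\<close>: every value on the open cone exceeds \<open>a\<^sub>0\<close>, so concavity inside the cone gives the
  inequality with \<open>s\<close> replaced by any smaller weight \<open>t\<close>, and \<open>t\<close> may tend to \<open>s\<close>.
\<close>

lemma concave_combination_closure:
  assumes \<Gamma>: "admissible_cone \<Gamma>" and F: "concave_on \<Gamma> F" and rng: "F ` \<Gamma> = {t. a\<^sub>0 < ereal t}" "a\<^sub>0 < \<infinity>"
    and r: "r \<in> closure \<Gamma>" "a\<^sub>0 = -\<infinity> \<Longrightarrow> r \<in> \<Gamma>" and r1: "r1 \<in> \<Gamma>"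
    and b: "ereal b \<le> F_ext \<Gamma> a\<^sub>0 F r" and s: "0 < s" "s < 1"
  shows "(1 - s) * b + s * F r1 \<le> F ((1 - s) *\<^sub>R r + s *\<^sub>R r1)"
proof (cases "r \<in> \<Gamma>")
  case True
  then have "b \<le> F r" using b by (simp add: F_ext_def)
  then have "(1 - s) * b + s * F r1 \<le> (1 - s) * F r + s * F r1" using s by simp
  also have "\<dots> \<le> F ((1 - s) *\<^sub>R r + s *\<^sub>R r1)"
    using concave_onD[OF F _ _ True r1, of s] s by simp
  finally show ?thesis .
next
  case False
  then obtain \<alpha> where \<alpha>: "a\<^sub>0 = ereal \<alpha>" using r(2) rng(2) by (cases a\<^sub>0) auto
  have b: "b \<le> \<alpha>" using b False \<alpha> by (simp add: F_ext_def)
  have above: "\<alpha> < F x" if "x \<in> \<Gamma>" for x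
    using rng(1) that \<alpha> by (metis (mono_tags, lifting) ereal_less_eq(3) imageI linorder_not_less mem_Collect_eq)
  let ?y = "(1 - s) *\<^sub>R r + s *\<^sub>R r1"
  have approx: "\<alpha> + t * (F r1 - \<alpha>) \<le> F ?y" if t: "0 < t" "t < s" for t
  proof -
    \<comment> \<open>The point is also a combination, with the smaller weight \<open>t\<close> on \<open>r1\<close>, of \<open>r1\<close> and a point of the open cone.\<close>
    define \<epsilon> where "\<epsilon> = (s - t) / (1 - t)"
    have \<epsilon>: "0 < \<epsilon>" "\<epsilon> < 1" using t s by (auto simp: \<epsilon>_def field_simps)
    define r' where "r' = (1 - \<epsilon>) *\<^sub>R r + \<epsilon> *\<^sub>R r1"
    have r': "r' \<in> \<Gamma>" unfolding r'_def by (rule admissible_cone_combination[OF \<Gamma> r(1) r1 \<epsilon>])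
    have w: "(1 - t) * (1 - \<epsilon>) = 1 - s" "(1 - t) * \<epsilon> + t = s" using t s by (auto simp: \<epsilon>_def field_simps)
    have y: "?y = (1 - t) *\<^sub>R r' + t *\<^sub>R r1"
    proof -
      have "?y = ((1 - t) * (1 - \<epsilon>)) *\<^sub>R r + ((1 - t) * \<epsilon> + t) *\<^sub>R r1" by (simp only: w)
      then show ?thesis by (simp only: r'_def scaleR_add_right scaleR_scaleR scaleR_left.add add.assoc)
    qed
    have "\<alpha> + t * (F r1 - \<alpha>) = (1 - t) * \<alpha> + t * F r1" by (simp add: algebra_simps)
    also have "\<dots> \<le> (1 - t) * F r' + t * F r1" using above[OF r'] t s by simp
    also have "\<dots> \<le> F ?y" unfolding y using concave_onD[OF F _ _ r' r1, of t] t s by simp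
    finally show ?thesis .
  qed
  have "\<alpha> + s * (F r1 - \<alpha>) \<le> F ?y"
  proof (rule tendsto_upperbound[where F = "at_left s"])
    show "((\<lambda>t. \<alpha> + t * (F r1 - \<alpha>)) \<longlongrightarrow> \<alpha> + s * (F r1 - \<alpha>)) (at_left s)" by (intro tendsto_intros)
    show "\<forall>\<^sub>F t in at_left s. \<alpha> + t * (F r1 - \<alpha>) \<le> F ?y"
      by (rule eventually_at_leftI[OF _ s(1)]) (use approx in auto)
  qed simp
  moreover have "(1 - s) * b \<le> (1 - s) * \<alpha>" using b s by (intro mult_left_mono) auto
  ultimately show ?thesis by (simp add: algebra_simps)
qed

section \<open>Contact points off a null set\<close>

text \<open>
  Lipschitz continuity at a single point suffices for a map to preserve null sets, and unlike a local
  Lipschitz bound it passes easily to sums, products and compositions.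
\<close>

definition pointwise_Lipschitz_at :: "('a::real_normed_vector \<Rightarrow> 'b::real_normed_vector) \<Rightarrow> 'a \<Rightarrow> bool" where
  "pointwise_Lipschitz_at f x \<longleftrightarrow> (\<exists>B. \<forall>\<^sub>F y in nhds x. norm (f y - f x) \<le> B * norm (y - x))"

lemma pointwise_Lipschitz_at_add:
  assumes "pointwise_Lipschitz_at f x" "pointwise_Lipschitz_at g x"
  shows "pointwise_Lipschitz_at (\<lambda>y. f y + g y) x"
proof -
  obtain B C where "\<forall>\<^sub>F y in nhds x. norm (f y - f x) \<le> B * norm (y - x)"
    "\<forall>\<^sub>F y in nhds x. norm (g y - g x) \<le> C * norm (y - x)" using assms unfolding pointwise_Lipschitz_at_def by blast
  then have "\<forall>\<^sub>F y in nhds x. norm ((f y + g y) - (f x + g x)) \<le> (B + C) * norm (y - x)"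
  proof eventually_elim
    case (elim y)
    have "norm ((f y + g y) - (f x + g x)) \<le> norm (f y - f x) + norm (g y - g x)"
      using norm_triangle_ineq[of "f y - f x" "g y - g x"] by (simp add: algebra_simps)
    with elim show ?case by (simp add: distrib_right)
  qed
  then show ?thesis unfolding pointwise_Lipschitz_at_def by blast
qed

lemma pointwise_Lipschitz_at_minus:
  assumes "pointwise_Lipschitz_at f x"
  shows "pointwise_Lipschitz_at (\<lambda>y. - f y) x"
proof -
  have "norm (- f y - - f x) = norm (f y - f x)" for y by (simp add: norm_minus_commute)
  then show ?thesis using assms unfolding pointwise_Lipschitz_at_def by simp
qed

lemma pointwise_Lipschitz_at_diff:
  assumes "pointwise_Lipschitz_at f x" "pointwise_Lipschitz_at g x"
  shows "pointwise_Lipschitz_at (\<lambda>y. f y - g y) x"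
  using pointwise_Lipschitz_at_add[OF assms(1) pointwise_Lipschitz_at_minus[OF assms(2)]] by simp

lemma pointwise_Lipschitz_at_scaleR:
  assumes "pointwise_Lipschitz_at f x" "pointwise_Lipschitz_at g x"
  shows "pointwise_Lipschitz_at (\<lambda>y. f y *\<^sub>R g y) x"
proof -
  obtain B C where BC: "\<forall>\<^sub>F y in nhds x. norm (f y - f x) \<le> B * norm (y - x)"
    "\<forall>\<^sub>F y in nhds x. norm (g y - g x) \<le> C * norm (y - x)" using assms unfolding pointwise_Lipschitz_at_def by blast
  have "\<forall>\<^sub>F y in nhds x. dist y x < 1" unfolding eventually_nhds_metric by (rule exI[of _ 1]) simp
  with BC have "\<forall>\<^sub>F y in nhds x. norm (f y *\<^sub>R g y - f x *\<^sub>R g x) \<le> ((\<bar>f x\<bar> + \<bar>B\<bar>) * \<bar>C\<bar> + \<bar>B\<bar> * norm (g x)) * norm (y - x)"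
  proof eventually_elim
    case (elim y)
    have n: "norm (y - x) \<le> 1" using elim(3) by (simp add: dist_norm)
    have f: "norm (f y - f x) \<le> \<bar>B\<bar> * norm (y - x)"
      using elim(1) mult_right_mono[OF abs_ge_self[of B] norm_ge_zero[of "y - x"]] by linarith
    have g: "norm (g y - g x) \<le> \<bar>C\<bar> * norm (y - x)"
      using elim(2) mult_right_mono[OF abs_ge_self[of C] norm_ge_zero[of "y - x"]] by linarith
    have "\<bar>B\<bar> * norm (y - x) \<le> \<bar>B\<bar> * 1" using n by (intro mult_left_mono) auto
    then have fy: "\<bar>f y\<bar> \<le> \<bar>f x\<bar> + \<bar>B\<bar>" using f by simp
    have "f y *\<^sub>R g y - f x *\<^sub>R g x = f y *\<^sub>R (g y - g x) + (f y - f x) *\<^sub>R g x" by (simp add: algebra_simps)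
    then have "norm (f y *\<^sub>R g y - f x *\<^sub>R g x) \<le> \<bar>f y\<bar> * norm (g y - g x) + norm (f y - f x) * norm (g x)"
      by (metis norm_scaleR norm_triangle_ineq real_norm_def)
    also have "\<dots> \<le> (\<bar>f x\<bar> + \<bar>B\<bar>) * (\<bar>C\<bar> * norm (y - x)) + (\<bar>B\<bar> * norm (y - x)) * norm (g x)"
      using f g fy by (intro add_mono mult_mono) auto
    finally show ?case by (simp add: algebra_simps)
  qed
  then show ?thesis unfolding pointwise_Lipschitz_at_def by blast
qed

lemma has_derivative_imp_pointwise_Lipschitz_at:
  assumes "(f has_derivative f') (at x)"
  shows "pointwise_Lipschitz_at f x"
proof -
  interpret bounded_linear f' using assms by (rule has_derivative_bounded_linear)
  obtain K where K: "\<And>h. norm (f' h) \<le> norm h * K" using bounded by blast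
  obtain d where d: "0 < d" "\<And>y. norm (y - x) < d \<Longrightarrow> norm (f y - f x - f' (y - x)) \<le> 1 * norm (y - x)"
    using assms unfolding has_derivative_at_alt by (meson zero_less_one)
  have "\<forall>\<^sub>F y in nhds x. norm (f y - f x) \<le> (1 + K) * norm (y - x)"
    unfolding eventually_nhds_metric
  proof (intro exI[of _ d] conjI allI impI)
    fix y assume "dist y x < d"
    then have "norm (f y - f x - f' (y - x)) \<le> norm (y - x)" using d(2)[of y] by (simp add: dist_norm)
    then show "norm (f y - f x) \<le> (1 + K) * norm (y - x)"
      using K[of "y - x"] norm_triangle_sub[of "f y - f x" "f' (y - x)"] by (simp add: algebra_simps)
  qed (rule d)
  then show ?thesis unfolding pointwise_Lipschitz_at_def by blast
qed

lemma C11_loc_grad_pointwise_Lipschitz: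
  assumes "open \<Omega>" "C11_loc \<Omega> u" "x \<in> \<Omega>"
  shows "pointwise_Lipschitz_at (grad u) x"
proof -
  obtain \<epsilon> L where e: "0 < \<epsilon>" "L-lipschitz_on (ball x \<epsilon> \<inter> \<Omega>) (grad u)"
    using assms(2,3) unfolding C11_loc_def by blast
  have "\<forall>\<^sub>F y in nhds x. y \<in> ball x \<epsilon> \<inter> \<Omega>"
    using assms e by (intro eventually_nhds_in_open) auto
  then have "\<forall>\<^sub>F y in nhds x. norm (grad u y - grad u x) \<le> L * norm (y - x)"
    by eventually_elim (use lipschitz_onD[OF e(2), of _ x] assms e in \<open>auto simp: dist_norm\<close>)
  then show ?thesis unfolding pointwise_Lipschitz_at_def by blast
qed

text \<open>
  For every small \<open>\<zeta>\<close> the function \<open>\<psi> x - \<zeta> \<bullet> x\<close> attains its maximum over \<open>K\<close> inside \<open>U\<close>, and the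
  gradient \<open>g\<close> of \<open>\<psi>\<close> equals \<open>\<zeta>\<close> there. If all these maximum points were in \<open>N\<close>, a ball would be contained
  in the image of a null set under \<open>g\<close>, which is null.
\<close>

lemma contact_point_off_negligible:
  fixes \<psi> :: "'a::euclidean_space \<Rightarrow> real"
  assumes K: "compact K" and U: "open U" "U \<subseteq> K" "x0 \<in> U"
    and cont: "continuous_on K \<psi>" and less: "\<And>x. x \<in> K - U \<Longrightarrow> \<psi> x < \<psi> x0"
    and der: "\<And>x. x \<in> U \<Longrightarrow> (\<psi> has_derivative (\<lambda>h. g x \<bullet> h)) (at x)"
    and lip: "\<And>x. x \<in> U \<Longrightarrow> pointwise_Lipschitz_at g x"
    and N: "negligible N" and r: "0 < r"
  obtains x where "x \<in> U - N" "norm (g x) < r" "\<And>y. y \<in> U \<Longrightarrow> \<psi> y - g x \<bullet> y \<le> \<psi> x - g x \<bullet> x"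
proof -
  have "compact (K - U)" using K U(1) by (rule compact_diff)
  have "\<exists>\<gamma>>0. \<forall>x\<in>K - U. \<psi> x \<le> \<psi> x0 - \<gamma>"
  proof (cases "K - U = {}")
    case True
    then show ?thesis by (intro exI[of _ 1]) auto
  next
    case False
    obtain m where m: "m \<in> K - U" "\<And>x. x \<in> K - U \<Longrightarrow> \<psi> x \<le> \<psi> m"
      using continuous_attains_sup[OF \<open>compact (K - U)\<close> False continuous_on_subset[OF cont]] by blast
    then show ?thesis using less[OF m(1)] by (intro exI[of _ "\<psi> x0 - \<psi> m"]) auto
  qed
  then obtain \<gamma> where \<gamma>: "0 < \<gamma>" "\<And>x. x \<in> K - U \<Longrightarrow> \<psi> x \<le> \<psi> x0 - \<gamma>" by blast
  obtain R where R: "\<And>x. x \<in> K \<Longrightarrow> norm x \<le> R" using compact_imp_bounded[OF K] by (auto simp: bounded_iff)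
  have R0: "0 \<le> R" using R[of x0] U norm_ge_zero[of x0] by (meson order_trans subsetD)
  define r' where "r' = min r (\<gamma> / (2 * R + 1))"
  have r': "0 < r'" "r' \<le> r" using r \<gamma> R0 by (auto simp: r'_def)
  have contact: "\<exists>x\<in>U. g x = \<zeta> \<and> (\<forall>y\<in>U. \<psi> y - \<zeta> \<bullet> y \<le> \<psi> x - \<zeta> \<bullet> x)" if \<zeta>: "norm \<zeta> < r'" for \<zeta>
  proof -
    have "continuous_on K (\<lambda>x. \<psi> x - \<zeta> \<bullet> x)" by (intro continuous_intros cont)
    then obtain x where x: "x \<in> K" "\<And>y. y \<in> K \<Longrightarrow> \<psi> y - \<zeta> \<bullet> y \<le> \<psi> x - \<zeta> \<bullet> x"
      using continuous_attains_sup[OF K, of "\<lambda>x. \<psi> x - \<zeta> \<bullet> x"] U by blast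
    have xU: "x \<in> U"
    proof (rule ccontr)
      assume "x \<notin> U"
      then have "\<psi> x \<le> \<psi> x0 - \<gamma>" using \<gamma>(2) x(1) by blast
      moreover have "\<psi> x0 - \<zeta> \<bullet> x0 \<le> \<psi> x - \<zeta> \<bullet> x" using x(2) U by blast
      ultimately have "\<gamma> \<le> \<zeta> \<bullet> (x0 - x)" by (simp add: inner_diff_right)
      also have "\<dots> \<le> norm \<zeta> * norm (x0 - x)" by (rule norm_cauchy_schwarz)
      also have "\<dots> \<le> norm \<zeta> * (2 * R)"
        using R[of x0] R[OF x(1)] U norm_triangle_ineq4[of x0 x] by (intro mult_left_mono) (auto simp: subset_iff)
      also have "\<dots> \<le> r' * (2 * R)" using \<zeta> R0 by (intro mult_right_mono) auto
      also have "\<dots> < r' * (2 * R + 1)" using r' by (intro mult_strict_left_mono) auto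
      also have "\<dots> \<le> \<gamma> / (2 * R + 1) * (2 * R + 1)" using R0 by (intro mult_right_mono) (auto simp: r'_def)
      also have "\<dots> = \<gamma>" using R0 by simp
      finally show False by simp
    qed
    have max: "\<forall>y\<in>U. \<psi> y - \<zeta> \<bullet> y \<le> \<psi> x - \<zeta> \<bullet> x" using x(2) U(2) by blast
    have "((\<lambda>x. \<psi> x - \<zeta> \<bullet> x) has_derivative (\<lambda>h. g x \<bullet> h - \<zeta> \<bullet> h)) (at x)"
      by (intro has_derivative_diff der[OF xU]) (auto intro!: derivative_eq_intros)
    then have "(\<lambda>h. g x \<bullet> h - \<zeta> \<bullet> h) = (\<lambda>h. 0)"
      by (rule differential_zero_maxmin[OF xU U(1)]) (use max in blast)
    then have "(g x - \<zeta>) \<bullet> (g x - \<zeta>) = 0" by (metis inner_diff_left)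
    then have "g x = \<zeta>" by simp
    with max xU show ?thesis by blast
  qed
  have "\<not> ball 0 r' \<subseteq> g ` (U \<inter> N)"
  proof
    assume sub: "ball 0 r' \<subseteq> g ` (U \<inter> N)"
    have "negligible (g ` (U \<inter> N))"
    proof (rule negligible_locally_Lipschitz_image)
      show "negligible (U \<inter> N)" using N by (rule negligible_subset) auto
      fix x assume "x \<in> U \<inter> N"
      then obtain B where "\<forall>\<^sub>F y in nhds x. norm (g y - g x) \<le> B * norm (y - x)"
        using lip unfolding pointwise_Lipschitz_at_def by blast
      then obtain T where "open T" "x \<in> T" "\<forall>y\<in>T. norm (g y - g x) \<le> B * norm (y - x)"
        unfolding eventually_nhds by blast
      then show "\<exists>T B. open T \<and> x \<in> T \<and> (\<forall>y\<in>U \<inter> N \<inter> T. norm (g y - g x) \<le> B * norm (y - x))" by blast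
    qed simp
    then have "negligible (ball (0::'a) r')" using sub by (rule negligible_subset)
    then show False using open_not_negligible[of "ball (0::'a) r'"] r' by auto
  qed
  then obtain \<zeta> where \<zeta>0: "\<zeta> \<in> ball 0 r'" "\<zeta> \<notin> g ` (U \<inter> N)" by blast
  then have \<zeta>: "norm \<zeta> < r'" "\<zeta> \<notin> g ` (U \<inter> N)" by simp_all
  obtain x where x: "x \<in> U" "g x = \<zeta>" "\<forall>y\<in>U. \<psi> y - \<zeta> \<bullet> y \<le> \<psi> x - \<zeta> \<bullet> x" using contact[OF \<zeta>(1)] by blast
  show thesis by (rule that[of x]) (use x \<zeta> r' in auto)
qed

lemma second_derivative_nonpos_at_max:
  fixes \<psi> :: "'a::euclidean_space \<Rightarrow> real"
  assumes U: "open U" "x \<in> U" and der: "\<And>y. y \<in> U \<Longrightarrow> (\<psi> has_derivative (\<lambda>h. g y \<bullet> h)) (at y)"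
    and g: "(g has_derivative g') (at x)" and max: "\<And>y. y \<in> U \<Longrightarrow> \<psi> y - g x \<bullet> y \<le> \<psi> x - g x \<bullet> x"
  shows "g' \<xi> \<bullet> \<xi> \<le> 0"
proof (rule ccontr)
  assume "\<not> g' \<xi> \<bullet> \<xi> \<le> 0"
  then have pos: "0 < g' \<xi> \<bullet> \<xi>" by simp
  define \<phi> where "\<phi> t = \<psi> (x + t *\<^sub>R \<xi>) - g x \<bullet> (x + t *\<^sub>R \<xi>)" for t
  define \<phi>' where "\<phi>' t = (g (x + t *\<^sub>R \<xi>) - g x) \<bullet> \<xi>" for t
  have line: "((\<lambda>t. x + t *\<^sub>R \<xi>) has_derivative (\<lambda>t. t *\<^sub>R \<xi>)) (at t)" for t by (auto intro!: derivative_eq_intros)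
  have "((\<lambda>t. x + t *\<^sub>R \<xi>) \<longlongrightarrow> x + 0 *\<^sub>R \<xi>) (at_right 0)" by (intro tendsto_intros)
  then have "\<forall>\<^sub>F t in at_right 0. x + t *\<^sub>R \<xi> \<in> U" using U by (intro topological_tendstoD) auto
  then obtain d1 where d1: "0 < d1" "\<And>t. 0 < t \<Longrightarrow> t < d1 \<Longrightarrow> x + t *\<^sub>R \<xi> \<in> U"
    unfolding eventually_at_right_field by auto
  have d\<phi>: "(\<phi> has_real_derivative \<phi>' t) (at t)" if "x + t *\<^sub>R \<xi> \<in> U" for t
  proof -
    have "((\<lambda>t. \<psi> (x + t *\<^sub>R \<xi>)) has_derivative (\<lambda>h. g (x + t *\<^sub>R \<xi>) \<bullet> (h *\<^sub>R \<xi>))) (at t)"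
      by (rule has_derivative_compose[where g = \<psi>, OF line der[OF that]])
    then have "(\<phi> has_derivative (\<lambda>h. g (x + t *\<^sub>R \<xi>) \<bullet> (h *\<^sub>R \<xi>) - g x \<bullet> (h *\<^sub>R \<xi>))) (at t)"
      unfolding \<phi>_def by (rule has_derivative_diff) (rule has_derivative_inner_right[OF line])
    moreover have "(\<lambda>h. g (x + t *\<^sub>R \<xi>) \<bullet> (h *\<^sub>R \<xi>) - g x \<bullet> (h *\<^sub>R \<xi>)) = (*) (\<phi>' t)"
      by (auto simp: \<phi>'_def inner_diff_left algebra_simps)
    ultimately show ?thesis by (simp add: has_field_derivative_def)
  qed
  have "(\<phi>' has_real_derivative g' \<xi> \<bullet> \<xi>) (at 0)"
  proof -
    have "((\<lambda>t. g (x + t *\<^sub>R \<xi>)) has_derivative (\<lambda>h. g' (h *\<^sub>R \<xi>))) (at 0)"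
      by (rule has_derivative_compose[where g = g, OF line]) (use g in simp)
    then have "((\<lambda>t. (g (x + t *\<^sub>R \<xi>) - g x) \<bullet> \<xi>) has_derivative (\<lambda>h. (g' (h *\<^sub>R \<xi>) - 0) \<bullet> \<xi>)) (at 0)"
      by (intro has_derivative_inner_left has_derivative_diff has_derivative_const)
    moreover have "(\<lambda>h. (g' (h *\<^sub>R \<xi>) - 0) \<bullet> \<xi>) = (*) (g' \<xi> \<bullet> \<xi>)"
      using has_derivative_linear[OF g] by (auto simp: linear_cmul)
    ultimately show ?thesis by (simp add: has_field_derivative_def \<phi>'_def[abs_def])
  qed
  from DERIV_pos_inc_right[OF this pos] obtain d2 where d2: "0 < d2" "\<And>h. 0 < h \<Longrightarrow> h < d2 \<Longrightarrow> \<phi>' 0 < \<phi>' (0 + h)" by blast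
  define t where "t = min d1 d2 / 2"
  have t: "0 < t" "t < d1" "t < d2" using d1 d2 by (auto simp: t_def)
  have "\<phi> 0 < \<phi> t"
  proof (rule DERIV_pos_imp_increasing_open[OF t(1)])
    fix s assume s: "0 < s" "s < t"
    then have "0 < \<phi>' s" using d2(2)[of s] t by (simp add: \<phi>'_def)
    then show "\<exists>y. (\<phi> has_real_derivative y) (at s) \<and> 0 < y" using d\<phi> d1(2)[of s] s t by fastforce
  next
    show "continuous_on {0..t} \<phi>"
    proof (rule continuous_at_imp_continuous_on, rule ballI)
      fix s assume "s \<in> {0..t}"
      then have "x + s *\<^sub>R \<xi> \<in> U" using d1(2)[of s] t U by (cases "s = 0") auto
      then show "isCont \<phi> s" using d\<phi> DERIV_isCont by blast
    qed
  qed
  moreover have "\<phi> t \<le> \<phi> 0" unfolding \<phi>_def using max[OF d1(2)[OF t(1,2)]] by simp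
  ultimately show False by simp
qed

section \<open>Regular matrix functions along segments\<close>

lemma norm_matrix_vector_mult_le:
  fixes M :: "real^'n^'m"
  shows "norm (M *v \<xi>) \<le> norm M * norm \<xi>"
proof -
  have "norm (M *v \<xi>) = L2_set (\<lambda>i. norm (M $ i \<bullet> \<xi>)) UNIV"
    by (simp add: norm_vec_def matrix_vector_mul_component)
  also have "\<dots> \<le> L2_set (\<lambda>i. norm (M $ i) * norm \<xi>) UNIV"
    by (rule L2_set_mono) (auto simp: Cauchy_Schwarz_ineq2)
  also have "\<dots> = norm M * norm \<xi>"
    by (simp add: norm_vec_def[of M] L2_set_left_distrib)
  finally show ?thesis .
qed

lemma abs_quadratic_form_le:
  fixes M :: "real^'n^'n"
  shows "\<bar>\<xi> \<bullet> (M *v \<eta>)\<bar> \<le> norm M * norm \<xi> * norm \<eta>"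
proof -
  have "\<bar>\<xi> \<bullet> (M *v \<eta>)\<bar> \<le> norm \<xi> * norm (M *v \<eta>)" by (rule Cauchy_Schwarz_ineq2)
  also have "\<dots> \<le> norm \<xi> * (norm M * norm \<eta>)" by (intro mult_left_mono norm_matrix_vector_mult_le) auto
  finally show ?thesis by (simp add: mult_ac)
qed

text \<open>
  Split \<open>\<xi>\<close> into its component along \<open>q\<close> and the orthogonal one. The form is nonnegative on the latter,
  and the mixed terms are split by Young's inequality so that the coefficient of \<open>|\<xi>|\<^sup>2\<close> can be made
  small at the expense of that of \<open>(\<xi> \<bullet> q)\<^sup>2\<close>.
\<close>

lemma quadratic_form_codimension_one_bound:
  fixes M :: "real^'n^'n"
  assumes C: "norm M \<le> C * (norm q)\<^sup>2" "0 \<le> C" and \<kappa>: "0 < \<kappa>"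
    and pos: "\<And>\<xi>. \<xi> \<bullet> q = 0 \<Longrightarrow> 0 \<le> \<xi> \<bullet> (M *v \<xi>)"
  shows "- (\<kappa> * (norm q)\<^sup>2 * (norm \<xi>)\<^sup>2 + (C + C\<^sup>2 / \<kappa>) * (\<xi> \<bullet> q)\<^sup>2) \<le> \<xi> \<bullet> (M *v \<xi>)"
proof (cases "q = 0")
  case True
  then show ?thesis using C by simp
next
  case False
  define n where "n = norm q"
  have n: "0 < n" using False by (simp add: n_def)
  define c where "c = (\<xi> \<bullet> q) / n\<^sup>2"
  define a where "a = \<xi> - c *\<^sub>R q"
  have qq: "q \<bullet> q = n\<^sup>2" by (simp add: n_def power2_norm_eq_inner)
  have aq: "a \<bullet> q = 0" using n by (simp add: a_def c_def inner_diff_left qq)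
  have xi: "\<xi> = a + c *\<^sub>R q" by (simp add: a_def)
  have na: "norm a \<le> norm \<xi>"
  proof -
    have "(norm \<xi>)\<^sup>2 = (norm a)\<^sup>2 + c\<^sup>2 * n\<^sup>2"
      unfolding power2_norm_eq_inner xi
      using aq by (simp add: inner_add_left inner_add_right inner_commute[of q a] qq power2_eq_square)
    then have "(norm a)\<^sup>2 \<le> (norm \<xi>)\<^sup>2" by simp
    then show ?thesis by (rule power2_le_imp_le) simp
  qed
  define x where "x = \<bar>\<xi> \<bullet> q\<bar>"
  have nb: "norm (c *\<^sub>R q) = x / n" using n by (simp add: c_def x_def n_def power2_eq_square)
  have x0: "0 \<le> x" by (simp add: x_def)
  have cross: "norm M * norm a * norm (c *\<^sub>R q) \<le> C * n * norm \<xi> * x"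
  proof -
    have "norm M * norm a * norm (c *\<^sub>R q) \<le> (C * n\<^sup>2) * norm \<xi> * (x / n)"
      unfolding nb using C na n x0 by (intro mult_mono) (auto simp: n_def)
    also have "\<dots> = C * n * norm \<xi> * x" using n by (simp add: power2_eq_square)
    finally show ?thesis .
  qed
  have last: "norm M * norm (c *\<^sub>R q) * norm (c *\<^sub>R q) \<le> C * x\<^sup>2"
  proof -
    have "norm M * norm (c *\<^sub>R q) * norm (c *\<^sub>R q) \<le> (C * n\<^sup>2) * (x / n) * (x / n)"
      unfolding nb using C n x0 by (intro mult_mono) (auto simp: n_def)
    also have "\<dots> = C * x\<^sup>2" using n by (simp add: power2_eq_square)
    finally show ?thesis .
  qed
  have young: "2 * (C * n * norm \<xi> * x) \<le> \<kappa> * n\<^sup>2 * (norm \<xi>)\<^sup>2 + C\<^sup>2 / \<kappa> * x\<^sup>2"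
  proof -
    have "0 \<le> (\<kappa> * n * norm \<xi> - C * x)\<^sup>2 / \<kappa>" using \<kappa> by simp
    also have "\<dots> = \<kappa> * n\<^sup>2 * (norm \<xi>)\<^sup>2 + C\<^sup>2 / \<kappa> * x\<^sup>2 - 2 * (C * n * norm \<xi> * x)"
      using \<kappa> by (simp add: power2_eq_square field_simps)
    finally show ?thesis by simp
  qed
  have "\<xi> \<bullet> (M *v \<xi>) = a \<bullet> (M *v a) + a \<bullet> (M *v (c *\<^sub>R q)) + (c *\<^sub>R q) \<bullet> (M *v a) + (c *\<^sub>R q) \<bullet> (M *v (c *\<^sub>R q))"
    by (subst (1 2) xi) (simp only: matrix_vector_right_distrib inner_add_left inner_add_right add_ac)
  moreover have "0 \<le> a \<bullet> (M *v a)" by (rule pos[OF aq])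
  moreover have "\<bar>a \<bullet> (M *v (c *\<^sub>R q))\<bar> \<le> C * n * norm \<xi> * x"
    using abs_quadratic_form_le[of a M "c *\<^sub>R q"] cross by linarith
  moreover have "\<bar>(c *\<^sub>R q) \<bullet> (M *v a)\<bar> \<le> C * n * norm \<xi> * x"
    using abs_quadratic_form_le[of "c *\<^sub>R q" M a] cross by (simp add: mult_ac)
  moreover have "\<bar>(c *\<^sub>R q) \<bullet> (M *v (c *\<^sub>R q))\<bar> \<le> C * x\<^sup>2"
    using abs_quadratic_form_le[of "c *\<^sub>R q" M "c *\<^sub>R q"] last by linarith
  ultimately have "- (2 * (C * n * norm \<xi> * x) + C * x\<^sup>2) \<le> \<xi> \<bullet> (M *v \<xi>)" by linarith
  with young have "- (\<kappa> * n\<^sup>2 * (norm \<xi>)\<^sup>2 + C\<^sup>2 / \<kappa> * x\<^sup>2 + C * x\<^sup>2) \<le> \<xi> \<bullet> (M *v \<xi>)" by linarith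
  moreover have "x\<^sup>2 = (\<xi> \<bullet> q)\<^sup>2" by (simp add: x_def)
  ultimately show ?thesis by (simp add: n_def algebra_simps)
qed

text \<open>
  Partial derivatives in \<open>p\<close>: \<open>dA x z p q\<close> is the derivative in direction \<open>q\<close>, and \<open>d2A x z p r q\<close>
  differentiates it once more in direction \<open>r\<close>. They are restrictions of the total derivatives to increments
  \<open>(0, 0, q)\<close>, and the second ones inherit a bound on compact sets from continuity.
\<close>

lemma C2_closure_p_derivatives:
  fixes A :: "real^'n \<Rightarrow> real \<Rightarrow> real^'n \<Rightarrow> 'b::real_normed_vector"
  assumes "C2_closure (\<Omega> \<times> UNIV \<times> UNIV) (\<lambda>(x, z, p). A x z p)"
  obtains dA d2A where
    "\<And>x z p. x \<in> \<Omega> \<Longrightarrow> (A x z has_derivative dA x z p) (at p)"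
    "\<And>x z p q. x \<in> \<Omega> \<Longrightarrow> ((\<lambda>p. dA x z p q) has_derivative (\<lambda>r. d2A x z p r q)) (at p)"
    "\<And>x z p. bounded_bilinear (d2A x z p)"
    "\<And>S. compact S \<Longrightarrow> S \<subseteq> \<Omega> \<times> UNIV \<times> UNIV \<Longrightarrow>
       \<exists>C\<ge>0. \<forall>(x, z, p)\<in>S. \<forall>r q. norm (d2A x z p r q) \<le> C * norm r * norm q"
proof -
  let ?A = "\<lambda>(x, z, p). A x z p"
  obtain f' f'' where cont: "continuous_on (closure (\<Omega> \<times> UNIV \<times> UNIV)) f''"
    and f': "\<And>w. w \<in> \<Omega> \<times> UNIV \<times> UNIV \<Longrightarrow> (?A has_derivative blinfun_apply (f' w)) (at w)"
    and f'': "\<And>w. w \<in> \<Omega> \<times> UNIV \<times> UNIV \<Longrightarrow> (f' has_derivative blinfun_apply (f'' w)) (at w)"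
    using assms unfolding C2_closure_def by blast
  define dA where "dA x z p q = blinfun_apply (f' (x, z, p)) (0, 0, q)" for x z p q
  define d2A where "d2A x z p r q = blinfun_apply (blinfun_apply (f'' (x, z, p)) (0, 0, r)) (0, 0, q)" for x z p r q
  have emb: "((\<lambda>p. (x, z, p)) has_derivative (\<lambda>q. (0, 0, q))) (at p)" for x :: "real^'n" and z :: real and p :: "real^'n"
    by (auto intro!: derivative_eq_intros)
  show thesis
  proof
    fix x z p q assume x: "x \<in> \<Omega>"
    have "((\<lambda>p. ?A (x, z, p)) has_derivative (\<lambda>q. blinfun_apply (f' (x, z, p)) (0, 0, q))) (at p)"
      by (rule has_derivative_compose[where g = ?A, OF emb f']) (use x in simp)
    then show "(A x z has_derivative dA x z p) (at p)" by (simp add: dA_def[abs_def])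
    have "((\<lambda>p. f' (x, z, p)) has_derivative (\<lambda>r. blinfun_apply (f'' (x, z, p)) (0, 0, r))) (at p)"
      by (rule has_derivative_compose[where g = f', OF emb f'']) (use x in simp)
    then show "((\<lambda>p. dA x z p q) has_derivative (\<lambda>r. d2A x z p r q)) (at p)"
      unfolding dA_def d2A_def by (rule bounded_linear.has_derivative[OF blinfun.bounded_linear_left])
  next
    fix x z p
    have emb_lin: "(0, 0, a + b) = (0, 0, a) + ((0, 0, b) :: (real^'n) \<times> real \<times> (real^'n))"
      "(0, 0, t *\<^sub>R a) = t *\<^sub>R ((0, 0, a) :: (real^'n) \<times> real \<times> (real^'n))" for a b :: "real^'n" and t
      by simp_all
    show "bounded_bilinear (d2A x z p)"
    proof (rule bounded_bilinear.intro)
      show "\<exists>K. \<forall>a b. norm (d2A x z p a b) \<le> norm a * norm b * K"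
      proof (intro exI allI)
        fix a b :: "real^'n"
        have "norm (d2A x z p a b) \<le> norm (blinfun_apply (f'' (x, z, p)) (0, 0, a)) * norm (0::real^'n, 0::real, b)"
          unfolding d2A_def by (rule norm_blinfun)
        also have "\<dots> \<le> (norm (f'' (x, z, p)) * norm (0::real^'n, 0::real, a)) * norm (0::real^'n, 0::real, b)"
          by (intro mult_right_mono norm_blinfun) auto
        finally show "norm (d2A x z p a b) \<le> norm a * norm b * norm (f'' (x, z, p))"
          by (simp add: norm_Pair mult_ac)
      qed
    qed (simp_all only: d2A_def emb_lin blinfun.add_left blinfun.add_right blinfun.scaleR_left blinfun.scaleR_right)
  next
    fix S assume S: "compact S" "S \<subseteq> \<Omega> \<times> (UNIV :: real set) \<times> (UNIV :: (real^'n) set)"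
    have "continuous_on S f''" using cont by (rule continuous_on_subset) (use S closure_subset in blast)
    then have "bounded (f'' ` S)" using S(1) by (intro compact_imp_bounded compact_continuous_image)
    then obtain C where C: "\<And>w. w \<in> S \<Longrightarrow> norm (f'' w) \<le> C" by (auto simp: bounded_iff)
    have "norm (d2A x z p r q) \<le> \<bar>C\<bar> * norm r * norm q" if "(x, z, p) \<in> S" for x z p r q
    proof -
      have "norm (d2A x z p r q) \<le> norm (blinfun_apply (f'' (x, z, p)) (0, 0, r)) * norm (0::real^'n, 0::real, q)"
        unfolding d2A_def by (rule norm_blinfun)
      also have "\<dots> \<le> (norm (f'' (x, z, p)) * norm (0::real^'n, 0::real, r)) * norm (0::real^'n, 0::real, q)"
        by (intro mult_right_mono norm_blinfun) auto
      also have "\<dots> \<le> (\<bar>C\<bar> * norm (0::real^'n, 0::real, r)) * norm (0::real^'n, 0::real, q)"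
        using C[OF that] by (intro mult_right_mono) auto
      finally show ?thesis by (simp add: norm_Pair)
    qed
    then show "\<exists>C\<ge>0. \<forall>(x, z, p)\<in>S. \<forall>r q. norm (d2A x z p r q) \<le> C * norm r * norm q"
      by (intro exI[of _ "\<bar>C\<bar>"]) auto
  qed
qed

lemma regular_A_second_derivative:
  fixes A :: "real^'n \<Rightarrow> real \<Rightarrow> real^'n \<Rightarrow> real^'n^'n"
  assumes reg: "regular_A \<Omega> A" and x: "x \<in> \<Omega>" and orth: "\<xi> \<bullet> \<eta> = 0"
    and dA: "\<And>p. (A x z has_derivative dA p) (at p)"
    and d2A: "\<And>q. ((\<lambda>p. dA p q) has_derivative (\<lambda>r. d2A r q)) (at p)" and bil: "bounded_bilinear d2A"
  shows "0 \<le> \<xi> \<bullet> (d2A \<eta> \<eta> *v \<xi>)"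
proof -
  interpret bounded_bilinear d2A by (rule bil)
  have comp: "bounded_linear (\<lambda>M :: real^'n^'n. M $ i $ j)" for i j
    by (rule bounded_linear_compose[OF bounded_linear_vec_nth bounded_linear_vec_nth])
  have 1: "pd l (\<lambda>q. A x z q $ i $ j) p' = dA p' (axis l 1) $ i $ j" for l i j p'
    by (rule pd_eq_derivative, rule bounded_linear.has_derivative[OF comp dA])
  have 2: "pd k (pd l (\<lambda>q. A x z q $ i $ j)) p = d2A (axis k 1) (axis l 1) $ i $ j" for k l i j
    unfolding 1 by (rule pd_eq_derivative, rule bounded_linear.has_derivative[OF comp d2A])
  have eta: "\<eta> = (\<Sum>k\<in>UNIV. \<eta> $ k *\<^sub>R axis k 1)" by (simp add: basis_expansion flip: scalar_mult_eq_scaleR)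
  have ent: "d2A \<eta> \<eta> $ i $ j = (\<Sum>k\<in>UNIV. \<Sum>l\<in>UNIV. d2A (axis k 1) (axis l 1) $ i $ j * \<eta> $ k * \<eta> $ l)" for i j
  proof -
    have "d2A \<eta> \<eta> = (\<Sum>k\<in>UNIV. \<Sum>l\<in>UNIV. (\<eta> $ k * \<eta> $ l) *\<^sub>R d2A (axis k 1) (axis l 1))"
      by (subst (1) eta, subst (2) eta) (simp add: sum_left sum_right scaleR_left scaleR_right scaleR_sum_right, subst sum.swap, simp add: mult.commute)
    then show ?thesis by (simp add: mult_ac)
  qed
  have "\<xi> \<bullet> (d2A \<eta> \<eta> *v \<xi>) = (\<Sum>i\<in>UNIV. \<Sum>j\<in>UNIV. d2A \<eta> \<eta> $ i $ j * \<xi> $ i * \<xi> $ j)"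
    by (simp add: inner_vec_def matrix_vector_mult_def sum_distrib_left mult_ac)
  also have "\<dots> = (\<Sum>i\<in>UNIV. \<Sum>j\<in>UNIV. \<Sum>k\<in>UNIV. \<Sum>l\<in>UNIV.
               pd k (pd l (\<lambda>q. A x z q $ i $ j)) p * \<xi> $ i * \<xi> $ j * \<eta> $ k * \<eta> $ l)"
    unfolding ent 2 by (simp add: sum_distrib_left sum_distrib_right mult_ac)
  also have "0 \<le> \<dots>" using reg x orth unfolding regular_A_def by blast
  finally show ?thesis .
qed

text \<open>
  A quantitative substitute for convexity in \<open>p\<close>. By the codimension-one bound, the second derivative of
  \<open>t \<mapsto> \<xi> \<bullet> A(p0 + t q) \<xi>\<close> is at least \<open>- D\<close>, where \<open>D = \<kappa> |q|\<^sup>2 |\<xi>|\<^sup>2 + (C + C\<^sup>2 / \<kappa>) (\<xi> \<bullet> q)\<^sup>2\<close>, so that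
  adding \<open>D t\<^sup>2 / 2\<close> makes the function convex on \<open>{0..1}\<close>.
\<close>

lemma regular_A_segment:
  fixes A :: "real^'n \<Rightarrow> real \<Rightarrow> real^'n \<Rightarrow> real^'n^'n"
  assumes reg: "regular_A \<Omega> A" and x: "x \<in> \<Omega>"
    and dA: "\<And>p. (A x z has_derivative dA p) (at p)"
    and d2A: "\<And>p q. ((\<lambda>p. dA p q) has_derivative (\<lambda>r. d2A p r q)) (at p)" and bil: "\<And>p. bounded_bilinear (d2A p)"
    and C: "0 \<le> C" "\<And>t. 0 \<le> t \<Longrightarrow> t \<le> 1 \<Longrightarrow> norm (d2A (p0 + t *\<^sub>R q) q q) \<le> C * (norm q)\<^sup>2"
    and \<kappa>: "0 < \<kappa>" and s: "0 \<le> s" "s \<le> 1"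
  shows "- (s * (\<kappa> * (norm q)\<^sup>2 * (norm \<xi>)\<^sup>2 + (C + C\<^sup>2 / \<kappa>) * (\<xi> \<bullet> q)\<^sup>2))
    \<le> (1 - s) * (\<xi> \<bullet> (A x z p0 *v \<xi>)) + s * (\<xi> \<bullet> (A x z (p0 + q) *v \<xi>)) - \<xi> \<bullet> (A x z (p0 + s *\<^sub>R q) *v \<xi>)"
proof -
  define D where "D = \<kappa> * (norm q)\<^sup>2 * (norm \<xi>)\<^sup>2 + (C + C\<^sup>2 / \<kappa>) * (\<xi> \<bullet> q)\<^sup>2"
  have D: "0 \<le> D" using C \<kappa> by (auto simp: D_def intro!: add_nonneg_nonneg mult_nonneg_nonneg)
  have form: "bounded_linear (\<lambda>M. \<xi> \<bullet> (M *v \<xi>))" for \<xi> :: "real^'n"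
  proof (rule bounded_linear_intro)
    fix M :: "real^'n^'n"
    show "norm (\<xi> \<bullet> (M *v \<xi>)) \<le> norm M * (norm \<xi> * norm \<xi>)"
      using abs_quadratic_form_le[of \<xi> M \<xi>] by (simp add: mult_ac)
  qed (auto simp: matrix_vector_mult_add_rdistrib inner_add_right scaleR_matrix_vector_assoc[symmetric])
  let ?\<gamma> = "\<lambda>t. p0 + t *\<^sub>R q"
  have line: "(?\<gamma> has_derivative (\<lambda>t. t *\<^sub>R q)) (at t)" for t by (auto intro!: derivative_eq_intros)
  have lin_dA: "linear (dA p)" for p by (rule has_derivative_linear[OF dA])
  have d1: "((\<lambda>t. \<xi> \<bullet> (A x z (?\<gamma> t) *v \<xi>)) has_real_derivative \<xi> \<bullet> (dA (?\<gamma> t) q *v \<xi>)) (at t)" for t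
  proof -
    have "((\<lambda>t. \<xi> \<bullet> (A x z (?\<gamma> t) *v \<xi>)) has_derivative (\<lambda>h. \<xi> \<bullet> (dA (?\<gamma> t) (h *\<^sub>R q) *v \<xi>))) (at t)"
      by (intro bounded_linear.has_derivative[OF form] has_derivative_compose[where g = "A x z", OF line dA])
    moreover have "(\<lambda>h. \<xi> \<bullet> (dA (?\<gamma> t) (h *\<^sub>R q) *v \<xi>)) = (*) (\<xi> \<bullet> (dA (?\<gamma> t) q *v \<xi>))"
      by (auto simp: linear_cmul[OF lin_dA] scaleR_matrix_vector_assoc[symmetric])
    ultimately show ?thesis by (simp add: has_field_derivative_def)
  qed
  have d2: "((\<lambda>t. \<xi> \<bullet> (dA (?\<gamma> t) q *v \<xi>)) has_real_derivative \<xi> \<bullet> (d2A (?\<gamma> t) q q *v \<xi>)) (at t)" for t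
  proof -
    have "((\<lambda>t. \<xi> \<bullet> (dA (?\<gamma> t) q *v \<xi>)) has_derivative (\<lambda>h. \<xi> \<bullet> (d2A (?\<gamma> t) (h *\<^sub>R q) q *v \<xi>))) (at t)"
      by (intro bounded_linear.has_derivative[OF form] has_derivative_compose[where g = "\<lambda>p. dA p q", OF line d2A])
    moreover have "(\<lambda>h. \<xi> \<bullet> (d2A (?\<gamma> t) (h *\<^sub>R q) q *v \<xi>)) = (*) (\<xi> \<bullet> (d2A (?\<gamma> t) q q *v \<xi>))"
      by (auto simp: bounded_bilinear.scaleR_left[OF bil] scaleR_matrix_vector_assoc[symmetric])
    ultimately show ?thesis by (simp add: has_field_derivative_def)
  qed
  define \<phi> where "\<phi> t = \<xi> \<bullet> (A x z (?\<gamma> t) *v \<xi>) + D * t\<^sup>2 / 2" for t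
  have "convex_on {0..1} \<phi>"
  proof (rule f''_ge0_imp_convex)
    fix t :: real assume t: "t \<in> {0..1}"
    show "(\<phi> has_real_derivative (\<xi> \<bullet> (dA (?\<gamma> t) q *v \<xi>) + D * t)) (at t)"
      unfolding \<phi>_def by (rule DERIV_add[OF d1]) (auto intro!: derivative_eq_intros)
    show "((\<lambda>t. \<xi> \<bullet> (dA (?\<gamma> t) q *v \<xi>) + D * t) has_real_derivative (\<xi> \<bullet> (d2A (?\<gamma> t) q q *v \<xi>) + D)) (at t)"
      by (rule DERIV_add[OF d2]) (auto intro!: derivative_eq_intros)
    have "0 \<le> \<zeta> \<bullet> (d2A (?\<gamma> t) q q *v \<zeta>)" if "\<zeta> \<bullet> q = 0" for \<zeta>
      by (rule regular_A_second_derivative[OF reg x that dA d2A bil])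
    then have "- D \<le> \<xi> \<bullet> (d2A (?\<gamma> t) q q *v \<xi>)"
      unfolding D_def using t C by (intro quadratic_form_codimension_one_bound \<kappa>) auto
    then show "0 \<le> \<xi> \<bullet> (d2A (?\<gamma> t) q q *v \<xi>) + D" by simp
  qed simp
  from convex_onD[OF this, of s 0 1] s
  have "\<phi> s \<le> (1 - s) * \<phi> 0 + s * \<phi> 1" by simp
  moreover have "D * s\<^sup>2 \<ge> 0" using D by simp
  moreover have "s * D \<ge> 0" using D s by simp
  ultimately show ?thesis unfolding \<phi>_def D_def[symmetric] by (simp add: algebra_simps)
qed

section \<open>The comparison principle\<close>

lemma AE_lebesgue_on_off_negligible:
  assumes "AE x in lebesgue_on \<Omega>. P x" "\<Omega> \<in> sets lebesgue"
  obtains N where "negligible N" "\<And>x. x \<in> \<Omega> - N \<Longrightarrow> P x"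
proof -
  have "AE x in lebesgue. x \<in> \<Omega> \<longrightarrow> P x"
    using assms by (subst (asm) AE_restrict_space_iff) auto
  then obtain N where "\<And>x. x \<in> space lebesgue - N \<Longrightarrow> x \<in> \<Omega> \<longrightarrow> P x" "N \<in> null_sets lebesgue"
    by (rule AE_E3) blast
  then show thesis by (intro that[of N]) (auto simp: negligible_iff_null_sets)
qed

lemma C11_closure_imp_loc:
  assumes "C11_closure \<Omega> u"
  shows "C11_loc \<Omega> u"
  using assms unfolding C11_closure_def C11_loc_def
  by (meson inf_le2 lipschitz_on_subset zero_less_one)

lemma C11_loc_imp_continuous:
  assumes "open \<Omega>" "C11_loc \<Omega> u"
  shows "continuous_on \<Omega> u" "continuous_on \<Omega> (grad u)"
proof -
  show "continuous_on \<Omega> u"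
    using assms unfolding C11_loc_def
    by (intro differentiable_imp_continuous_on) (auto simp: differentiable_on_def intro: differentiable_at_withinI)
  show "continuous_on \<Omega> (grad u)"
  proof (rule continuous_at_imp_continuous_on, rule ballI)
    fix x assume x: "x \<in> \<Omega>"
    obtain \<epsilon> L where e: "0 < \<epsilon>" "L-lipschitz_on (ball x \<epsilon> \<inter> \<Omega>) (grad u)"
      using assms(2) x unfolding C11_loc_def by blast
    have "continuous_on (ball x \<epsilon> \<inter> \<Omega>) (grad u)" by (rule lipschitz_on_continuous_on[OF e(2)])
    moreover have "open (ball x \<epsilon> \<inter> \<Omega>)" "x \<in> ball x \<epsilon> \<inter> \<Omega>" using assms(1) x e(1) by auto
    ultimately show "isCont (grad u) x" by (simp add: continuous_on_eq_continuous_at)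
  qed
qed

lemma C2_closure_imp_continuous_on:
  assumes "C2_closure U f"
  shows "continuous_on U f"
proof (rule continuous_on_subset[OF _ closure_subset])
  show "continuous_on (closure U) f" using assms by (simp add: C2_closure_def)
qed

lemma uniformly_continuous_in_p:
  fixes f :: "'a::metric_space \<Rightarrow> real \<Rightarrow> 'b::euclidean_space \<Rightarrow> 'c::real_normed_vector"
  assumes f: "continuous_on (S \<times> UNIV \<times> UNIV) (\<lambda>(x, z, p). f x z p)"
    and K: "compact K" "K \<subseteq> S" and u: "continuous_on K u" and e: "0 < e"
  shows "\<exists>r>0. \<forall>x\<in>K. \<forall>p p'. norm p \<le> P \<longrightarrow> norm p' \<le> P \<longrightarrow> norm (p - p') < r \<longrightarrow>
    norm (f x (u x) p - f x (u x) p') < e"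
proof -
  let ?C = "K \<times> u ` K \<times> cball (0::'b) P" and ?f = "\<lambda>(x, z, p). f x z p"
  have "continuous_on ?C ?f" using f by (rule continuous_on_subset) (use K in auto)
  moreover have "compact ?C" by (intro compact_Times compact_continuous_image compact_cball K u)
  ultimately have "uniformly_continuous_on ?C ?f" by (rule compact_uniformly_continuous)
  then obtain r where r: "0 < r" "\<And>w w'. w \<in> ?C \<Longrightarrow> w' \<in> ?C \<Longrightarrow> dist w' w < r \<Longrightarrow> dist (?f w') (?f w) < e"
    using e unfolding uniformly_continuous_on_def by meson
  show ?thesis
  proof (intro exI[of _ r] conjI ballI allI impI r(1))
    fix x and p p' :: 'b assume "x \<in> K" "norm p \<le> P" "norm p' \<le> P" "norm (p - p') < r"
    then show "norm (f x (u x) p - f x (u x) p') < e"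
      using r(2)[of "(x, u x, p')" "(x, u x, p)"] by (simp add: dist_Pair_Pair dist_norm)
  qed
qed

text \<open>
  How the conditions on \<open>F\<close> are used at a contact point: \<open>R\<close>, \<open>S\<close> and \<open>M\<close> are the values of the operator
  at the subsolution, at the strict subsolution (diminished by \<open>\<delta> I\<close>) and at the supersolution, with
  right-hand sides \<open>b\<close>, \<open>b1\<close> and \<open>c\<close>. That \<open>M\<close> lies in the cone, which the supersolution inequality
  presupposes, is a consequence of \<open>M\<close> dominating a point of the cone.
\<close>

lemma touching_inequality:
  assumes \<Gamma>: "admissible_cone \<Gamma>" and F1: "F1_minus \<Gamma> F" and F2: "F2 \<Gamma> F" and F3: "F3 \<Gamma> a\<^sub>0 F"
    and R: "R \<in> closure \<Gamma>" "a\<^sub>0 = -\<infinity> \<longrightarrow> R \<in> \<Gamma>" "ereal b \<le> F_ext \<Gamma> a\<^sub>0 F R"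
    and S: "S \<in> \<Gamma>" "b1 \<le> F S" and s: "0 < s" "s < 1"
    and psd: "pos_semidef (M - ((1 - s) *\<^sub>R R + s *\<^sub>R S))" and M: "M \<in> \<Gamma> \<longrightarrow> F M \<le> c"
  shows "(1 - s) * b + s * b1 \<le> c"
proof -
  let ?Y = "(1 - s) *\<^sub>R R + s *\<^sub>R S"
  have Y: "?Y \<in> \<Gamma>" by (rule admissible_cone_combination[OF \<Gamma> R(1) S(1) s])
  have "(M - ?Y) + ?Y \<in> \<Gamma>" by (rule admissible_cone_closure_add[OF \<Gamma> pos_semidef_in_closure[OF \<Gamma> psd] Y])
  then have "F M \<le> c" using M by simp
  moreover have "F ?Y \<le> F (?Y + (M - ?Y))" using F1 Y psd unfolding F1_minus_def by blast
  moreover have "(1 - s) * b + s * F S \<le> F ?Y"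
    using F2 F3 R S s unfolding F2_def F3_def by (intro concave_combination_closure[OF \<Gamma>]) auto
  moreover have "s * b1 \<le> s * F S" using S s by simp
  ultimately show ?thesis by simp
qed

lemma quadratic_form_simps:
  fixes M N :: "real^'n^'n"
  shows "\<xi> \<bullet> ((M + N) *v \<xi>) = \<xi> \<bullet> (M *v \<xi>) + \<xi> \<bullet> (N *v \<xi>)"
    "\<xi> \<bullet> ((M - N) *v \<xi>) = \<xi> \<bullet> (M *v \<xi>) - \<xi> \<bullet> (N *v \<xi>)"
    "\<xi> \<bullet> ((c *\<^sub>R M) *v \<xi>) = c * (\<xi> \<bullet> (M *v \<xi>))"
    "\<xi> \<bullet> (mat 1 *v \<xi>) = (norm \<xi>)\<^sup>2"
  by (simp_all add: matrix_vector_mult_add_rdistrib matrix_vector_mult_diff_rdistrib inner_add_right inner_diff_right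
      scaleR_matrix_vector_assoc[symmetric] power2_norm_eq_inner)

theorem theorem4p1:
  fixes \<Omega> :: "(real^'n) set"
    and \<Gamma> :: "(real^'n^'n) set"
    and F :: "real^'n^'n \<Rightarrow> real"
    and a\<^sub>0 :: ereal
    and A :: "real^'n \<Rightarrow> real \<Rightarrow> real^'n \<Rightarrow> real^'n^'n"
    and B :: "real^'n \<Rightarrow> real \<Rightarrow> real^'n \<Rightarrow> real"
    and u v :: "real^'n \<Rightarrow> real"
  assumes "open \<Omega>" and "connected \<Omega>" and "\<Omega> \<noteq> {}" and "bounded \<Omega>"
    and "admissible_cone \<Gamma>"
    and "continuous_on \<Gamma> F" and "F1_minus \<Gamma> F" and "F2 \<Gamma> F" and "F3 \<Gamma> a\<^sub>0 F"
    and "\<forall>x\<in>closure \<Omega>. \<forall>z p. A x z p \<in> sym_mats"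
    and "C2_closure (\<Omega> \<times> UNIV \<times> UNIV) (\<lambda>(x, z, p). A x z p)"
    and "regular_A \<Omega> A" and "nondecreasing_A (closure \<Omega>) A"
    and "C2_closure (\<Omega> \<times> UNIV \<times> UNIV) (\<lambda>(x, z, p). B x z p)"
    and "\<forall>x\<in>closure \<Omega>. \<forall>z p. a\<^sub>0 \<le> ereal (B x z p)"
    and "convex_in_p (closure \<Omega>) B" and "nondecreasing_B (closure \<Omega>) B"
    and "C11_loc \<Omega> u" and "continuous_on (closure \<Omega>) u"
    and "supersolution \<Omega> \<Gamma> F A B u"
    and "C11_loc \<Omega> v" and "continuous_on (closure \<Omega>) v"
    and "subsolution \<Omega> \<Gamma> a\<^sub>0 F A B v"
    and "\<exists>u_bar. C11_closure \<Omega> u_bar \<and> strict_subsolution \<Omega> \<Gamma> F A B u_bar \<and>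
                 (\<forall>x\<in>\<Omega>. u x \<le> u_bar x)"
  shows "(SUP x\<in>\<Omega>. v x - u x) \<le> (SUP x\<in>frontier \<Omega>. max (v x - u x) 0)"
proof -
  note \<Omega> = assms(1) and \<Gamma> = assms(5) and Asym = assms(10) and AC2 = assms(11) and Areg = assms(12) and Amono = assms(13)
    and BC2 = assms(14) and Bconv = assms(16) and Bmono = assms(17)
    and u11 = assms(18) and u_cont = assms(19) and super = assms(20)
    and v11 = assms(21) and v_cont = assms(22) and sub = assms(23)
  obtain u\<^sub>b where ub: "C11_closure \<Omega> u\<^sub>b" "strict_subsolution \<Omega> \<Gamma> F A B u\<^sub>b" "\<And>x. x \<in> \<Omega> \<Longrightarrow> u x \<le> u\<^sub>b x"
    using assms(24) by blast
  have ub11: "C11_loc \<Omega> u\<^sub>b" by (rule C11_closure_imp_loc[OF ub(1)])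
  define m where "m = (SUP x\<in>frontier \<Omega>. max (v x - u x) 0)"
  have cl: "compact (closure \<Omega>)" using assms(4) by (simp add: compact_closure)
  have vu_cont: "continuous_on (closure \<Omega>) (\<lambda>x. v x - u x)" by (intro continuous_intros u_cont v_cont)
  have front: "max (v x - u x) 0 \<le> m" if "x \<in> frontier \<Omega>" for x
    unfolding m_def
  proof (rule cSUP_upper[OF that])
    have "compact (frontier \<Omega>)" using assms(4) by (simp add: compact_frontier_bounded)
    moreover have "continuous_on (frontier \<Omega>) (\<lambda>x. max (v x - u x) 0)"
      by (intro continuous_on_max continuous_on_const continuous_on_subset[OF vu_cont]) (auto simp: frontier_def)
    ultimately show "bdd_above ((\<lambda>x. max (v x - u x) 0) ` frontier \<Omega>)"
      by (intro bounded_imp_bdd_above compact_imp_bounded compact_continuous_image)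
  qed
  have "frontier \<Omega> \<noteq> {}" using frontier_not_empty[OF assms(3)] assms(4) not_bounded_UNIV by metis
  then obtain x2 where "x2 \<in> frontier \<Omega>" by blast
  from front[OF this] have m0: "0 \<le> m" by simp
  have "v x1 - u x1 \<le> m" if x1: "x1 \<in> \<Omega>" for x1
  proof (rule ccontr)
    assume "\<not> v x1 - u x1 \<le> m"
    then have gt: "m < v x1 - u x1" by simp
    (* The level l is positive and lies strictly between the boundary bound and v x1 - u x1. So the
       superlevel set K0 is a compact subset of the domain on which u <= v. *)
    define l where "l = (m + (v x1 - u x1)) / 2"
    define gap where "gap = (v x1 - u x1) - l"
    have l: "m < l" "0 < l" "0 < gap" using gt m0 by (auto simp: l_def gap_def)
    define K0 where "K0 = closure \<Omega> \<inter> (\<lambda>x. v x - u x) -` {l..}"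
    define U where "U = \<Omega> \<inter> (\<lambda>x. v x - u x) -` {l<..}"
    have "closed K0" unfolding K0_def by (intro continuous_closed_preimage vu_cont) auto
    then have K0: "compact K0" using compact_Int_closed[OF cl, of K0] by (simp add: K0_def Int_assoc[symmetric])
    have K0\<Omega>: "K0 \<subseteq> \<Omega>"
    proof
      fix x assume x: "x \<in> K0"
      then have "x \<notin> frontier \<Omega>" using front[of x] l by (auto simp: K0_def)
      then show "x \<in> \<Omega>" using x \<Omega> by (auto simp: K0_def frontier_def interior_open)
    qed
    have \<Omega>cl: "\<Omega> \<subseteq> closure \<Omega>" by (rule closure_subset)
    have U: "open U" "U \<subseteq> K0" "x1 \<in> U"
    proof -
      show "open U" unfolding U_def
        by (intro continuous_open_preimage continuous_on_subset[OF vu_cont \<Omega>cl] \<Omega>) auto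
      show "U \<subseteq> K0" using \<Omega>cl by (auto simp: U_def K0_def)
      show "x1 \<in> U" using x1 l by (simp add: U_def gap_def)
    qed
    have v_gt: "u x \<le> v x" if "x \<in> K0" for x using that l by (auto simp: K0_def)

    note cont = C11_loc_imp_continuous[OF \<Omega>]
    have bdd: "\<exists>b. \<forall>x\<in>K0. norm (f x) \<le> b" if "continuous_on \<Omega> f" for f :: "real^'n \<Rightarrow> 'z::real_normed_vector"
      using compact_imp_bounded[OF compact_continuous_image[OF continuous_on_subset[OF that K0\<Omega>] K0]]
      by (auto simp: bounded_iff)
    obtain P1 where P1: "\<And>x. x \<in> K0 \<Longrightarrow> norm (grad v x) \<le> P1" using bdd[OF cont(2)[OF v11]] by blast
    obtain P2 where P2: "\<And>x. x \<in> K0 \<Longrightarrow> norm (grad u\<^sub>b x) \<le> P2" using bdd[OF cont(2)[OF ub11]] by blast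
    define P where "P = \<bar>P1\<bar> + \<bar>P2\<bar> + 1"
    have P: "norm (grad v x) \<le> P - 1" "norm (grad u\<^sub>b x) \<le> P - 1" if "x \<in> K0" for x
      using P1[OF that] P2[OF that] by (auto simp: P_def)
    obtain W where W: "\<And>x. x \<in> K0 \<Longrightarrow> \<bar>u\<^sub>b x - v x\<bar> \<le> W"
      using bdd[of "\<lambda>x. u\<^sub>b x - v x"] cont(1)[OF v11] cont(1)[OF ub11] by (auto intro: continuous_intros)
    have u_K0: "continuous_on K0 u" by (rule continuous_on_subset[OF cont(1)[OF u11] K0\<Omega>])

    obtain dA d2A where
      dA: "\<And>x z p. x \<in> \<Omega> \<Longrightarrow> (A x z has_derivative dA x z p) (at p)"
      and d2A: "\<And>x z p q. x \<in> \<Omega> \<Longrightarrow> ((\<lambda>p. dA x z p q) has_derivative (\<lambda>r. d2A x z p r q)) (at p)"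
      and bil: "\<And>x z p. bounded_bilinear (d2A x z p)"
      and d2A_bdd: "\<And>S. compact S \<Longrightarrow> S \<subseteq> \<Omega> \<times> UNIV \<times> UNIV \<Longrightarrow>
         \<exists>C\<ge>0. \<forall>(x, z, p)\<in>S. \<forall>r q. norm (d2A x z p r q) \<le> C * norm r * norm q"
      by (rule C2_closure_p_derivatives[OF AC2]) (rule that)
    have "compact (K0 \<times> u ` K0 \<times> cball (0 :: real^'n) P)"
      by (intro compact_Times compact_continuous_image compact_cball K0 u_K0)
    from d2A_bdd[OF this] K0\<Omega> obtain C where C0: "0 \<le> C"
      and C: "\<And>x p r q. x \<in> K0 \<Longrightarrow> norm p \<le> P \<Longrightarrow> norm (d2A x (u x) p r q) \<le> C * norm r * norm q"
      by fastforce
    obtain \<delta> \<delta>' where \<delta>: "0 < \<delta>" "0 < \<delta>'" and strict: "AE x in lebesgue_on \<Omega>.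
        Mop A u\<^sub>b x - \<delta> *\<^sub>R mat 1 \<in> \<Gamma> \<and> F (Mop A u\<^sub>b x - \<delta> *\<^sub>R mat 1) \<ge> B x (u\<^sub>b x) (grad u\<^sub>b x) + \<delta>'"
      using ub(2) unfolding strict_subsolution_def by blast

    (* kappa is fixed by kappa |q|^2 <= delta / 2, where |q| <= 2 P on K0, and k by k >= C + C^2 / kappa.
       Since k is needed before tau, the bound s <= 1/2 and the requirement that the maximum stay
       away from the edge of K0 are both imposed on tau. *)
    define \<kappa> where "\<kappa> = \<delta> / (2 * (2 * P)\<^sup>2)"
    have Pge: "1 \<le> P" by (simp add: P_def)
    have \<kappa>: "0 < \<kappa>" "\<kappa> * (2 * P)\<^sup>2 = \<delta> / 2" using \<delta> Pge by (simp_all add: \<kappa>_def)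
    define k where "k = C + C\<^sup>2 / \<kappa> + 1"
    have k: "0 < k" using C0 \<kappa> by (simp add: k_def add_nonneg_pos)
    define \<tau> where "\<tau> = min (1 / (2 * k * exp (k * W))) (gap / (2 * exp (k * W)))"
    have \<tau>: "0 < \<tau>" using k l by (simp add: \<tau>_def)
    define E where "E x = exp (k * (u\<^sub>b x - v x))" for x
    define s where "s x = \<tau> * k * E x" for x
    define s\<^sub>0 where "s\<^sub>0 = \<tau> * k * exp (- (k * W))"
    have s0: "0 < s\<^sub>0" using \<tau> k by (simp add: s\<^sub>0_def)
    have E_le: "E x \<le> exp (k * W)" "exp (- (k * W)) \<le> E x" if "x \<in> K0" for x
    proof -
      have "\<bar>k * (u\<^sub>b x - v x)\<bar> \<le> k * W" using W[OF that] k by (simp add: abs_mult)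
      then show "E x \<le> exp (k * W)" "exp (- (k * W)) \<le> E x" by (auto simp: E_def)
    qed
    have s_bd: "s\<^sub>0 \<le> s x" "s x \<le> 1 / 2" if "x \<in> K0" for x
    proof -
      show "s\<^sub>0 \<le> s x" unfolding s_def s\<^sub>0_def using E_le(2)[OF that] \<tau> k by simp
      have "s x \<le> \<tau> * k * exp (k * W)" unfolding s_def using E_le(1)[OF that] \<tau> k by simp
      also have "\<dots> \<le> (1 / (2 * k * exp (k * W))) * k * exp (k * W)"
        using k by (intro mult_right_mono) (auto simp: \<tau>_def)
      also have "\<dots> = 1 / 2" using k by simp
      finally show "s x \<le> 1 / 2" .
    qed
    have \<tau>E: "\<tau> * E x \<le> gap / 2" if "x \<in> K0" for x
    proof -
      have "\<tau> * E x \<le> (gap / (2 * exp (k * W))) * exp (k * W)"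
        using E_le(1)[OF that] l by (intro mult_mono) (auto simp: \<tau>_def E_def)
      also have "\<dots> = gap / 2" by simp
      finally show ?thesis .
    qed
    have "0 < s\<^sub>0 * \<delta> / 2" "0 < s\<^sub>0 * \<delta>' / 2" using s0 \<delta> by simp_all
    note uniform = uniformly_continuous_in_p[OF C2_closure_imp_continuous_on K0 K0\<Omega> u_K0, where P = P]
    obtain rA where rA: "0 < rA" "\<forall>x\<in>K0. \<forall>p p'. norm p \<le> P \<longrightarrow> norm p' \<le> P \<longrightarrow> norm (p - p') < rA \<longrightarrow>
        norm (A x (u x) p - A x (u x) p') < s\<^sub>0 * \<delta> / 2"
      using uniform[OF AC2 \<open>0 < s\<^sub>0 * \<delta> / 2\<close>] by (elim exE conjE)
    obtain rB where rB: "0 < rB" "\<forall>x\<in>K0. \<forall>p p'. norm p \<le> P \<longrightarrow> norm p' \<le> P \<longrightarrow> norm (p - p') < rB \<longrightarrow>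
        norm (B x (u x) p - B x (u x) p') < s\<^sub>0 * \<delta>' / 2"
      using uniform[OF BC2 \<open>0 < s\<^sub>0 * \<delta>' / 2\<close>] by (elim exE conjE)

    have \<Omega>_sets: "\<Omega> \<in> sets lebesgue" using \<Omega> by simp
    obtain Nu where Nu: "negligible Nu" "\<And>x. x \<in> \<Omega> - Nu \<Longrightarrow> (grad u has_derivative (\<lambda>h. hess u x *v h)) (at x) \<and> hess u x \<in> sym_mats"
      using C11_loc_hess_AE[OF \<Omega> u11] by metis
    obtain Nv where Nv: "negligible Nv" "\<And>x. x \<in> \<Omega> - Nv \<Longrightarrow> (grad v has_derivative (\<lambda>h. hess v x *v h)) (at x) \<and> hess v x \<in> sym_mats"
      using C11_loc_hess_AE[OF \<Omega> v11] by metis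
    obtain Nb where Nb: "negligible Nb" "\<And>x. x \<in> \<Omega> - Nb \<Longrightarrow> (grad u\<^sub>b has_derivative (\<lambda>h. hess u\<^sub>b x *v h)) (at x) \<and> hess u\<^sub>b x \<in> sym_mats"
      using C11_loc_hess_AE[OF \<Omega> ub11] by metis
    obtain N1 where N1: "negligible N1" "\<And>x. x \<in> \<Omega> - N1 \<Longrightarrow> Mop A u x \<in> \<Gamma> \<longrightarrow> F (Mop A u x) \<le> B x (u x) (grad u x)"
      using AE_lebesgue_on_off_negligible[OF super[unfolded supersolution_def] \<Omega>_sets] by metis
    obtain N2 where N2: "negligible N2" "\<And>x. x \<in> \<Omega> - N2 \<Longrightarrow> Mop A v x \<in> closure \<Gamma> \<and> (a\<^sub>0 = -\<infinity> \<longrightarrow> Mop A v x \<in> \<Gamma>) \<and>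
        F_ext \<Gamma> a\<^sub>0 F (Mop A v x) \<ge> ereal (B x (v x) (grad v x))"
      using AE_lebesgue_on_off_negligible[OF sub[unfolded subsolution_def] \<Omega>_sets] by metis
    obtain N3 where N3: "negligible N3" "\<And>x. x \<in> \<Omega> - N3 \<Longrightarrow> Mop A u\<^sub>b x - \<delta> *\<^sub>R mat 1 \<in> \<Gamma> \<and>
        F (Mop A u\<^sub>b x - \<delta> *\<^sub>R mat 1) \<ge> B x (u\<^sub>b x) (grad u\<^sub>b x) + \<delta>'"
      using AE_lebesgue_on_off_negligible[OF strict \<Omega>_sets] by metis
    define N where "N = Nu \<union> Nv \<union> Nb \<union> N1 \<union> N2 \<union> N3"
    have N: "negligible N" unfolding N_def by (intro negligible_Un Nu(1) Nv(1) Nb(1) N1(1) N2(1) N3(1))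

    define q where "q x = grad u\<^sub>b x - grad v x" for x
    define \<psi> where "\<psi> x = v x - u x + \<tau> * E x" for x
    define g where "g x = grad v x - grad u x + s x *\<^sub>R q x" for x
    have du: "(u has_derivative (\<lambda>h. grad u x \<bullet> h)) (at x)"
      and dv: "(v has_derivative (\<lambda>h. grad v x \<bullet> h)) (at x)"
      and db: "(u\<^sub>b has_derivative (\<lambda>h. grad u\<^sub>b x \<bullet> h)) (at x)" if "x \<in> \<Omega>" for x
      using u11 v11 ub11 that unfolding C11_loc_def by (auto intro: has_derivative_grad)
    have dE: "(E has_derivative (\<lambda>h. E x * (k * (q x \<bullet> h)))) (at x)" if "x \<in> \<Omega>" for x
    proof -
      have "((\<lambda>x. exp (k * (u\<^sub>b x - v x))) has_derivative (\<lambda>h. exp (k * (u\<^sub>b x - v x)) * (k * (grad u\<^sub>b x \<bullet> h - grad v x \<bullet> h)))) (at x)"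
        by (auto intro!: derivative_eq_intros dv[OF that] db[OF that])
      then show ?thesis by (simp add: E_def[abs_def] q_def inner_diff_left)
    qed
    have ds: "(s has_derivative (\<lambda>h. s x * k * (q x \<bullet> h))) (at x)" if "x \<in> \<Omega>" for x
      unfolding s_def using has_derivative_mult_right[OF dE[OF that], of "\<tau> * k"] by (simp add: mult_ac)
    have d\<psi>: "(\<psi> has_derivative (\<lambda>h. g x \<bullet> h)) (at x)" if "x \<in> \<Omega>" for x
    proof -
      have "(\<psi> has_derivative (\<lambda>h. grad v x \<bullet> h - grad u x \<bullet> h + \<tau> * (E x * (k * (q x \<bullet> h))))) (at x)"
        unfolding \<psi>_def by (intro has_derivative_add has_derivative_diff has_derivative_mult_right dE du dv that)
      then show ?thesis by (simp add: g_def s_def inner_add_left inner_diff_left mult_ac)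
    qed
    have g_lip: "pointwise_Lipschitz_at g x" if "x \<in> \<Omega>" for x
      unfolding g_def q_def
      by (intro pointwise_Lipschitz_at_add pointwise_Lipschitz_at_diff pointwise_Lipschitz_at_scaleR
          C11_loc_grad_pointwise_Lipschitz[OF \<Omega> _ that] u11 v11 ub11
          has_derivative_imp_pointwise_Lipschitz_at[OF ds[OF that]])
    have U\<Omega>: "U \<subseteq> \<Omega>" by (simp add: U_def)
    (* The contact gradient must be small enough that replacing p by grad u changes A and B by no more
       than half of the slack s delta, s delta'. *)
    define r where "r = Min {1, rA, rB}"
    have r: "0 < r" "r \<le> 1" "r \<le> rA" "r \<le> rB" using rA(1) rB(1) by (auto simp: r_def)
    obtain x where xUN: "x \<in> U - N" and gx: "norm (g x) < r"
      and max: "\<And>y. y \<in> U \<Longrightarrow> \<psi> y - g x \<bullet> y \<le> \<psi> x - g x \<bullet> x"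
    proof (rule contact_point_off_negligible[OF K0 U])
      show "continuous_on K0 \<psi>"
      proof (rule continuous_at_imp_continuous_on, rule ballI)
        fix x assume "x \<in> K0"
        then show "isCont \<psi> x" using d\<psi> K0\<Omega> has_derivative_continuous by blast
      qed
      fix x assume x: "x \<in> K0 - U"
      then have "v x - u x \<le> l" using K0\<Omega> by (auto simp: U_def)
      then have "\<psi> x \<le> l + gap / 2" using \<tau>E[of x] x by (simp add: \<psi>_def)
      also have "\<dots> < l + gap" using l by simp
      also have "\<dots> \<le> \<psi> x1" using \<tau> by (simp add: gap_def \<psi>_def E_def)
      finally show "\<psi> x < \<psi> x1" .
    qed (use d\<psi> g_lip U\<Omega> N r in auto)
    have x: "x \<in> U" "x \<in> K0" "x \<in> \<Omega>" "x \<in> closure \<Omega>" using xUN U U\<Omega> \<Omega>cl by auto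
    have Hu: "(grad u has_derivative (\<lambda>h. hess u x *v h)) (at x)" "hess u x \<in> sym_mats"
      and Hv: "(grad v has_derivative (\<lambda>h. hess v x *v h)) (at x)" "hess v x \<in> sym_mats"
      and Hb: "(grad u\<^sub>b has_derivative (\<lambda>h. hess u\<^sub>b x *v h)) (at x)" "hess u\<^sub>b x \<in> sym_mats"
      using Nu(2) Nv(2) Nb(2) xUN x(3) by (auto simp: N_def)
    have dg: "(g has_derivative (\<lambda>h. hess v x *v h - hess u x *v h
        + (s x *\<^sub>R (hess u\<^sub>b x *v h - hess v x *v h) + (s x * k * (q x \<bullet> h)) *\<^sub>R q x))) (at x)"
      unfolding g_def q_def
      by (intro has_derivative_add has_derivative_diff has_derivative_scaleR Hu Hv Hb ds[OF x(3), unfolded q_def])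
    (* The exponential contributes the term with (\<xi> \<bullet> q)^2, which will absorb the defect of convexity of A. *)
    have hess_le: "(1 - s x) * (\<xi> \<bullet> (hess v x *v \<xi>)) + s x * (\<xi> \<bullet> (hess u\<^sub>b x *v \<xi>)) + s x * k * (\<xi> \<bullet> q x)\<^sup>2
        \<le> \<xi> \<bullet> (hess u x *v \<xi>)" for \<xi>
      using second_derivative_nonpos_at_max[OF U(1) x(1) d\<psi> dg max, of \<xi>] U\<Omega>
      by (auto simp: inner_add_left inner_diff_left inner_commute[of _ \<xi>] algebra_simps power2_eq_square)
    have s: "0 < s x" "s x < 1" "s\<^sub>0 \<le> s x" using s_bd[OF x(2)] s0 by auto
    define p where "p = grad v x + s x *\<^sub>R q x"
    have p_comb: "p = (1 - s x) *\<^sub>R grad v x + s x *\<^sub>R grad u\<^sub>b x" by (simp add: p_def q_def algebra_simps)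
    have p_norm: "norm (grad v x + t *\<^sub>R q x) \<le> P - 1" if t: "0 \<le> t" "t \<le> 1" for t
    proof -
      have "grad v x + t *\<^sub>R q x = (1 - t) *\<^sub>R grad v x + t *\<^sub>R grad u\<^sub>b x" by (simp add: q_def algebra_simps)
      then have "norm (grad v x + t *\<^sub>R q x) \<le> (1 - t) * norm (grad v x) + t * norm (grad u\<^sub>b x)"
        using norm_triangle_ineq[of "(1 - t) *\<^sub>R grad v x" "t *\<^sub>R grad u\<^sub>b x"] t by simp
      also have "\<dots> \<le> (1 - t) * (P - 1) + t * (P - 1)" using P[OF x(2)] t by (intro add_mono mult_left_mono) auto
      finally show ?thesis by (simp add: algebra_simps)
    qed
    have pg: "p - grad u x = g x" by (simp add: p_def g_def)
    have p_le: "norm p \<le> P" using p_norm[of "s x"] s by (simp add: p_def)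
    have gu_le: "norm (grad u x) \<le> P"
    proof -
      have "grad u x = p - g x" using pg by (simp add: algebra_simps)
      then have "norm (grad u x) \<le> norm p + norm (g x)" using norm_triangle_ineq4 by metis
      then show ?thesis using p_norm[of "s x"] s gx r by (simp add: p_def)
    qed
    have A_close: "norm (A x (u x) p - A x (u x) (grad u x)) \<le> s x * (\<delta> / 2)"
    proof -
      have "norm (A x (u x) p - A x (u x) (grad u x)) < s\<^sub>0 * \<delta> / 2"
        by (rule rA(2)[rule_format, OF x(2) p_le gu_le]) (use pg gx r in simp)
      also have "\<dots> \<le> s x * (\<delta> / 2)" using s \<delta> by simp
      finally show ?thesis by simp
    qed
    have B_close: "\<bar>B x (u x) p - B x (u x) (grad u x)\<bar> < s x * \<delta>'"
    proof -
      have "norm (B x (u x) p - B x (u x) (grad u x)) < s\<^sub>0 * \<delta>' / 2"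
        by (rule rB(2)[rule_format, OF x(2) p_le gu_le]) (use pg gx r in simp)
      also have "\<dots> \<le> s x * \<delta>'" using s s0 \<delta> by (simp add: mult_mono)
      finally show ?thesis by simp
    qed
    have q_le: "\<kappa> * (norm (q x))\<^sup>2 \<le> \<delta> / 2"
    proof -
      have "norm (q x) \<le> 2 * P" using norm_triangle_ineq4[of "grad u\<^sub>b x" "grad v x"] P[OF x(2)] by (simp add: q_def)
      then have "\<kappa> * (norm (q x))\<^sup>2 \<le> \<kappa> * (2 * P)\<^sup>2" using \<kappa>(1) by (intro mult_left_mono power_mono) auto
      then show ?thesis using \<kappa>(2) by simp
    qed
    let ?\<eta> = "Mop A u x - ((1 - s x) *\<^sub>R Mop A v x + s x *\<^sub>R (Mop A u\<^sub>b x - \<delta> *\<^sub>R mat 1))"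
    have "pos_semidef ?\<eta>"
      unfolding pos_semidef_def
    proof (intro conjI allI)
      have "mat 1 \<in> (sym_mats :: (real^'n^'n) set)" by (simp add: sym_mats_def transpose_mat)
      then show "?\<eta> \<in> sym_mats"
        unfolding Mop_def using Hu(2) Hv(2) Hb(2) Asym x(4)
        by (intro subspace_diff[OF subspace_sym_mats] subspace_add[OF subspace_sym_mats] subspace_scale[OF subspace_sym_mats]) auto
      fix \<xi> :: "real^'n"
      define Q where "Q M = \<xi> \<bullet> (M *v \<xi>)" for M :: "real^'n^'n"
      have Av: "(1 - s x) * Q (A x (u x) (grad v x)) \<le> (1 - s x) * Q (A x (v x) (grad v x))"
      proof (rule mult_left_mono)
        have "pos_semidef (A x (v x) (grad v x) - A x (u x) (grad v x))"
          using Amono x(4) v_gt[OF x(2)] unfolding nondecreasing_A_def by blast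
        then show "Q (A x (u x) (grad v x)) \<le> Q (A x (v x) (grad v x))"
          unfolding pos_semidef_def Q_def by (simp add: quadratic_form_simps)
      qed (use s in simp)
      have Ab: "s x * Q (A x (u x) (grad u\<^sub>b x)) \<le> s x * Q (A x (u\<^sub>b x) (grad u\<^sub>b x))"
      proof (rule mult_left_mono)
        have "pos_semidef (A x (u\<^sub>b x) (grad u\<^sub>b x) - A x (u x) (grad u\<^sub>b x))"
          using Amono x(4) ub(3)[OF x(3)] unfolding nondecreasing_A_def by blast
        then show "Q (A x (u x) (grad u\<^sub>b x)) \<le> Q (A x (u\<^sub>b x) (grad u\<^sub>b x))"
          unfolding pos_semidef_def Q_def by (simp add: quadratic_form_simps)
      qed (use s in simp)
      have seg: "- (s x * (\<kappa> * (norm (q x))\<^sup>2 * (norm \<xi>)\<^sup>2 + (C + C\<^sup>2 / \<kappa>) * (\<xi> \<bullet> q x)\<^sup>2))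
          \<le> (1 - s x) * Q (A x (u x) (grad v x)) + s x * Q (A x (u x) (grad v x + q x)) - Q (A x (u x) p)"
        unfolding Q_def p_def
      proof (rule regular_A_segment[OF Areg x(3) dA[OF x(3)] d2A[OF x(3)] bil C0 _ \<kappa>(1)])
        fix t :: real assume t: "0 \<le> t" "t \<le> 1"
        show "norm (d2A x (u x) (grad v x + t *\<^sub>R q x) (q x) (q x)) \<le> C * (norm (q x))\<^sup>2"
          using C[OF x(2), of "grad v x + t *\<^sub>R q x" "q x" "q x"] p_norm[OF t] by (simp add: power2_eq_square)
      qed (use s in auto)
      have close: "Q (A x (u x) (grad u x)) - Q (A x (u x) p) \<le> s x * (\<delta> / 2) * (norm \<xi>)\<^sup>2"
      proof -
        have "\<bar>Q (A x (u x) p - A x (u x) (grad u x))\<bar> \<le> norm (A x (u x) p - A x (u x) (grad u x)) * norm \<xi> * norm \<xi>"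
          unfolding Q_def by (rule abs_quadratic_form_le)
        also have "\<dots> \<le> s x * (\<delta> / 2) * norm \<xi> * norm \<xi>" using A_close by (intro mult_right_mono) auto
        also have "\<dots> = s x * (\<delta> / 2) * (norm \<xi>)\<^sup>2" by (simp add: power2_eq_square)
        also have "Q (A x (u x) p - A x (u x) (grad u x)) = Q (A x (u x) p) - Q (A x (u x) (grad u x))"
          unfolding Q_def by (rule quadratic_form_simps)
        finally show ?thesis by linarith
      qed
      have small: "s x * (\<kappa> * (norm (q x))\<^sup>2 * (norm \<xi>)\<^sup>2) \<le> s x * (\<delta> / 2 * (norm \<xi>)\<^sup>2)"
        using q_le s by (intro mult_left_mono mult_right_mono) auto
      have kk: "s x * ((C + C\<^sup>2 / \<kappa>) * (\<xi> \<bullet> q x)\<^sup>2) \<le> s x * (k * (\<xi> \<bullet> q x)\<^sup>2)"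
        using s by (intro mult_left_mono mult_right_mono) (auto simp: k_def)
      have gb: "grad v x + q x = grad u\<^sub>b x" by (simp add: q_def)
      have "\<xi> \<bullet> (?\<eta> *v \<xi>) = Q (hess u x) - Q (A x (u x) (grad u x))
          - ((1 - s x) * (Q (hess v x) - Q (A x (v x) (grad v x)))
             + s x * (Q (hess u\<^sub>b x) - Q (A x (u\<^sub>b x) (grad u\<^sub>b x)) - \<delta> * (norm \<xi>)\<^sup>2))"
        unfolding Mop_def Q_def by (simp only: quadratic_form_simps)
      moreover have "(1 - s x) * Q (hess v x) + s x * Q (hess u\<^sub>b x) + s x * k * (\<xi> \<bullet> q x)\<^sup>2 \<le> Q (hess u x)"
        unfolding Q_def by (rule hess_le)
      ultimately show "0 \<le> \<xi> \<bullet> (?\<eta> *v \<xi>)"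
        using Av Ab seg[unfolded gb] close small kk by (simp add: algebra_simps)
    qed
    then have "(1 - s x) * B x (v x) (grad v x) + s x * (B x (u\<^sub>b x) (grad u\<^sub>b x) + \<delta>') \<le> B x (u x) (grad u x)"
      using N1(2) N2(2) N3(2) xUN x(3) s
      by (intro touching_inequality[OF \<Gamma> assms(7-9), where R = "Mop A v x" and S = "Mop A u\<^sub>b x - \<delta> *\<^sub>R mat 1" and M = "Mop A u x"])
        (auto simp: N_def)
    moreover have "B x (u x) (grad v x) \<le> B x (v x) (grad v x)" "B x (u x) (grad u\<^sub>b x) \<le> B x (u\<^sub>b x) (grad u\<^sub>b x)"
      using Bmono x(4) v_gt[OF x(2)] ub(3)[OF x(3)] unfolding nondecreasing_B_def by (auto dest: monoD)
    then have "(1 - s x) * B x (u x) (grad v x) \<le> (1 - s x) * B x (v x) (grad v x)"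
      "s x * B x (u x) (grad u\<^sub>b x) \<le> s x * B x (u\<^sub>b x) (grad u\<^sub>b x)"
      using s by (auto intro: mult_left_mono)
    moreover have "B x (u x) p \<le> (1 - s x) * B x (u x) (grad v x) + s x * B x (u x) (grad u\<^sub>b x)"
    proof -
      have "convex_on UNIV (B x (u x))" using Bconv x(4) unfolding convex_in_p_def by blast
      from convex_onD[OF this, of "s x" "grad v x" "grad u\<^sub>b x"] show ?thesis using s unfolding p_comb by simp
    qed
    ultimately show False using B_close by (simp add: algebra_simps)
  qed
  then have "(SUP x\<in>\<Omega>. v x - u x) \<le> m"
    by (intro cSUP_least assms(3))
  then show ?thesis by (simp add: m_def)
qed

end
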